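(* Consider a multi-class $M/G/1$ queue with classes $\{1,\dots,N\}$, where class-$n$ update packets arrive according to a Poisson process of rate $\lambda_n>0$ and have i.i.d. service times with mean $x_n$ and second moment $y_n$. Assume $\rho\triangleq\sum_{j=1}^N\lambda_jx_j<1$. Then for every class $n$ the peak age-of-information is $$A^{mg1}_{p,n}=\frac{1}{\lambda_n}+x_n+\frac{\sum_{j=1}^N\lambda_jy_j}{2\left(1-\sum_{j=1}^N\lambda_jx_j\right)}.$$
   Context: The system is a single-server queue shared by $N$ entities (classes) $1,\dots,N$. Class-$n$ packets are status-update packets of entity $n$; an arrival of a class-$n$ packet to the queue is the generation of that packet, and its departure (service completion) is its reception at the destination. The class arrival processes are independent Poisson processes; service times are independent across packets and independent of the arrivals. In the $M/G/1$ system packets arriving while the server is busy are queued (infinite buffer) and served in first-come-first-served order. The status age $\Delta_n(t)$ of entity $n$ at time $t$ is the time elapsed since the generation of its latest received update packet, i.e. $t$ minus the generation time of that packet. It grows at unit rate and drops at each instant at which a class-$n$ packet is received. Let $A_{nk}$ be the $k$-th peak value of $\Delta_n$, i.e. its value just before its $k$-th drop. The peak age-of-information (PAoI) of entity $n$ is $$A_{p,n}\triangleq\lim_{K\to\infty}\frac1K\sum_{k=1}^KA_{nk}.$$ The superscript $mg1$ indicates the $M/G/1$ system.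
   Formalization: Service times are assumed almost surely strictly positive; if they may be zero, several class-n packets can be received at the same instant, giving a single drop of the age, and the formula fails. *)

theory Defs
  imports "HOL-Probability.Probability"
begin

text \<open>A packet is a pair \<open>(n, k)\<close>: the \<open>k\<close>-th packet (counted from 0) of class \<open>n\<close>.
  The queue is first described for one sample path, given by the generation times \<open>a\<close> and the
  service times \<open>s\<close> of the packets.\<close>

definition packets :: "nat \<Rightarrow> (nat \<times> nat) set" where
  "packets N = {1..N} \<times> UNIV"

text \<open>Positions in the common arrival order start at 1. The definitions make sense if arrival
  times are pairwise distinct and only finitely many lie in each bounded interval, which almost
  surely is the case for independent Poisson arrivals.\<close>

definition queue_position :: "nat \<Rightarrow> (nat \<times> nat \<Rightarrow> real) \<Rightarrow> nat \<times> nat \<Rightarrow> nat" where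
  "queue_position N a p = card {q \<in> packets N. a q \<le> a p}"

definition packet_at :: "nat \<Rightarrow> (nat \<times> nat \<Rightarrow> real) \<Rightarrow> nat \<Rightarrow> nat \<times> nat" where
  "packet_at N a j = (THE p. p \<in> packets N \<and> queue_position N a p = j)"

text \<open>\<open>completion_time N a s j\<close> is the time at which the server has finished the first \<open>j\<close> packets
  in order of arrival; the system is empty at time 0.\<close>

primrec completion_time ::
    "nat \<Rightarrow> (nat \<times> nat \<Rightarrow> real) \<Rightarrow> (nat \<times> nat \<Rightarrow> real) \<Rightarrow> nat \<Rightarrow> real" where
  "completion_time N a s 0 = 0"
| "completion_time N a s (Suc j) =
     max (completion_time N a s j) (a (packet_at N a (Suc j))) + s (packet_at N a (Suc j))"

definition fcfs_departure ::
    "nat \<Rightarrow> (nat \<times> nat \<Rightarrow> real) \<Rightarrow> (nat \<times> nat \<Rightarrow> real) \<Rightarrow> nat \<times> nat \<Rightarrow> real" where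
  "fcfs_departure N a s p = completion_time N a s (queue_position N a p)"

text \<open>Age at time \<open>t\<close> of an entity whose \<open>k\<close>-th packet is generated at time \<open>g k\<close> and received at
  time \<open>d k\<close>. Before the first reception, the age is counted from a fictitious update
  generated at time \<open>- \<delta>\<close>.\<close>

definition status_age :: "real \<Rightarrow> (nat \<Rightarrow> real) \<Rightarrow> (nat \<Rightarrow> real) \<Rightarrow> real \<Rightarrow> real" where
  "status_age \<delta> g d t =
     (if \<exists>k. d k \<le> t then t - g (arg_max d (\<lambda>k. d k \<le> t)) else t + \<delta>)"

definition drop_times :: "(real \<Rightarrow> real) \<Rightarrow> real set" where
  "drop_times f = {t. \<exists>l. (f \<longlongrightarrow> l) (at_left t) \<and> f t < l}"

text \<open>Drops and peaks are counted from 1.\<close>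

definition nth_drop :: "(real \<Rightarrow> real) \<Rightarrow> nat \<Rightarrow> real" where
  "nth_drop f k = (THE t. t \<in> drop_times f \<and> card {u \<in> drop_times f. u \<le> t} = k)"

definition peak :: "(real \<Rightarrow> real) \<Rightarrow> nat \<Rightarrow> real" where
  "peak f k = Lim (at_left (nth_drop f k)) f"

text \<open>\<open>T n k\<close> is the time between the generations of the packets \<open>k - 1\<close> and \<open>k\<close> of class \<open>n\<close> (from
  time 0 if \<open>k = 0\<close>); the arrivals of class \<open>n\<close> form a Poisson process of rate \<open>lam n\<close> because
  these times are independent and exponentially distributed. \<open>S n k\<close> are the service times.

  If service times could vanish, several packets of a class could be received at the
  same instant, producing only one drop of the age.\<close>

locale multiclass_MG1 = prob_space M for M :: "'a measure" +
  fixes N :: nat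
    and lam x y :: "nat \<Rightarrow> real"
    and T S :: "nat \<Rightarrow> nat \<Rightarrow> 'a \<Rightarrow> real"
  assumes rate_pos: "\<And>n. n \<in> {1..N} \<Longrightarrow> 0 < lam n"
    and interarrival_exponential:
      "\<And>n k. n \<in> {1..N} \<Longrightarrow> distributed M lborel (T n k) (exponential_density (lam n))"
    and service_identical:
      "\<And>n k. n \<in> {1..N} \<Longrightarrow> distr M borel (S n k) = distr M borel (S n 0)"
    and service_pos: "\<And>n k. n \<in> {1..N} \<Longrightarrow> AE \<omega> in M. 0 < S n k \<omega>"
    and service_mean: "\<And>n k. n \<in> {1..N} \<Longrightarrow> has_bochner_integral M (S n k) (x n)"
    and service_second_moment:
      "\<And>n k. n \<in> {1..N} \<Longrightarrow> has_bochner_integral M (\<lambda>\<omega>. (S n k \<omega>)\<^sup>2) (y n)"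
    and independent:
      "indep_vars (\<lambda>_. borel)
         (\<lambda>i. case i of Inl (n, k) \<Rightarrow> T n k | Inr (n, k) \<Rightarrow> S n k)
         (packets N <+> packets N)"

definition generation_time :: "(nat \<Rightarrow> nat \<Rightarrow> 'a \<Rightarrow> real) \<Rightarrow> 'a \<Rightarrow> nat \<times> nat \<Rightarrow> real" where
  "generation_time T \<omega> = (\<lambda>(n, k). \<Sum>i\<le>k. T n i \<omega>)"

definition reception_time ::
    "nat \<Rightarrow> (nat \<Rightarrow> nat \<Rightarrow> 'a \<Rightarrow> real) \<Rightarrow> (nat \<Rightarrow> nat \<Rightarrow> 'a \<Rightarrow> real) \<Rightarrow> 'a \<Rightarrow> nat \<times> nat \<Rightarrow> real" where
  "reception_time N T S \<omega> = fcfs_departure N (generation_time T \<omega>) (\<lambda>(n, k). S n k \<omega>)"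

definition entity_age ::
    "nat \<Rightarrow> (nat \<Rightarrow> nat \<Rightarrow> 'a \<Rightarrow> real) \<Rightarrow> (nat \<Rightarrow> nat \<Rightarrow> 'a \<Rightarrow> real) \<Rightarrow> (nat \<Rightarrow> real) \<Rightarrow> nat \<Rightarrow> 'a
      \<Rightarrow> real \<Rightarrow> real" where
  "entity_age N T S \<delta> n \<omega> =
     status_age (\<delta> n) (\<lambda>k. generation_time T \<omega> (n, k)) (\<lambda>k. reception_time N T S \<omega> (n, k))"

text \<open>The peak age-of-information is an almost sure limit of averages; the predicate states that
  the limit exists and is the number \<open>A\<close>.\<close>

definition has_peak_age ::
    "'a measure \<Rightarrow> nat \<Rightarrow> (nat \<Rightarrow> nat \<Rightarrow> 'a \<Rightarrow> real) \<Rightarrow> (nat \<Rightarrow> nat \<Rightarrow> 'a \<Rightarrow> real) \<Rightarrow> (nat \<Rightarrow> real) \<Rightarrow> nat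
      \<Rightarrow> real \<Rightarrow> bool" where
  "has_peak_age M N T S \<delta> n A \<longleftrightarrow>
     (AE \<omega> in M. (\<lambda>K. 1 / real K * (\<Sum>k=1..K. peak (entity_age N T S \<delta> n \<omega>) k)) \<longlonglongrightarrow> A)"

end

theory Submission
  imports Defs "HOL-Probability.Probability" "HOL-Real_Asymp.Real_Asymp"
begin

text \<open>
The \<open>k\<close>-th peak of the age of class \<open>n\<close> is the time between two generations plus the waiting and
the service time of a packet, so everything rests on the average waiting time of class \<open>n\<close>. The
identity \<open>area t + (W t)\<^sup>2 / 2 = (\<Sum>packets. w * s + s\<^sup>2 / 2)\<close> for the workload \<open>W\<close> expresses the
area below \<open>W\<close> through the waiting times \<open>w\<close> and the service times \<open>s\<close> of the packets that arrived
before \<open>t\<close>. In the long run \<open>w * s\<close> may be replaced by \<open>w * x j\<close> for class \<open>j\<close>, since \<open>w\<close> does not depend on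
\<open>s\<close>, and the sum of the \<open>w\<close> of class \<open>j\<close> by \<open>lam j * area t\<close>, since Poisson arrivals see time
averages. This leaves a linear equation for the limit of \<open>area t / t\<close>.

The classes are never merged into one Poisson process. Both replacements are justified by
resampling one coordinate at a time, the service time or the interarrival time of a single packet,
which makes the errors orthogonal. A second moment of the service times only gives a first moment
of the workload. Therefore the workload is capped at \<open>t powr (7 / 8)\<close> in the errors, which bounds
their variances; the cap is eventually inactive, because the laws of large numbers hold with
rate \<open>t powr (3 / 4)\<close>.
\<close>

section \<open>The workload along a sample path\<close>

text \<open>Two points shape the proof. The variance bounds for the errors need the mean area below
  the capped workload to grow at most linearly in time, with a factor that does not depend on the
  cap. This comes from an area inequality taken in expectation: the cap makes the expected area
  \<open>e\<close> finite beforehand, so that \<open>e \<le> \<rho> * e + c * t\<close>, with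
  \<open>\<rho> < 1\<close> the offered load, can be solved for \<open>e\<close>. On a single path,
  the rate \<open>t powr (3 / 4)\<close> for the workload does not make the boundary term
  \<open>(W t)\<^sup>2 / 2\<close> small compared with \<open>t\<close>. For the upper bound it has
  the right sign; the lower bound compares neighbouring times and becomes a contraction with factor
  \<open>\<rho>\<close>. The exponents come from one balance: about \<open>i ^ 16\<close> packets
  fluctuate by \<open>i ^ 12\<close>, the cap \<open>i ^ 14\<close> lies above this, and
  \<open>i ^ 14 / i ^ 16\<close> is still summable. Since the ratio of successive times tends to 1,
  monotone interpolation fills the gaps. The squares of the service times have only a first moment,
  hence the separate strong law by truncation.\<close>

text \<open>The workload just before time \<open>u\<close> is the largest excess, over all packets \<open>p\<close> arrived before \<open>u\<close>,
  of the work arrived from \<open>p\<close> on over the time elapsed since then. In this form it is measurable on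
  all paths, and it visibly does not depend on packets that arrive at time \<open>u\<close> or later. The
  subtraction in \<open>ennreal\<close> truncates at 0, and an infinite supremum is mapped to 0.\<close>

definition workload ::
    "nat \<Rightarrow> (nat \<times> nat \<Rightarrow> real) \<Rightarrow> (nat \<times> nat \<Rightarrow> real) \<Rightarrow> real \<Rightarrow> real" where
  "workload N a s u = enn2real (SUP p\<in>packets N. if a p < u then
     (\<Sum>j=1..N. \<Sum>k. if a p \<le> a (j, k) \<and> a (j, k) < u then ennreal (s (j, k)) else 0)
       - ennreal (u - a p) else 0)"

lemma workload_nonneg [simp]: "0 \<le> workload N a s u"
  by (simp add: workload_def)

text \<open>All later independence of the workload rests on this: a change among the packets that
  arrive at \<open>u\<close> or later, both before and after the change, leaves the workload at
  \<open>u\<close> as it was. It holds on every path, with no regularity assumed.\<close>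

lemma workload_cong:
  assumes "\<And>q. q \<in> packets N \<Longrightarrow> a q < u \<longleftrightarrow> a' q < u"
    and "\<And>q. q \<in> packets N \<Longrightarrow> a q < u \<Longrightarrow> a q = a' q \<and> s q = s' q"
  shows "workload N a s u = workload N a' s' u"
proof -
  have "(if a p < u then
     (\<Sum>j=1..N. \<Sum>k. if a p \<le> a (j, k) \<and> a (j, k) < u then ennreal (s (j, k)) else 0)
       - ennreal (u - a p) else 0) = (if a' p < u then
     (\<Sum>j=1..N. \<Sum>k. if a' p \<le> a' (j, k) \<and> a' (j, k) < u then ennreal (s' (j, k)) else 0)
       - ennreal (u - a' p) else 0)" if p: "p \<in> packets N" for p
  proof (cases "a p < u")
    case True
    have "(if a p \<le> a (j, k) \<and> a (j, k) < u then ennreal (s (j, k)) else 0) =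
      (if a' p \<le> a' (j, k) \<and> a' (j, k) < u then ennreal (s' (j, k)) else 0)" if "j \<in> {1..N}" for j k
    proof -
      have "(j, k) \<in> packets N" using that by (simp add: packets_def)
      then show ?thesis using assms(1)[of "(j,k)"] assms(2)[of "(j,k)"] assms(2)[OF p True] by auto
    qed
    then show ?thesis using True assms(1)[OF p] assms(2)[OF p True] by simp
  next
    case False
    then show ?thesis using assms(1)[OF p] by simp
  qed
  then show ?thesis
    unfolding workload_def by (intro arg_cong[where f=enn2real] SUP_cong refl) blast
qed

text \<open>Properties that a path has almost surely, collected so that the queue can be treated
  deterministically. \<open>1 \<le> N\<close> makes the set of packets infinite, so that every
  position in the arrival order is occupied.\<close>

locale fcfs_path =
  fixes N :: nat and a s :: "nat \<times> nat \<Rightarrow> real"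
  assumes classes: "1 \<le> N"
    and arrival_pos: "\<And>p. p \<in> packets N \<Longrightarrow> 0 < a p"
    and arrivals_distinct: "inj_on a (packets N)"
    and locally_finite: "\<And>u. finite {q \<in> packets N. a q \<le> u}"
    and service_pos: "\<And>p. p \<in> packets N \<Longrightarrow> 0 < s p"
begin

abbreviation "pos \<equiv> queue_position N a"
abbreviation "pk \<equiv> packet_at N a"
abbreviation "C \<equiv> completion_time N a s"
abbreviation "W \<equiv> workload N a s"

text \<open>The inequality is strict: at an arrival instant the arriving packet is not counted, so
  that the workload at this instant is its waiting time.\<close>

definition arrived :: "real \<Rightarrow> nat" where
  "arrived u = card {q \<in> packets N. a q < u}"

lemma locally_finite': "finite {q \<in> packets N. a q < u}"
  by (rule finite_subset[OF _ locally_finite[of u]]) auto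

lemma infinite_packets: "infinite (packets N)"
  using classes by (simp add: packets_def finite_cartesian_product_iff)

text \<open>Infinitely many packets, of which only finitely many arrive up to \<open>c\<close>,
  force a later one; local finiteness yields an earliest among these, and distinctness makes it
  unique. This is the induction step for \<open>pos_surj\<close>.\<close>

lemma ex_next_arrival:
  obtains q where "q \<in> packets N" "c < a q"
    "{r \<in> packets N. a r \<le> a q} = insert q {r \<in> packets N. a r \<le> c}"
proof -
  have "packets N - {r \<in> packets N. a r \<le> c} \<noteq> {}"
    using infinite_packets locally_finite[of c] by (metis finite.emptyI infinite_remove finite_Diff2)
  then obtain q0 where q0: "q0 \<in> packets N" "c < a q0" by force
  let ?B = "{r \<in> packets N. c < a r \<and> a r \<le> a q0}"
  have fin: "finite ?B" by (rule finite_subset[OF _ locally_finite[of "a q0"]]) auto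
  have ne: "?B \<noteq> {}" using q0 by blast
  have "Min (a ` ?B) \<in> a ` ?B" using fin ne by (intro Min_in) auto
  then obtain q where q: "Min (a ` ?B) = a q" "q \<in> ?B" by (rule imageE)
  then have q_le: "a q \<le> a r" if "r \<in> ?B" for r using fin that q(1)[symmetric] by simp
  show thesis
  proof
    show "q \<in> packets N" "c < a q" using q by auto
    show "{r \<in> packets N. a r \<le> a q} = insert q {r \<in> packets N. a r \<le> c}"
    proof (intro equalityI subsetI)
      fix r assume r: "r \<in> {r \<in> packets N. a r \<le> a q}"
      show "r \<in> insert q {r \<in> packets N. a r \<le> c}"
      proof (cases "a r \<le> c")
        case False
        then have "r \<in> ?B" using r q by auto
        then have "a r = a q" using q_le[of r] r by auto
        then show ?thesis using arrivals_distinct r q by (auto simp: inj_on_def)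
      qed (use r in auto)
    qed (use q in auto)
  qed
qed

section \<open>Numbering the packets in the order of arrival\<close>

lemma pos_mono:
  assumes "p \<in> packets N" "q \<in> packets N" "a p < a q"
  shows "pos p < pos q"
  unfolding queue_position_def
  by (rule psubset_card_mono[OF locally_finite]) (use assms in force)

lemma pos_less_iff:
  assumes "p \<in> packets N" "q \<in> packets N"
  shows "pos p < pos q \<longleftrightarrow> a p < a q"
proof (cases "a p = a q")
  case True
  then have "pos p = pos q" by (simp add: queue_position_def)
  then show ?thesis using True by simp
next
  case False
  then show ?thesis using pos_mono[OF assms] pos_mono[OF assms(2,1)] by linarith
qed

lemma pos_inj: "inj_on pos (packets N)"
proof (rule inj_onI)
  fix p q assume "p \<in> packets N" "q \<in> packets N" "pos p = pos q"
  then have "a p = a q" using pos_less_iff[of p q] pos_less_iff[of q p] by force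
  with \<open>p \<in> _\<close> \<open>q \<in> _\<close> show "p = q" using arrivals_distinct by (auto dest: inj_onD)
qed

lemma pos_ge_1: "p \<in> packets N \<Longrightarrow> 1 \<le> pos p"
proof -
  assume "p \<in> packets N"
  then have "{q \<in> packets N. a q \<le> a p} \<noteq> {}" by blast
  then show ?thesis
    unfolding queue_position_def using locally_finite[of "a p"] by (simp add: Suc_le_eq card_gt_0_iff)
qed

lemma pos_surj: "\<exists>p\<in>packets N. pos p = Suc j"
proof (induction j)
  case 0
  obtain q where q: "q \<in> packets N" "0 < a q" "{r \<in> packets N. a r \<le> a q} = insert q {r \<in> packets N. a r \<le> 0}"
    by (rule ex_next_arrival[of 0])
  have none: "{r \<in> packets N. a r \<le> 0} = {}" using arrival_pos by force
  then have "pos q = 1" unfolding queue_position_def q(3) none by simp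
  then show ?case using q by auto
next
  case (Suc j)
  then obtain p where p: "p \<in> packets N" "pos p = Suc j" by auto
  obtain q where q: "q \<in> packets N" "a p < a q"
     "{r \<in> packets N. a r \<le> a q} = insert q {r \<in> packets N. a r \<le> a p}"
    by (rule ex_next_arrival[of "a p"])
  have "pos q = Suc (Suc j)"
    using p(2) q(2) unfolding queue_position_def q(3)
    by (subst card_insert_disjoint[OF locally_finite]) auto
  then show ?case using q by auto
qed

lemma packet_at_pos: "p \<in> packets N \<Longrightarrow> pk (pos p) = p"
  unfolding packet_at_def by (rule the_equality) (use pos_inj in \<open>auto dest: inj_onD\<close>)

lemma packet_at:
  assumes "1 \<le> j"
  shows "pk j \<in> packets N" "pos (pk j) = j"
proof -
  obtain p where p: "p \<in> packets N" "pos p = j" using pos_surj[of "j - 1"] assms by auto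
  then have "pk j = p" using packet_at_pos[OF p(1)] by simp
  then show "pk j \<in> packets N" "pos (pk j) = j" using p by simp_all
qed

lemma pk_inj: "inj_on pk {1..}"
  by (rule inj_onI) (metis packet_at(2) atLeast_iff)

lemma pos_le_arrived_iff:
  assumes "p \<in> packets N"
  shows "pos p \<le> arrived u \<longleftrightarrow> a p < u"
proof
  assume "a p < u"
  then show "pos p \<le> arrived u"
    unfolding queue_position_def arrived_def by (intro card_mono locally_finite') auto
next
  assume *: "pos p \<le> arrived u"
  show "a p < u"
  proof (rule ccontr)
    assume "\<not> a p < u"
    then have "arrived u < pos p"
      unfolding queue_position_def arrived_def using assms
      by (intro psubset_card_mono locally_finite) force
    then show False using * by simp
  qed
qed

lemma arrived_eq: "{q \<in> packets N. a q < u} = pk ` {1..arrived u}"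
proof (intro equalityI subsetI)
  fix q assume q: "q \<in> {q \<in> packets N. a q < u}"
  then have "pos q \<in> {1..arrived u}" using pos_le_arrived_iff pos_ge_1 by auto
  then show "q \<in> pk ` {1..arrived u}" using q packet_at_pos by (metis (mono_tags, lifting) image_eqI mem_Collect_eq)
next
  fix q assume "q \<in> pk ` {1..arrived u}"
  then obtain i where i: "q = pk i" "1 \<le> i" "i \<le> arrived u" by auto
  then show "q \<in> {q \<in> packets N. a q < u}" using packet_at[of i] pos_le_arrived_iff[of q u] by auto
qed

lemma arrived_arrival:
  assumes "p \<in> packets N" shows "arrived (a p) = pos p - 1"
proof -
  have "{q \<in> packets N. a q \<le> a p} = insert p {q \<in> packets N. a q < a p}"
    using assms arrivals_distinct by (auto simp: inj_on_def order_le_less)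
  then show ?thesis unfolding arrived_def queue_position_def
    by (simp add: card_insert_disjoint[OF locally_finite'])
qed

text \<open>Together with \<open>C_attained\<close> this solves Lindley's recursion:
  \<open>C j\<close> is the maximum over \<open>i \<le> j\<close> of the time at which packet
  \<open>j\<close> would be finished if the server worked without pause from the arrival of packet
  \<open>i\<close> on. The maximum is attained at the packet that opens the busy period of packet
  \<open>j\<close>.\<close>

lemma C_ge: "1 \<le> i \<Longrightarrow> i \<le> j \<Longrightarrow> a (pk i) + (\<Sum>l=i..j. s (pk l)) \<le> C j"
proof (induction j)
  case (Suc j)
  show ?case
  proof (cases "i = Suc j")
    case False
    then have "a (pk i) + (\<Sum>l=i..j. s (pk l)) \<le> C j" using Suc by simp
    then show ?thesis using Suc.prems False by (simp add: max_def)
  qed (simp add: max_def)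
qed simp

lemma C_attained: "1 \<le> j \<Longrightarrow> \<exists>i\<in>{1..j}. C j = a (pk i) + (\<Sum>l=i..j. s (pk l))"
proof (induction j)
  case (Suc j)
  show ?case
  proof (cases "j = 0 \<or> C j \<le> a (pk (Suc j))")
    case True
    have "C (Suc j) = a (pk (Suc j)) + s (pk (Suc j))"
      using True arrival_pos[OF packet_at(1)[of "Suc j"]] by (auto simp: max_def)
    then show ?thesis by (intro bexI[of _ "Suc j"]) auto
  next
    case False
    then obtain i where i: "i \<in> {1..j}" "C j = a (pk i) + (\<Sum>l=i..j. s (pk l))" using Suc by auto
    then have "C (Suc j) = a (pk i) + (\<Sum>l=i..Suc j. s (pk l))" using False by (auto simp: max_def)
    then show ?thesis using i by (intro bexI[of _ i]) auto
  qed
qed simp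

text \<open>The workload is defined by series over all packets of a class, which are measurable on
  all paths; on a regular path they are finite sums.\<close>

lemma sum_packets_suminf:
  fixes f :: "nat \<times> nat \<Rightarrow> ennreal"
  assumes "finite {q \<in> packets N. P q}"
  shows "(\<Sum>j=1..N. \<Sum>k. if P (j, k) then f (j, k) else 0) = (\<Sum>q | q \<in> packets N \<and> P q. f q)"
proof -
  have fin: "finite {k. P (j, k)}" if "j \<in> {1..N}" for j
  proof -
    have "(\<lambda>k. (j, k)) ` {k. P (j, k)} \<subseteq> {q \<in> packets N. P q}" using that by (auto simp: packets_def)
    then have "finite ((\<lambda>k. (j, k)) ` {k. P (j, k)})" using assms finite_subset by blast
    then show ?thesis by (rule finite_imageD) (auto simp: inj_on_def)
  qed
  have "(\<Sum>j=1..N. \<Sum>k. if P (j, k) then f (j, k) else 0) = (\<Sum>j=1..N. \<Sum>k\<in>{k. P (j, k)}. f (j, k))"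
    by (intro sum.cong refl, subst suminf_finite[OF fin]) auto
  also have "\<dots> = (\<Sum>(j, k)\<in>(SIGMA j:{1..N}. {k. P (j, k)}). f (j, k))"
    by (rule sum.Sigma) (use fin in auto)
  also have "(SIGMA j:{1..N}. {k. P (j, k)}) = {q. q \<in> packets N \<and> P q}" by (auto simp: packets_def)
  finally show ?thesis by simp
qed

text \<open>In the supremum that defines the workload, packet number \<open>i\<close> contributes
  \<open>a (pk i)\<close> plus the work arrived from then on, minus \<open>u\<close>. The supremum
  is therefore the maximum of \<open>C_ge\<close> and \<open>C_attained\<close> less
  \<open>u\<close>, and subtraction in \<open>ennreal\<close> supplies the truncation at 0.\<close>

lemma workload_eq:
  assumes "0 \<le> u"
  shows "W u = max 0 (C (arrived u) - u)"
proof -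
  let ?J = "arrived u"
  define F where "F p = (if a p < u then
     (\<Sum>j=1..N. \<Sum>k. if a p \<le> a (j, k) \<and> a (j, k) < u then ennreal (s (j, k)) else 0)
       - ennreal (u - a p) else 0)" for p
  have F: "F (pk i) = ennreal (a (pk i) + (\<Sum>l=i..?J. s (pk l)) - u)" if i: "1 \<le> i" "i \<le> ?J" for i
  proof -
    have lt: "a (pk i) < u" using i packet_at[of i] pos_le_arrived_iff[of "pk i" u] by simp
    have "{q. q \<in> packets N \<and> a (pk i) \<le> a q \<and> a q < u} = pk ` {i..?J}"
    proof (intro equalityI subsetI)
      fix q assume q: "q \<in> {q. q \<in> packets N \<and> a (pk i) \<le> a q \<and> a q < u}"
      then have "i \<le> pos q" using pos_less_iff[of q "pk i"] packet_at[of i] i by force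
      moreover have "pos q \<le> ?J" using q pos_le_arrived_iff by simp
      moreover have "pk (pos q) = q" using q packet_at_pos by simp
      ultimately show "q \<in> pk ` {i..?J}" by (metis atLeastAtMost_iff image_eqI)
    next
      fix q assume "q \<in> pk ` {i..?J}"
      then obtain l where l: "q = pk l" "i \<le> l" "l \<le> ?J" by auto
      with packet_at[of l] packet_at[of i] pos_less_iff[of q "pk i"] pos_le_arrived_iff[of q u] i
      show "q \<in> {q. q \<in> packets N \<and> a (pk i) \<le> a q \<and> a q < u}" by force
    qed
    moreover have "finite {q \<in> packets N. a (pk i) \<le> a q \<and> a q < u}"
      by (rule finite_subset[OF _ locally_finite[of u]]) auto
    ultimately have "(\<Sum>j=1..N. \<Sum>k. if a (pk i) \<le> a (j, k) \<and> a (j, k) < u then ennreal (s (j, k)) else 0)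
        = (\<Sum>q\<in>pk ` {i..?J}. ennreal (s q))"
      by (subst sum_packets_suminf) auto
    also have "\<dots> = (\<Sum>l=i..?J. ennreal (s (pk l)))"
      by (subst sum.reindex) (use pk_inj i in \<open>auto intro: inj_on_subset\<close>)
    also have "\<dots> = ennreal (\<Sum>l=i..?J. s (pk l))"
      by (rule sum_ennreal) (use service_pos[OF packet_at(1)] i in \<open>force intro: less_imp_le\<close>)
    finally show ?thesis using lt unfolding F_def by (simp add: ennreal_minus algebra_simps)
  qed
  have "(SUP p\<in>packets N. F p) = ennreal (max 0 (C ?J - u))"
  proof (rule antisym)
    show "(SUP p\<in>packets N. F p) \<le> ennreal (max 0 (C ?J - u))"
    proof (rule SUP_least)
      fix p assume p: "p \<in> packets N"
      show "F p \<le> ennreal (max 0 (C ?J - u))"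
      proof (cases "a p < u")
        case True
        then have i: "1 \<le> pos p" "pos p \<le> ?J" using p pos_ge_1 pos_le_arrived_iff by auto
        then show ?thesis using F[OF i] C_ge[OF i] packet_at_pos[OF p] by (simp add: ennreal_leI)
      qed (simp add: F_def)
    qed
    show "ennreal (max 0 (C ?J - u)) \<le> (SUP p\<in>packets N. F p)"
    proof (cases "?J = 0")
      \<comment> \<open>Before the first arrival \<open>C 0 = 0\<close>, and
        \<open>0 \<le> u\<close> makes the left side vanish.\<close>
      case True
      then show ?thesis using assms by simp
    next
      case False
      then obtain i where i: "i \<in> {1..?J}" "C ?J = a (pk i) + (\<Sum>l=i..?J. s (pk l))"
        using C_attained[of ?J] by auto
      then have "ennreal (max 0 (C ?J - u)) = F (pk i)" using F[of i] by (simp add: ennreal_max_0 del: max_def)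
      also have "\<dots> \<le> (SUP p\<in>packets N. F p)" by (rule SUP_upper) (use i packet_at in auto)
      finally show ?thesis .
    qed
  qed
  moreover have "W u = enn2real (SUP p\<in>packets N. F p)" by (simp only: workload_def F_def)
  ultimately show ?thesis by (metis enn2real_ennreal max.cobounded1)
qed

text \<open>The server finishes the earlier packets at time \<open>C (pos p - 1)\<close>, so the
  workload left at the arrival of \<open>p\<close> is exactly its waiting time.\<close>

lemma fcfs_departure_eq:
  assumes "p \<in> packets N"
  shows "fcfs_departure N a s p = a p + W (a p) + s p"
proof -
  obtain j where j: "pos p = Suc j" using pos_ge_1[OF assms] by (metis Suc_le_D One_nat_def)
  have "W (a p) = max 0 (C j - a p)"
    using workload_eq[of "a p"] arrived_arrival[OF assms] arrival_pos[OF assms] j by simp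
  then show ?thesis unfolding fcfs_departure_def j
    using packet_at_pos[OF assms] j by (simp add: max_def)
qed

lemma C_strict_mono: "strict_mono C"
proof (subst strict_mono_Suc_iff, rule allI)
  fix j
  have "0 < s (pk (Suc j))" by (rule service_pos[OF packet_at(1)]) simp
  then show "C j < C (Suc j)" by (simp add: max_def)
qed

lemma fcfs_departure_mono:
  assumes "p \<in> packets N" "q \<in> packets N" "a p < a q"
  shows "fcfs_departure N a s p < fcfs_departure N a s q"
  unfolding fcfs_departure_def using C_strict_mono pos_mono[OF assms] by (simp add: strict_mono_less)

end

section \<open>Integrals of functions of the workload, and a bound by fluctuations of the
  input\<close>

context fcfs_path begin

lemma arrived_mono: "u \<le> v \<Longrightarrow> arrived u \<le> arrived v"
  unfolding arrived_def by (intro card_mono locally_finite') auto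

lemma sum_arrived: "(\<Sum>q | q \<in> packets N \<and> a q < u. f q) = (\<Sum>i=1..arrived u. f (pk i))"
proof -
  have "(\<Sum>q | q \<in> packets N \<and> a q < u. f q) = (\<Sum>q\<in>pk ` {1..arrived u}. f q)"
    using arrived_eq by simp
  also have "\<dots> = (\<Sum>i=1..arrived u. f (pk i))"
    by (subst sum.reindex) (auto intro: inj_on_subset[OF pk_inj])
  finally show ?thesis .
qed

text \<open>Between arrivals the workload falls at rate 1, so the integral of \<open>g (W u)\<close>
  is a decrease of \<open>G\<close>, while each arrival adds a jump of \<open>G\<close>. Idle
  periods need no separate treatment: \<open>g\<close> and \<open>G\<close> vanish on the negatives,
  hence \<open>W u\<close> may be replaced by the line \<open>C - u\<close> that continues below 0.
  The identity is used for the half square and for its capped variant.\<close>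

lemma energy_identity:
  assumes dG: "\<And>x. (G has_real_derivative g x) (at x)"
    and g0: "\<And>x. x \<le> 0 \<Longrightarrow> g x = 0" and G0: "\<And>x. x \<le> 0 \<Longrightarrow> G x = 0"
    and t: "0 \<le> t"
  shows "((\<lambda>u. g (W u)) has_integral
    (\<Sum>q | q \<in> packets N \<and> a q < t. G (W (a q) + s q) - G (W (a q))) - G (W t)) {0..t}"
proof -
  have g_max: "g (max 0 x) = g x" and G_max: "G (max 0 x) = G x" for x
    using g0 G0 by (auto simp: max_def)
  have "((\<lambda>u. g (W u)) has_integral
    (\<Sum>i=1..j. G (W (a (pk i)) + s (pk i)) - G (W (a (pk i)))) - G (W t)) {0..t}"
    if "0 \<le> t" "arrived t = j" for j t
    using that
  proof (induction j arbitrary: t)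
    case 0
    have W0: "W u = 0" if "u \<in> {0..t}" for u
      using that workload_eq[of u] arrived_mono[of u t] 0 by simp
    have "((\<lambda>u. g (W u)) has_integral 0) {0..t}"
      by (rule has_integral_is_0) (use W0 g0 in auto)
    then show ?case using W0[of t] G0 0 by simp
  next
    case (Suc j)
    let ?p = "pk (Suc j)" let ?t1 = "a ?p" let ?C = "C (Suc j)"
    have p: "?p \<in> packets N" "pos ?p = Suc j" using packet_at[of "Suc j"] by auto
    have arr: "arrived ?t1 = j" using arrived_arrival[OF p(1)] p(2) by simp
    have t1: "0 \<le> ?t1" "?t1 < t"
      using arrival_pos[OF p(1)] pos_le_arrived_iff[OF p(1), of t] p(2) Suc.prems by auto
    have C_t1: "?C - ?t1 = W ?t1 + s ?p"
      using workload_eq[OF t1(1)] arr by (simp add: max_def)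
    \<comment> \<open>The point \<open>?t1\<close> is left out: there the workload does not yet
      contain packet \<open>Suc j\<close>.\<close>
    have W_u: "W u = max 0 (?C - u)" if "u \<in> {?t1..t} - {?t1}" for u
    proof -
      have "Suc j \<le> arrived u" using that pos_le_arrived_iff[OF p(1), of u] p(2) by simp
      moreover have "arrived u \<le> Suc j" using that arrived_mono[of u t] Suc.prems by simp
      ultimately have "arrived u = Suc j" by simp
      then show ?thesis using workload_eq[of u] that t1 by simp
    qed
    have "((\<lambda>u. g (?C - u)) has_integral (- G (?C - t)) - (- G (?C - ?t1))) {?t1..t}"
    proof (rule fundamental_theorem_of_calculus)
      show "?t1 \<le> t" using t1 by simp
      fix u assume "u \<in> {?t1..t}"
      have "((\<lambda>u. - G (?C - u)) has_real_derivative g (?C - u)) (at u)"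
        by (rule derivative_eq_intros DERIV_chain2[OF dG] refl | simp)+
      then show "((\<lambda>u. - G (?C - u)) has_vector_derivative g (?C - u)) (at u within {?t1..t})"
        using has_real_derivative_iff_has_vector_derivative has_vector_derivative_at_within by blast
    qed
    then have "((\<lambda>u. g (W u)) has_integral (- G (?C - t)) - (- G (?C - ?t1))) {?t1..t}"
      by (rule has_integral_spike_finite[of "{?t1}", rotated 2]) (use W_u g_max in auto)
    from has_integral_combine[OF t1(1) less_imp_le[OF t1(2)] Suc.IH[OF t1(1) arr] this]
    have "((\<lambda>u. g (W u)) has_integral (\<Sum>i=1..j. G (W (a (pk i)) + s (pk i)) - G (W (a (pk i))))
       - G (W ?t1) + (G (?C - ?t1) - G (?C - t))) {0..t}" by simp
    moreover have "G (?C - t) = G (W t)" using W_u[of t] t1 G_max by simp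
    ultimately show ?case unfolding C_t1 by (simp add: algebra_simps)
  qed
  from this[OF t refl] show ?thesis by (simp add: sum_arrived)
qed

text \<open>Let \<open>i\<close> be the maximiser in \<open>C_attained\<close> and \<open>?u\<close>
  its arrival time. A positive workload at \<open>t\<close> is the work arrived from
  \<open>?u\<close> until \<open>t\<close> minus the elapsed time \<open>t - ?u\<close>. The arrived
  work deviates from \<open>\<rho> * u\<close> by at most \<open>D\<close> at either end, and the
  remaining drift \<open>\<rho> - 1\<close> is not positive.\<close>

lemma workload_le_fluctuation:
  assumes D: "\<And>u. 0 \<le> u \<Longrightarrow> u \<le> t \<Longrightarrow> \<bar>(\<Sum>q | q \<in> packets N \<and> a q < u. s q) - \<rho> * u\<bar> \<le> D"
    and "\<rho> \<le> 1" and t: "0 \<le> t"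
  shows "W t \<le> 2 * D"
proof -
  have D0: "0 \<le> D" using D[of 0] t by simp
  show ?thesis
  proof (cases "arrived t = 0")
    case True
    then show ?thesis using workload_eq[OF t] t D0 by simp
  next
    case False
    let ?J = "arrived t"
    obtain i where i: "i \<in> {1..?J}" "C ?J = a (pk i) + (\<Sum>l=i..?J. s (pk l))"
      using C_attained[of ?J] False by auto
    let ?u = "a (pk i)"
    have p: "pk i \<in> packets N" "pos (pk i) = i" using packet_at i by auto
    have u: "0 \<le> ?u" "?u \<le> t" "arrived ?u = i - 1"
      using arrival_pos[OF p(1)] pos_le_arrived_iff[OF p(1), of t] i p arrived_arrival[OF p(1)] by auto
    have "(\<Sum>l=1..?J. s (pk l)) = (\<Sum>l=1..i-1. s (pk l)) + (\<Sum>l=i..?J. s (pk l))"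
    proof -
      have "{1..?J} = {1..i - 1} \<union> {i..?J}" using i by auto
      then show ?thesis by (simp only:) (subst sum.union_disjoint; auto)
    qed
    then have "C ?J - t = ?u - t + ((\<Sum>l=1..arrived t. s (pk l)) - (\<Sum>l=1..arrived ?u. s (pk l)))"
      using i u by simp
    also have "\<dots> \<le> ?u - t + ((\<rho> * t + D) - (\<rho> * ?u - D))"
      using D[of t] D[of ?u] u t unfolding sum_arrived by linarith
    also have "\<dots> = 2 * D - (1 - \<rho>) * (t - ?u)" by (simp add: algebra_simps)
    also have "\<dots> \<le> 2 * D" using u assms by simp
    finally show ?thesis using workload_eq[OF t] D0 by simp
  qed
qed

end

text \<open>Between receptions the age is \<open>t\<close> plus an intercept, which falls at every
  reception because generation times increase. So the drops are exactly the receptions, which cannot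
  accumulate since \<open>d\<close> tends to infinity. Receptions are counted from 0 and peaks from
  1; before reception \<open>k\<close> the age refers to packet \<open>k - 1\<close>, or to the
  fictitious update if \<open>k = 0\<close>.\<close>

lemma status_age_peak:
  assumes d: "strict_mono d" and g: "\<And>k. g k < g (Suc k)" and g0: "- \<delta> < g 0"
    and unb: "filterlim d at_top sequentially"
  shows "peak (status_age \<delta> g d) (Suc k) = d k + (case k of 0 \<Rightarrow> \<delta> | Suc i \<Rightarrow> - g i)"
proof -
  let ?f = "status_age \<delta> g d"
  \<comment> \<open>Intercept of the age just before reception \<open>k\<close>: minus the
    generation time of the latest packet received until then.\<close>
  define c where "c k = (case k of 0 \<Rightarrow> \<delta> | Suc i \<Rightarrow> - g i)" for k
  have dec: "c (Suc k) < c k" for k using g g0 by (cases k) (auto simp: c_def)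
  have less_iff: "d i < d j \<longleftrightarrow> i < j" and le_iff: "d i \<le> d j \<longleftrightarrow> i \<le> j" for i j
    using d by (simp_all add: strict_mono_less strict_mono_less_eq)
  have before: "?f t = t + c 0" if "t < d 0" for t
  proof -
    have "\<not> d k \<le> t" for k using that le_iff[of 0 k] by auto
    then show ?thesis by (simp add: status_age_def c_def)
  qed
  have after: "?f t = t + c (Suc k)" if "d k \<le> t" "t < d (Suc k)" for t k
  proof -
    have iff: "d i \<le> t \<longleftrightarrow> i \<le> k" for i
    proof
      show "d i \<le> t \<Longrightarrow> i \<le> k" using that less_iff[of i "Suc k"] by auto
      show "i \<le> k \<Longrightarrow> d i \<le> t" using that le_iff[of i k] by auto
    qed
    have "arg_max d (\<lambda>i. d i \<le> t) = k"
      unfolding arg_max_def is_arg_max_def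
      by (rule some_equality) (auto simp: iff less_iff not_less intro: antisym)
    then show ?thesis using that by (auto simp: status_age_def c_def)
  qed
  \<comment> \<open>Left end of the segment that ends at reception \<open>k\<close>; for
    \<open>k = 0\<close> any number below \<open>d 0\<close> would serve.\<close>
  define lo where "lo k = (case k of 0 \<Rightarrow> d 0 - 1 | Suc i \<Rightarrow> d i)" for k
  have lo: "lo k < d k" for k using d by (cases k) (auto simp: lo_def strict_mono_def)
  have seg: "?f t = t + c k" if "lo k \<le> t" "t < d k" for t k
    using that before after by (cases k) (auto simp: lo_def)
  have lim: "(?f \<longlongrightarrow> t + c k) (at_left t)" if "lo k < t" "t \<le> d k" for t k
  proof (rule Lim_transform_eventually)
    show "((\<lambda>u. u + c k) \<longlongrightarrow> t + c k) (at_left t)" by (intro tendsto_intros)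
    have "\<forall>\<^sub>F u in at_left t. lo k < u" using that by (intro eventually_at_leftI[of "lo k"]) auto
    moreover have "\<forall>\<^sub>F u in at_left t. u < t" by (simp add: eventually_at_filter)
    ultimately show "\<forall>\<^sub>F u in at_left t. u + c k = ?f u"
      by eventually_elim (use seg[of k] that in auto)
  qed
  have at_d: "?f (d k) = d k + c (Suc k)" for k using after[of k "d k"] less_iff[of k "Suc k"] by simp
  have drops: "drop_times ?f = range d"
  proof (intro equalityI subsetI)
    fix t assume "t \<in> range d"
    then obtain k where "t = d k" by auto
    then show "t \<in> drop_times ?f"
      using lim[OF lo order_refl, of k] at_d[of k] dec[of k] by (auto simp: drop_times_def)
  next
    fix t assume "t \<in> drop_times ?f"
    then obtain l where l: "(?f \<longlongrightarrow> l) (at_left t)" "?f t < l" by (auto simp: drop_times_def)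
    show "t \<in> range d"
    proof (rule ccontr)
      \<comment> \<open>Away from receptions the age is continuous from the left, so it cannot drop
        there.\<close>
      assume nt: "t \<notin> range d"
      have "\<exists>k. t < d k" using unb unfolding filterlim_at_top_dense eventually_sequentially by blast
      then obtain k where k: "t < d k" "\<And>i. i < k \<Longrightarrow> \<not> t < d i"
        using exists_least_iff[of "\<lambda>k. t < d k"] by blast
      show False
      proof (cases k)
        case 0
        have "((\<lambda>u. u + c 0) \<longlongrightarrow> t + c 0) (at_left t)" by (intro tendsto_intros)
        then have "(?f \<longlongrightarrow> t + c 0) (at_left t)"
          by (rule Lim_transform_eventually)
             (use before k 0 in \<open>auto simp: eventually_at_filter\<close>)
        then show False using l before[of t] k 0 tendsto_unique[OF _ l(1)] by force
      next
        case (Suc i)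
        then have "d i < t" using k(2)[of i] nt by (metis lessI linorder_less_linear rangeI)
        then have "(?f \<longlongrightarrow> t + c k) (at_left t)" "?f t = t + c k"
          using lim[of k t] seg[of k t] k Suc by (auto simp: lo_def)
        then show False using l tendsto_unique[OF _ l(1)] by force
      qed
    qed
  qed
  have count: "card {u \<in> drop_times ?f. u \<le> d i} = Suc i" for i
  proof -
    have "{u \<in> drop_times ?f. u \<le> d i} = d ` {..i}" unfolding drops using le_iff by auto
    then show ?thesis
      using strict_mono_on_imp_inj_on[OF d] by (simp add: card_image inj_on_subset)
  qed
  have "nth_drop ?f (Suc k) = d k"
    unfolding nth_drop_def
  proof (rule the_equality)
    show "d k \<in> drop_times ?f \<and> card {u \<in> drop_times ?f. u \<le> d k} = Suc k"
      using count drops by simp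
    fix t assume t: "t \<in> drop_times ?f \<and> card {u \<in> drop_times ?f. u \<le> t} = Suc k"
    then obtain i where "t = d i" using drops by auto
    then show "t = d k" using count[of i] t by simp
  qed
  then have "peak ?f (Suc k) = d k + c k"
    unfolding peak_def using lim[OF lo order_refl, of k] by (simp add: tendsto_Lim)
  then show ?thesis by (simp add: c_def)
qed

section \<open>Laws of large numbers\<close>

text \<open>For \<open>t k \<le> x < t (Suc k)\<close> monotonicity compares \<open>f x / x\<close>
  with the ratios at both ends, at the cost of a factor \<open>\<beta>\<close>, which is then sent
  to 1. The subsequence may depend on \<open>\<beta>\<close>; geometric ones, with their fixed
  ratio, have to.\<close>

lemma monotone_ratio_tendsto:
  fixes f :: "real \<Rightarrow> real"
  assumes mono: "mono f" and nonneg: "\<And>x. 0 \<le> f x"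
    and seq: "\<And>\<beta>. 1 < \<beta> \<Longrightarrow> \<exists>t. filterlim t at_top sequentially \<and> (\<forall>\<^sub>F k in sequentially. t (Suc k) \<le> \<beta> * t k) \<and>
      (\<lambda>k. f (t k) / t k) \<longlonglongrightarrow> L"
  shows "((\<lambda>x. f x / x) \<longlongrightarrow> L) at_top"
proof -
  have key: "\<forall>\<^sub>F x in at_top. l / \<beta> \<le> f x / x \<and> f x / x \<le> \<beta> * u"
    if "1 < \<beta>" "l < L" "L < u" for \<beta> l u
  proof -
    obtain t where t: "filterlim t at_top sequentially" "\<forall>\<^sub>F k in sequentially. t (Suc k) \<le> \<beta> * t k"
      "(\<lambda>k. f (t k) / t k) \<longlonglongrightarrow> L" using seq[OF \<open>1 < \<beta>\<close>] by blast
    have "\<forall>\<^sub>F k in sequentially. 0 < t k \<and> t (Suc k) \<le> \<beta> * t k \<and> l < f (t k) / t k \<and> f (t k) / t k < u"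
      using t(2) order_tendstoD[OF t(3)] that t(1)
      by (auto simp: filterlim_at_top_dense intro!: eventually_conj)
    then obtain k0 where k0: "\<And>k. k0 \<le> k \<Longrightarrow> 0 < t k \<and> t (Suc k) \<le> \<beta> * t k \<and> l < f (t k) / t k \<and> f (t k) / t k < u"
      by (auto simp: eventually_sequentially)
    show ?thesis
      unfolding eventually_at_top_linorder
    proof (intro exI allI impI)
      fix x assume x: "t k0 \<le> x"
      have "\<exists>m. x < t (k0 + m)"
      proof -
        have "\<forall>\<^sub>F k in sequentially. x < t k" using t(1) by (simp add: filterlim_at_top_dense)
        then obtain k where "\<And>j. k \<le> j \<Longrightarrow> x < t j" by (auto simp: eventually_sequentially)
        then show ?thesis by (intro exI[of _ k]) simp
      qed
      then obtain m where m: "x < t (k0 + m)" "\<And>i. i < m \<Longrightarrow> \<not> x < t (k0 + i)"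
        using exists_least_iff[of "\<lambda>m. x < t (k0 + m)"] by blast
      then have "m \<noteq> 0" using x by (intro notI) simp
      then obtain i where i: "m = Suc i" using not0_implies_Suc by blast
      define k where "k = k0 + i"
      have k: "t k \<le> x" "x < t (Suc k)" using m(1) m(2)[of i] i by (auto simp: k_def)
      have b: "0 < t k" "t (Suc k) \<le> \<beta> * t k" "l < f (t k) / t k" "f (t (Suc k)) / t (Suc k) < u" "0 < t (Suc k)"
        using k0[of k] k0[of "Suc k"] by (auto simp: k_def)
      have x0: "0 < x" using b k by simp
      have "l / \<beta> \<le> f x / x"
      \<comment> \<open>The comparison below multiplies by \<open>l\<close>; for
        \<open>l \<le> 0\<close> the sign of \<open>f\<close> is enough.\<close>
      proof (cases "l \<le> 0")
        case True
        then have "l / \<beta> \<le> 0" using that by (simp add: divide_nonpos_pos)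
        also have "0 \<le> f x / x" using nonneg x0 by simp
        finally show ?thesis .
      next
        case False
        have "l * x \<le> l * (\<beta> * t k)" using False k b by (intro mult_left_mono) auto
        also have "\<dots> \<le> \<beta> * f (t k)" using b that by (simp add: field_simps)
        also have "\<dots> \<le> \<beta> * f x" using monoD[OF mono k(1)] that by simp
        finally show ?thesis using x0 that by (simp add: field_simps)
      qed
      moreover have "f x / x \<le> \<beta> * u"
      proof -
        have u: "0 < u" using b nonneg[of "t (Suc k)"] by (smt (verit) divide_nonneg_pos)
        have "f x \<le> f (t (Suc k))" using monoD[OF mono] k by simp
        also have "\<dots> \<le> u * t (Suc k)" using b by (simp add: field_simps)
        also have "\<dots> \<le> u * (\<beta> * t k)" using b u by (intro mult_left_mono) auto
        also have "\<dots> \<le> u * (\<beta> * x)" using k u that by (intro mult_left_mono) auto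
        finally show ?thesis using x0 by (simp add: field_simps)
      qed
      ultimately show "l / \<beta> \<le> f x / x \<and> f x / x \<le> \<beta> * u" ..
    qed
  qed
  have cont: "\<forall>\<^sub>F \<beta> in at_right 1. P (g \<beta>)" if "isCont g 1" "open {x. P x}" "P (g 1)" for P and g :: "real \<Rightarrow> real"
  proof -
    have "(g \<longlongrightarrow> g 1) (at_right 1)" using that(1) by (simp add: continuous_within filterlim_at_split)
    then show ?thesis using that topological_tendstoD[of g "g 1" _ "{x. P x}"] by simp
  qed
  show ?thesis
  proof (rule order_tendstoI)
    fix a assume a: "a < L"
    obtain l where l: "a < l" "l < L" using a dense by blast
    have "\<forall>\<^sub>F \<beta> in at_right 1. a < l / \<beta>"
      by (rule cont) (use l in \<open>auto intro!: continuous_intros open_Collect_less\<close>)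
    then obtain \<beta> where "1 < \<beta>" "a < l / \<beta>"
      unfolding eventually_at_right_field by (metis dense less_numeral_extra(4) order_less_trans)
    then show "\<forall>\<^sub>F x in at_top. a < f x / x" using key[of \<beta> l "L + 1"] l
      by (auto elim!: eventually_mono)
  next
    fix a assume a: "L < a"
    obtain u where u: "u < a" "L < u" using a dense by blast
    have "\<forall>\<^sub>F \<beta> in at_right 1. \<beta> * u < a"
      by (rule cont) (use u in \<open>auto intro!: continuous_intros open_Collect_less\<close>)
    then obtain \<beta> where "1 < \<beta>" "\<beta> * u < a"
      unfolding eventually_at_right_field by (metis dense less_numeral_extra(4) order_less_trans)
    then show "\<forall>\<^sub>F x in at_top. f x / x < a" using key[of \<beta> "L - 1" u] u
      by (auto elim!: eventually_mono)
  qed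
qed

text \<open>Summable expectations make the series finite almost everywhere, so its terms tend to 0.
  This takes the place of the Borel-Cantelli lemma below.\<close>

lemma AE_tendsto_zero:
  assumes [measurable]: "\<And>i. Z i \<in> borel_measurable M"
    and nonneg: "\<And>i \<omega>. 0 \<le> (Z i \<omega> :: real)"
    and fin: "(\<Sum>i. \<integral>\<^sup>+\<omega>. ennreal (Z i \<omega>) \<partial>M) \<noteq> \<infinity>"
  shows "AE \<omega> in M. (\<lambda>i. Z i \<omega>) \<longlonglongrightarrow> 0"
proof -
  have "(\<integral>\<^sup>+\<omega>. (\<Sum>i. ennreal (Z i \<omega>)) \<partial>M) \<noteq> \<infinity>"
    using fin by (subst nn_integral_suminf) auto
  then have "AE \<omega> in M. (\<Sum>i. ennreal (Z i \<omega>)) \<noteq> \<infinity>"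
    by (intro nn_integral_PInf_AE) auto
  then show ?thesis
  proof eventually_elim
    case (elim \<omega>)
    then have "summable (\<lambda>i. Z i \<omega>)" by (intro summable_suminf_not_top) (use nonneg in auto)
    then show ?case by (rule summable_LIMSEQ_zero)
  qed
qed

lemma AE_tendsto_zero_second_moment:
  fixes Z :: "nat \<Rightarrow> 'a \<Rightarrow> real"
  assumes [measurable]: "\<And>i. Z i \<in> borel_measurable M"
    and bound: "\<And>i. (\<integral>\<^sup>+\<omega>. ennreal ((Z i \<omega>)\<^sup>2) \<partial>M) \<le> ennreal (c i)"
    and c: "summable c" "\<And>i. 0 \<le> c i"
  shows "AE \<omega> in M. (\<lambda>i. Z i \<omega>) \<longlonglongrightarrow> 0"
proof -
  have "(\<Sum>i. \<integral>\<^sup>+\<omega>. ennreal ((Z i \<omega>)\<^sup>2) \<partial>M) \<le> (\<Sum>i. ennreal (c i))"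
    by (intro suminf_le bound) auto
  also have "\<dots> < \<infinity>" using c by (simp add: suminf_ennreal2 less_top)
  finally have "(\<Sum>i. \<integral>\<^sup>+\<omega>. ennreal ((Z i \<omega>)\<^sup>2) \<partial>M) \<noteq> \<infinity>" by simp
  then have "AE \<omega> in M. (\<lambda>i. (Z i \<omega>)\<^sup>2) \<longlonglongrightarrow> 0" by (intro AE_tendsto_zero) auto
  then show ?thesis
  proof eventually_elim
    case (elim \<omega>)
    from tendsto_real_sqrt[OF this] show ?case by (simp add: tendsto_rabs_zero_iff)
  qed
qed

lemma integrable_mult_square:
  fixes f g :: "'a \<Rightarrow> real"
  assumes [measurable]: "f \<in> borel_measurable M" "g \<in> borel_measurable M"
    and "integrable M (\<lambda>\<omega>. (f \<omega>)\<^sup>2)" "integrable M (\<lambda>\<omega>. (g \<omega>)\<^sup>2)"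
  shows "integrable M (\<lambda>\<omega>. f \<omega> * g \<omega>)"
proof (rule Bochner_Integration.integrable_bound)
  show "integrable M (\<lambda>\<omega>. (f \<omega>)\<^sup>2 + (g \<omega>)\<^sup>2)" using assms by simp
  have "\<bar>a * b\<bar> \<le> a\<^sup>2 + b\<^sup>2" for a b :: real
    using sum_squares_bound[of a b] sum_squares_bound[of a "-b"] by (simp add: abs_if)
  then show "AE \<omega> in M. norm (f \<omega> * g \<omega>) \<le> norm ((f \<omega>)\<^sup>2 + (g \<omega>)\<^sup>2)" by simp
qed measurable

lemma second_moment_orthogonal_sum:
  fixes D :: "nat \<Rightarrow> 'a \<Rightarrow> real"
  assumes [measurable]: "\<And>k. D k \<in> borel_measurable M"
    and sq: "\<And>k. integrable M (\<lambda>\<omega>. (D k \<omega>)\<^sup>2)"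
    and orth: "\<And>k l. l < k \<Longrightarrow> (\<integral>\<omega>. D l \<omega> * D k \<omega> \<partial>M) = 0"
  shows "integrable M (\<lambda>\<omega>. (\<Sum>k<K. D k \<omega>)\<^sup>2)"
    and "(\<integral>\<omega>. (\<Sum>k<K. D k \<omega>)\<^sup>2 \<partial>M) = (\<Sum>k<K. \<integral>\<omega>. (D k \<omega>)\<^sup>2 \<partial>M)"
proof (induction K)
  case (Suc K)
  have eq: "(\<lambda>\<omega>. (\<Sum>k<Suc K. D k \<omega>)\<^sup>2) =
    (\<lambda>\<omega>. (\<Sum>k<K. D k \<omega>)\<^sup>2 + 2 * (\<Sum>k<K. D k \<omega> * D K \<omega>) + (D K \<omega>)\<^sup>2)"
    by (simp add: power2_eq_square algebra_simps sum_distrib_right sum_distrib_left fun_eq_iff)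
  have int: "integrable M (\<lambda>\<omega>. D k \<omega> * D K \<omega>)" for k
    by (rule integrable_mult_square) (use sq in auto)
  {
    case 1
    show ?case unfolding eq using Suc int sq by auto
  next
    case 2
    have "(\<integral>\<omega>. (\<Sum>k<K. D k \<omega> * D K \<omega>) \<partial>M) = 0" using int orth by simp
    then show ?case unfolding eq using Suc int sq by simp
  }
qed simp_all

text \<open>The subsequence \<open>k ^ 4\<close> is dense enough for monotone interpolation, and sparse
  enough for the variances \<open>k ^ 4 / k ^ 6\<close> to be summable.\<close>

lemma (in prob_space) lln_rate:
  fixes Y :: "nat \<Rightarrow> 'a \<Rightarrow> real"
  assumes [measurable]: "\<And>k. Y k \<in> borel_measurable M"
    and nonneg: "\<And>k. AE \<omega> in M. 0 \<le> Y k \<omega>" and "0 \<le> \<mu>" "0 \<le> v"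
    and var: "\<And>k. integrable M (\<lambda>\<omega>. (Y k \<omega> - \<mu>)\<^sup>2)" "\<And>k. (\<integral>\<omega>. (Y k \<omega> - \<mu>)\<^sup>2 \<partial>M) \<le> v"
    and orth: "\<And>k l. l < k \<Longrightarrow> (\<integral>\<omega>. (Y l \<omega> - \<mu>) * (Y k \<omega> - \<mu>) \<partial>M) = 0"
  shows "AE \<omega> in M. \<exists>C\<ge>0. \<forall>k K. K \<le> k ^ 4 \<longrightarrow> \<bar>(\<Sum>i<K. Y i \<omega>) - \<mu> * real K\<bar> \<le> C * real k ^ 3"
proof -
  \<comment> \<open>The normalisation \<open>k ^ 3\<close> is the power 3/4 of the number
    \<open>k ^ 4\<close> of summands.\<close>
  define Z where "Z k \<omega> = (\<Sum>i<k ^ 4. Y i \<omega> - \<mu>) / real k ^ 3" for k \<omega>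
  have [measurable]: "\<And>k. Z k \<in> borel_measurable M" unfolding Z_def by measurable
  have "AE \<omega> in M. (\<lambda>k. Z k \<omega>) \<longlonglongrightarrow> 0"
  proof (rule AE_tendsto_zero_second_moment)
    show "summable (\<lambda>k. v * (1 / real k ^ 2))"
      by (intro summable_mult) (use inverse_power_summable[of 2, where 'a=real] in \<open>simp add: field_simps\<close>)
    show "0 \<le> v * (1 / real k ^ 2)" for k using \<open>0 \<le> v\<close> by simp
    show "(\<integral>\<^sup>+\<omega>. ennreal ((Z k \<omega>)\<^sup>2) \<partial>M) \<le> ennreal (v * (1 / real k ^ 2))" for k
    proof -
      note s = second_moment_orthogonal_sum[of "\<lambda>k \<omega>. Y k \<omega> - \<mu>" M "k ^ 4", OF _ var(1) orth, simplified]
      have eq: "(Z k \<omega>)\<^sup>2 = (\<Sum>i<k ^ 4. Y i \<omega> - \<mu>)\<^sup>2 / real k ^ 6" for \<omega>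
        by (simp add: Z_def power_divide power_mult[symmetric])
      have "integrable M (\<lambda>\<omega>. (Z k \<omega>)\<^sup>2)" unfolding eq using s by simp
      then have "(\<integral>\<^sup>+\<omega>. ennreal ((Z k \<omega>)\<^sup>2) \<partial>M) = ennreal (\<integral>\<omega>. (Z k \<omega>)\<^sup>2 \<partial>M)"
        by (intro nn_integral_eq_integral) auto
      also have "(\<integral>\<omega>. (Z k \<omega>)\<^sup>2 \<partial>M) = (\<Sum>i<k ^ 4. \<integral>\<omega>. (Y i \<omega> - \<mu>)\<^sup>2 \<partial>M) / real k ^ 6"
        unfolding eq using s by simp
      also have "\<dots> \<le> (\<Sum>i<k ^ 4. v) / real k ^ 6"
        by (intro divide_right_mono sum_mono var) auto
      also have "\<dots> = v * (1 / real k ^ 2)" by (cases "k = 0") (simp_all add: field_simps power_numeral_reduce)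
      finally show ?thesis by (simp add: ennreal_leI)
    qed
  qed measurable
  moreover have "AE \<omega> in M. \<forall>k. 0 \<le> Y k \<omega>" using nonneg by (simp add: AE_all_countable)
  ultimately show ?thesis
  proof eventually_elim
    case (elim \<omega>)
    define A where "A K = (\<Sum>i<K. Y i \<omega>)" for K
    have A_mono: "A K \<le> A L" if "K \<le> L" for K L
      unfolding A_def using that elim by (intro sum_mono2) auto
    obtain c where c: "0 < c" "\<And>k. \<bar>Z k \<omega>\<bar> \<le> c"
      using convergent_imp_Bseq[OF convergentI[OF elim(1)]] by (auto simp: Bseq_def)
    have A_sq: "\<bar>A (k ^ 4) - \<mu> * real k ^ 4\<bar> \<le> c * real k ^ 3" for k
    proof (cases "k = 0")
      case False
      have "Z k \<omega> = (A (k ^ 4) - \<mu> * real k ^ 4) / real k ^ 3"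
        by (simp add: Z_def A_def sum_subtractf mult.commute)
      then show ?thesis using c(2)[of k] False by (simp add: abs_divide divide_le_eq)
    qed (simp add: A_def)
    have "\<bar>A K - \<mu> * real K\<bar> \<le> (4 * \<mu> + c) * real k ^ 3" if K: "K \<le> k ^ 4" for k K
    proof -
      \<comment> \<open>With the least such \<open>j\<close>, the index \<open>K\<close> lies
        between \<open>(j - 1) ^ 4\<close> and \<open>j ^ 4\<close>. This gap is at most
        \<open>4 * j ^ 3\<close>, so interpolating across it does not worsen the rate.\<close>
      obtain j where j: "K \<le> j ^ 4" "\<And>i. i < j \<Longrightarrow> \<not> K \<le> i ^ 4"
        using exists_least_iff[of "\<lambda>j. K \<le> j ^ 4"] K by blast
      have jk: "j \<le> k" using j(2)[of k] K by (meson not_le_imp_less)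
      show ?thesis
      proof (cases j)
        case 0
        then show ?thesis using j(1) c \<open>0 \<le> \<mu>\<close> by (simp add: A_def)
      next
        case (Suc i)
        have i: "i ^ 4 \<le> K" using j(2)[of i] Suc by simp
        have gap: "real j ^ 4 - real i ^ 4 \<le> 4 * real j ^ 3"
          unfolding Suc by (simp add: power_numeral_reduce algebra_simps)
        have j3: "real j ^ 3 \<le> real k ^ 3" and i3: "real i ^ 3 \<le> real k ^ 3"
          using jk Suc by (auto intro!: power_mono)
        have gap: "real j ^ 4 - real i ^ 4 \<le> 4 * real k ^ 3" using gap j3 by linarith
        have i4: "real i ^ 4 \<le> real K" and j4: "real K \<le> real j ^ 4"
          using i j(1) by (simp_all flip: of_nat_power)
        have "A K - \<mu> * real K \<le> A (j ^ 4) - \<mu> * real i ^ 4"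
          using A_mono[OF j(1)] mult_left_mono[OF i4 \<open>0 \<le> \<mu>\<close>] by linarith
        also have "\<dots> \<le> c * real j ^ 3 + \<mu> * (real j ^ 4 - real i ^ 4)"
          using A_sq[of j] by (simp add: algebra_simps)
        also have "\<dots> \<le> c * real k ^ 3 + \<mu> * (4 * real k ^ 3)"
          using c gap j3 \<open>0 \<le> \<mu>\<close> by (intro add_mono mult_left_mono) auto
        finally have up: "A K - \<mu> * real K \<le> (4 * \<mu> + c) * real k ^ 3" by (simp add: algebra_simps)
        have "\<mu> * real K - A K \<le> \<mu> * real j ^ 4 - A (i ^ 4)"
          using A_mono[OF i] mult_left_mono[OF j4 \<open>0 \<le> \<mu>\<close>] by linarith
        also have "\<dots> \<le> c * real i ^ 3 + \<mu> * (real j ^ 4 - real i ^ 4)"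
          using A_sq[of i] by (simp add: algebra_simps)
        also have "\<dots> \<le> c * real k ^ 3 + \<mu> * (4 * real k ^ 3)"
          using c gap j3 i3 \<open>0 \<le> \<mu>\<close> by (intro add_mono mult_left_mono) auto
        finally show ?thesis using up by (simp add: algebra_simps)
      qed
    qed
    then show ?case using c \<open>0 \<le> \<mu>\<close> unfolding A_def by (intro exI[of _ "4 * \<mu> + c"]) auto
  qed
qed

lemma lln_rate_imp_tendsto:
  assumes rate: "\<And>k K. K \<le> k ^ 4 \<Longrightarrow> \<bar>A K - \<mu> * real K\<bar> \<le> C * real k ^ 3" and "0 \<le> C"
  shows "(\<lambda>K. A K / real K) \<longlonglongrightarrow> \<mu>"
proof -
  have "(\<lambda>K. A K / real K - \<mu>) \<longlonglongrightarrow> 0"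
  proof (rule Lim_null_comparison)
    show "(\<lambda>K. 8 * C / root 4 (real K)) \<longlonglongrightarrow> 0"
      by real_asymp
    show "\<forall>\<^sub>F K in sequentially. norm (A K / real K - \<mu>) \<le> 8 * C / root 4 (real K)"
      using eventually_gt_at_top[of 0]
    proof eventually_elim
      case (elim K)
      define r where "r = root 4 (real K)"
      \<comment> \<open>The least \<open>k\<close> with \<open>K \<le> k ^ 4\<close>. It is at most
        \<open>2 * r\<close> because \<open>1 \<le> r\<close>, which produces the factor
        \<open>2 ^ 3 = 8\<close>.\<close>
      define k where "k = nat \<lceil>r\<rceil>"
      have r: "1 \<le> r" "r ^ 4 = real K" using elim by (auto simp: r_def)
      have k: "r \<le> real k" "real k \<le> 2 * r" using r by (auto simp: k_def) linarith
      have "real K \<le> real k ^ 4" using r k power_mono[of r "real k" 4] by simp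
      then have "\<bar>A K - \<mu> * real K\<bar> \<le> C * real k ^ 3" by (intro rate) (simp flip: of_nat_power)
      also have "\<dots> \<le> C * (2 * r) ^ 3" using k \<open>0 \<le> C\<close> by (intro mult_left_mono power_mono) auto
      finally have "\<bar>A K - \<mu> * real K\<bar> / real K \<le> C * (2 * r) ^ 3 / r ^ 4" using r elim
        by (simp add: divide_right_mono)
      also have "\<dots> = 8 * C / r" using r(1) by (simp add: power_numeral_reduce field_simps)
      also have "\<bar>A K - \<mu> * real K\<bar> / real K = \<bar>(A K - \<mu> * real K) / real K\<bar>" by simp
      also have "(A K - \<mu> * real K) / real K = A K / real K - \<mu>" using elim by (simp add: field_simps)
      finally show ?case by (simp add: r_def)
    qed
  qed
  then show ?thesis by (simp add: LIM_zero_iff)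
qed

text \<open>Both sums below are geometric, hence at most a constant times their largest term.\<close>

lemma sum_powers_below:
  fixes \<alpha> y :: real
  assumes "1 < \<alpha>" "0 \<le> y"
  shows "(\<Sum>k<m. if \<alpha> ^ k < y then \<alpha> ^ k else 0) \<le> \<alpha> / (\<alpha> - 1) * y"
proof (induction m)
  case (Suc m)
  show ?case
  proof (cases "\<alpha> ^ m < y")
    case True
    have "(\<Sum>k<Suc m. if \<alpha> ^ k < y then \<alpha> ^ k else 0) \<le> (\<Sum>k<Suc m. \<alpha> ^ k)"
      using assms by (intro sum_mono) auto
    also have "\<dots> = (\<alpha> ^ Suc m - 1) / (\<alpha> - 1)" using assms by (subst geometric_sum) auto
    also have "\<dots> \<le> \<alpha> / (\<alpha> - 1) * \<alpha> ^ m" using assms by (simp add: divide_right_mono)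
    also have "\<dots> \<le> \<alpha> / (\<alpha> - 1) * y" using assms True by (intro mult_left_mono) auto
    finally show ?thesis .
  qed (use Suc in simp)
qed (use assms in simp)

lemma sum_inverse_powers_above:
  fixes \<alpha> y :: real
  assumes "1 < \<alpha>" "0 < y"
  shows "(\<Sum>k<m. if y \<le> \<alpha> ^ k then 1 / \<alpha> ^ k else 0) \<le> \<alpha> / (\<alpha> - 1) * (1 / y)"
proof -
  define c where "c = \<alpha> / (\<alpha> - 1)"
  have c: "0 < c" "1 + c / \<alpha> = c" using assms by (auto simp: c_def field_simps)
  have "(\<alpha> ^ m < y \<longrightarrow> (\<Sum>k<m. if y \<le> \<alpha> ^ k then 1 / \<alpha> ^ k else 0) = 0) \<and>
    (y \<le> \<alpha> ^ m \<longrightarrow> (\<Sum>k<m. if y \<le> \<alpha> ^ k then 1 / \<alpha> ^ k else 0) \<le> c * (1 / y) - c * (1 / \<alpha> ^ m))"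
  proof (induction m)
    case 0
    have "c \<le> c * (1 / y)" if "y \<le> 1"
      using mult_left_mono[of 1 "1 / y" c] that assms c by simp
    then show ?case by auto
  next
    case (Suc m)
    let ?s = "\<lambda>m. \<Sum>k<m. if y \<le> \<alpha> ^ k then 1 / \<alpha> ^ k else 0"
    have m: "\<alpha> ^ m < \<alpha> ^ Suc m" using assms by simp
    have inv: "y \<le> z \<Longrightarrow> c * (1 / z) \<le> c * (1 / y)" for z
      using assms c by (intro mult_left_mono divide_left_mono) auto
    show ?case
    proof (cases "y \<le> \<alpha> ^ m")
      case True
      have "1 / \<alpha> ^ m - c * (1 / \<alpha> ^ m) = (1 - c) * (1 / \<alpha> ^ m)" by (simp add: diff_divide_distrib)
      also have "1 - c = - (c / \<alpha>)" using c by linarith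
      also have "- (c / \<alpha>) * (1 / \<alpha> ^ m) = - (c * (1 / \<alpha> ^ Suc m))" by simp
      finally have "1 / \<alpha> ^ m - c * (1 / \<alpha> ^ m) = - (c * (1 / \<alpha> ^ Suc m))" .
      moreover have "?s (Suc m) = ?s m + 1 / \<alpha> ^ m" using True by simp
      moreover have "\<not> \<alpha> ^ Suc m < y" using True m by linarith
      ultimately show ?thesis using Suc True by linarith
    next
      case False
      then have "?s (Suc m) = 0" using Suc by simp
      then show ?thesis using inv[of "\<alpha> ^ Suc m"] by auto
    qed
  qed
  then have "(\<Sum>k<m. if y \<le> \<alpha> ^ k then 1 / \<alpha> ^ k else 0) \<le> c * (1 / y)"
    using c assms by (smt (verit) divide_nonneg_nonneg mult_nonneg_nonneg zero_le_power)
  then show ?thesis by (simp add: c_def)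
qed

lemma suminf_ennreal_le:
  assumes "\<And>m. (\<Sum>k<m. f k) \<le> c" "\<And>k. (0::real) \<le> f k"
  shows "(\<Sum>k. ennreal (f k)) \<le> ennreal c"
  by (rule suminf_le_const) (use assms in \<open>auto simp: ennreal_leI\<close>)

lemma power_at_top:
  fixes \<alpha> :: real
  assumes "1 < \<alpha>"
  shows "filterlim (\<lambda>k. \<alpha> ^ k) at_top sequentially"
  by (rule filterlim_at_infinity_imp_filterlim_at_top[OF filterlim_realpow_sequentially_gt1])
     (use assms in auto)

text \<open>Truncation at \<open>\<alpha> ^ k\<close> for about \<open>\<alpha> ^ k\<close>
  summands, because only the mean of \<open>Y 0\<close> is known to be finite. Summed over
  \<open>k\<close>, the expected numbers of truncated variables and the variances of the truncated
  averages are both at most a multiple of this mean: the sum is moved inside the expectation, where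
  \<open>sum_powers_below\<close> and \<open>sum_inverse_powers_above\<close> apply
  pointwise.\<close>

lemma (in prob_space) strong_law_geometric:
  fixes Y :: "nat \<Rightarrow> 'a \<Rightarrow> real"
  assumes indep: "indep_vars (\<lambda>_. borel) Y UNIV"
    and ident: "\<And>k. distr M borel (Y k) = distr M borel (Y 0)"
    and int: "integrable M (Y 0)" and nonneg: "\<And>k \<omega>. 0 \<le> Y k \<omega>" and \<alpha>: "1 < \<alpha>"
  shows "AE \<omega> in M. (\<lambda>k. (\<Sum>i<nat \<lceil>\<alpha> ^ k\<rceil>. Y i \<omega>) / \<alpha> ^ k) \<longlonglongrightarrow> expectation (Y 0)"
proof -
  have [measurable]: "\<And>k. Y k \<in> borel_measurable M" using indep by (auto simp: indep_vars_def)
  define n where "n k = nat \<lceil>\<alpha> ^ k\<rceil>" for k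
  define X where "X k i \<omega> = (if Y i \<omega> \<le> \<alpha> ^ k then Y i \<omega> else 0)" for k i \<omega>
  have [measurable]: "\<And>k i. X k i \<in> borel_measurable M" unfolding X_def by measurable
  have \<alpha>k: "1 \<le> \<alpha> ^ k" "0 < \<alpha> ^ k" for k using \<alpha> by simp_all
  have n: "real (n k) \<le> 2 * \<alpha> ^ k" "\<alpha> ^ k \<le> real (n k)" "real (n k) \<le> \<alpha> ^ k + 1" for k
    using \<alpha>k[of k] unfolding n_def by linarith+
  have same: "(\<integral>\<^sup>+\<omega>. g (Y i \<omega>) \<partial>M) = (\<integral>\<^sup>+\<omega>. g (Y 0 \<omega>) \<partial>M)"
    if [measurable]: "g \<in> borel_measurable borel" for g :: "real \<Rightarrow> ennreal" and i
  proof -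
    have "(\<integral>\<^sup>+\<omega>. g (Y i \<omega>) \<partial>M) = (\<integral>\<^sup>+z. g z \<partial>distr M borel (Y i))" by (subst nn_integral_distr) auto
    also have "\<dots> = (\<integral>\<^sup>+z. g z \<partial>distr M borel (Y 0))" by (simp only: ident[of i])
    also have "\<dots> = (\<integral>\<^sup>+\<omega>. g (Y 0 \<omega>) \<partial>M)" by (subst nn_integral_distr) auto
    finally show ?thesis .
  qed
  have fin: "(\<integral>\<^sup>+\<omega>. ennreal (Y 0 \<omega>) \<partial>M) \<noteq> \<infinity>"
    using int nonneg by (simp add: nn_integral_eq_integral)
  \<comment> \<open>The 2 comes from \<open>real (n k) \<le> 2 * \<alpha> ^ k\<close>, the other
    factor from the geometric sums.\<close>
  define c where "c = 2 * (\<alpha> / (\<alpha> - 1))"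
  have c: "0 < c" using \<alpha> by (simp add: c_def)
  define I where "I k i \<omega> = (indicator {\<alpha> ^ k<..} (Y i \<omega>) :: real)" for k i \<omega>
  have [measurable]: "\<And>k i. I k i \<in> borel_measurable M" unfolding I_def by measurable
  have I_nonneg: "0 \<le> I k i \<omega>" for k i \<omega> by (simp add: I_def)
  \<comment> \<open>The count is an integer, so convergence to 0 means that eventually no variable
    is truncated.\<close>
  have few: "AE \<omega> in M. (\<lambda>k. \<Sum>i<n k. I k i \<omega>) \<longlonglongrightarrow> 0"
  proof (rule AE_tendsto_zero)
    have same_I: "(\<integral>\<^sup>+\<omega>. ennreal (I k i \<omega>) \<partial>M) = (\<integral>\<^sup>+\<omega>. ennreal (I k 0 \<omega>) \<partial>M)" for k i
      unfolding I_def by (rule same) measurable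
    have sum_I: "(\<integral>\<^sup>+\<omega>. ennreal (\<Sum>i<n k. I k i \<omega>) \<partial>M) = (\<Sum>i<n k. \<integral>\<^sup>+\<omega>. ennreal (I k i \<omega>) \<partial>M)" for k
      by (subst nn_integral_sum[symmetric]) (simp_all add: I_nonneg sum_ennreal)
    have "(\<integral>\<^sup>+\<omega>. ennreal (\<Sum>i<n k. I k i \<omega>) \<partial>M) = (\<Sum>i<n k. \<integral>\<^sup>+\<omega>. ennreal (I k 0 \<omega>) \<partial>M)" for k
      unfolding sum_I by (intro sum.cong refl same_I)
    then have "(\<Sum>k. \<integral>\<^sup>+\<omega>. ennreal (\<Sum>i<n k. I k i \<omega>) \<partial>M) =
       (\<Sum>k. \<integral>\<^sup>+\<omega>. ennreal (real (n k) * indicator {\<alpha> ^ k<..} (Y 0 \<omega>)) \<partial>M)"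
      by (simp add: I_def ennreal_mult nn_integral_cmult ennreal_of_nat_eq_real_of_nat)
    also have "\<dots> = (\<integral>\<^sup>+\<omega>. (\<Sum>k. ennreal (real (n k) * indicator {\<alpha> ^ k<..} (Y 0 \<omega>))) \<partial>M)"
      by (subst nn_integral_suminf) auto
    also have "\<dots> \<le> (\<integral>\<^sup>+\<omega>. ennreal c * ennreal (Y 0 \<omega>) \<partial>M)"
    proof (intro nn_integral_mono)
      fix \<omega>
      have "(\<Sum>k. ennreal (real (n k) * indicator {\<alpha> ^ k<..} (Y 0 \<omega>))) \<le> ennreal (c * Y 0 \<omega>)"
      proof (rule suminf_ennreal_le)
        fix m
        have "(\<Sum>k<m. real (n k) * indicator {\<alpha> ^ k<..} (Y 0 \<omega>)) \<le>
          (\<Sum>k<m. 2 * (if \<alpha> ^ k < Y 0 \<omega> then \<alpha> ^ k else 0))"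
          by (intro sum_mono) (use n in \<open>auto simp: indicator_def\<close>)
        also have "\<dots> \<le> c * Y 0 \<omega>"
          using sum_powers_below[OF \<alpha> nonneg[of 0 \<omega>], of m] by (simp add: c_def flip: sum_distrib_left)
        finally show "(\<Sum>k<m. real (n k) * indicator {\<alpha> ^ k<..} (Y 0 \<omega>)) \<le> c * Y 0 \<omega>" .
      qed simp
      then show "(\<Sum>k. ennreal (real (n k) * indicator {\<alpha> ^ k<..} (Y 0 \<omega>))) \<le> ennreal c * ennreal (Y 0 \<omega>)"
        using c nonneg by (simp add: ennreal_mult)
    qed
    also have "\<dots> < \<infinity>" using fin by (simp add: nn_integral_cmult ennreal_mult_less_top less_top)
    finally show "(\<Sum>k. \<integral>\<^sup>+\<omega>. ennreal (\<Sum>i<n k. I k i \<omega>) \<partial>M) \<noteq> \<infinity>" by simp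
  qed (auto intro: sum_nonneg I_nonneg)
  have fluct: "AE \<omega> in M. (\<lambda>k. (\<Sum>i<n k. X k i \<omega> - expectation (X k 0)) / \<alpha> ^ k) \<longlonglongrightarrow> 0"
  proof -
    have X_bound: "\<bar>X k i \<omega>\<bar> \<le> \<alpha> ^ k" for k i \<omega> using nonneg \<alpha>k[of k] by (auto simp: X_def)
    have X_int: "integrable M (X k i)" for k i
      by (rule integrable_const_bound[where B="\<alpha> ^ k"]) (use X_bound in auto)
    have X2_int: "integrable M (\<lambda>\<omega>. (X k i \<omega>)\<^sup>2)" for k i
      by (rule integrable_const_bound[where B="(\<alpha> ^ k)\<^sup>2"]) (use X_bound in \<open>auto intro: power2_le_iff_abs_le[THEN iffD2] simp: abs_le_square_iff[symmetric] less_imp_le \<alpha>k\<close>)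
    have distr_X: "expectation (X k i) = expectation (X k 0)"
       "expectation (\<lambda>\<omega>. (X k i \<omega>)\<^sup>2) = expectation (\<lambda>\<omega>. (X k 0 \<omega>)\<^sup>2)" for k i
    proof -
      have *: "expectation (\<lambda>\<omega>. g (Y i \<omega>)) = expectation (\<lambda>\<omega>. g (Y 0 \<omega>))"
        if [measurable]: "g \<in> borel_measurable borel" for g :: "real \<Rightarrow> real"
      proof -
        have "expectation (\<lambda>\<omega>. g (Y i \<omega>)) = (\<integral>z. g z \<partial>distr M borel (Y i))" by (subst integral_distr) auto
        also have "\<dots> = (\<integral>z. g z \<partial>distr M borel (Y 0))" by (simp only: ident[of i])
        also have "\<dots> = expectation (\<lambda>\<omega>. g (Y 0 \<omega>))" by (subst integral_distr) auto
        finally show ?thesis .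
      qed
      show "expectation (X k i) = expectation (X k 0)"
        using *[of "\<lambda>z. if z \<le> \<alpha> ^ k then z else 0"] by (simp add: X_def[abs_def])
      show "expectation (\<lambda>\<omega>. (X k i \<omega>)\<^sup>2) = expectation (\<lambda>\<omega>. (X k 0 \<omega>)\<^sup>2)"
        using *[of "\<lambda>z. (if z \<le> \<alpha> ^ k then z else 0)\<^sup>2"] by (simp add: X_def[abs_def])
    qed
    define e where "e k = expectation (X k 0)" for k
    have var: "expectation (\<lambda>\<omega>. (X k i \<omega> - e k)\<^sup>2) \<le> expectation (\<lambda>\<omega>. (X k 0 \<omega>)\<^sup>2)"
      "integrable M (\<lambda>\<omega>. (X k i \<omega> - e k)\<^sup>2)" for k i
    proof -
      have eq: "(\<lambda>\<omega>. (X k i \<omega> - e k)\<^sup>2) = (\<lambda>\<omega>. (X k i \<omega>)\<^sup>2 + (e k)\<^sup>2 - 2 * e k * X k i \<omega>)"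
        by (simp add: power2_diff fun_eq_iff)
      show "integrable M (\<lambda>\<omega>. (X k i \<omega> - e k)\<^sup>2)" unfolding eq using X_int X2_int by auto
      have "expectation (\<lambda>\<omega>. (X k i \<omega> - e k)\<^sup>2) = expectation (\<lambda>\<omega>. (X k i \<omega>)\<^sup>2) + (e k)\<^sup>2 - 2 * e k * e k"
        unfolding eq using X_int X2_int distr_X(1)[of k i] by (simp add: prob_space e_def)
      also have "\<dots> \<le> expectation (\<lambda>\<omega>. (X k i \<omega>)\<^sup>2)" by (simp add: power2_eq_square)
      finally show "expectation (\<lambda>\<omega>. (X k i \<omega> - e k)\<^sup>2) \<le> expectation (\<lambda>\<omega>. (X k 0 \<omega>)\<^sup>2)"
        using distr_X(2)[of k i] by simp
    qed
    have orth: "expectation (\<lambda>\<omega>. (X k i \<omega> - e k) * (X k j \<omega> - e k)) = 0" if "i < j" for k i j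
    proof -
      have "indep_vars (\<lambda>_. borel) (\<lambda>i \<omega>. (if Y i \<omega> \<le> \<alpha> ^ k then Y i \<omega> else 0) - e k) {i, j}"
        by (rule indep_vars_compose2[OF indep_vars_subset[OF indep subset_UNIV]]) measurable
      then have "indep_vars (\<lambda>_. borel) (\<lambda>i \<omega>. X k i \<omega> - e k) {i, j}" by (simp add: X_def)
      from indep_vars_lebesgue_integral[OF _ this] show ?thesis
        using that X_int distr_X(1)[of k] by (simp add: prob_space e_def)
    qed
    have "AE \<omega> in M. (\<lambda>k. ((\<Sum>i<n k. X k i \<omega> - e k) / \<alpha> ^ k)\<^sup>2) \<longlonglongrightarrow> 0"
    proof (rule AE_tendsto_zero)
      have "(\<integral>\<^sup>+\<omega>. ennreal (((\<Sum>i<n k. X k i \<omega> - e k) / \<alpha> ^ k)\<^sup>2) \<partial>M) \<le>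
         (\<integral>\<^sup>+\<omega>. ennreal (2 * (X k 0 \<omega>)\<^sup>2 / \<alpha> ^ k) \<partial>M)" for k
      proof -
        note s = second_moment_orthogonal_sum[of "\<lambda>i \<omega>. X k i \<omega> - e k" M "n k", OF _ var(2) orth, simplified]
        have "(\<integral>\<^sup>+\<omega>. ennreal (((\<Sum>i<n k. X k i \<omega> - e k) / \<alpha> ^ k)\<^sup>2) \<partial>M) =
          ennreal (expectation (\<lambda>\<omega>. (\<Sum>i<n k. X k i \<omega> - e k)\<^sup>2) / (\<alpha> ^ k)\<^sup>2)"
          using s by (subst nn_integral_eq_integral) (auto simp: power_divide)
        also have "\<dots> \<le> ennreal (real (n k) * expectation (\<lambda>\<omega>. (X k 0 \<omega>)\<^sup>2) / (\<alpha> ^ k)\<^sup>2)"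
          unfolding s
          by (intro ennreal_leI divide_right_mono sum_bounded_above[of "{..<n k}", simplified] var) auto
        also have "\<dots> \<le> ennreal (2 * \<alpha> ^ k * expectation (\<lambda>\<omega>. (X k 0 \<omega>)\<^sup>2) / (\<alpha> ^ k)\<^sup>2)"
          using n by (intro ennreal_leI divide_right_mono mult_right_mono) auto
        also have "\<dots> = ennreal (expectation (\<lambda>\<omega>. 2 * (X k 0 \<omega>)\<^sup>2 / \<alpha> ^ k))"
          using \<alpha>k[of k] by (simp add: power2_eq_square)
        also have "\<dots> = (\<integral>\<^sup>+\<omega>. ennreal (2 * (X k 0 \<omega>)\<^sup>2 / \<alpha> ^ k) \<partial>M)"
          using X2_int \<alpha>k[of k] by (subst nn_integral_eq_integral) (auto simp: less_imp_le)
        finally show ?thesis .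
      qed
      then have "(\<Sum>k. \<integral>\<^sup>+\<omega>. ennreal (((\<Sum>i<n k. X k i \<omega> - e k) / \<alpha> ^ k)\<^sup>2) \<partial>M) \<le>
         (\<Sum>k. \<integral>\<^sup>+\<omega>. ennreal (2 * (X k 0 \<omega>)\<^sup>2 / \<alpha> ^ k) \<partial>M)" by (intro suminf_le) auto
      also have "\<dots> = (\<integral>\<^sup>+\<omega>. (\<Sum>k. ennreal (2 * (X k 0 \<omega>)\<^sup>2 / \<alpha> ^ k)) \<partial>M)"
        by (subst nn_integral_suminf) auto
      also have "\<dots> \<le> (\<integral>\<^sup>+\<omega>. ennreal c * ennreal (Y 0 \<omega>) \<partial>M)"
      proof (intro nn_integral_mono)
        fix \<omega>
        have "(\<Sum>k. ennreal (2 * (X k 0 \<omega>)\<^sup>2 / \<alpha> ^ k)) \<le> ennreal (c * Y 0 \<omega>)"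
        proof (rule suminf_ennreal_le)
          fix m
          show "(\<Sum>k<m. 2 * (X k 0 \<omega>)\<^sup>2 / \<alpha> ^ k) \<le> c * Y 0 \<omega>"
          proof (cases "Y 0 \<omega> = 0")
            case True
            then have "X k 0 \<omega> = 0" for k by (simp add: X_def)
            then show ?thesis using True by simp
          next
            case False
            then have y: "0 < Y 0 \<omega>" using nonneg[of 0 \<omega>] by simp
            have "(\<Sum>k<m. 2 * (X k 0 \<omega>)\<^sup>2 / \<alpha> ^ k) =
              2 * (Y 0 \<omega>)\<^sup>2 * (\<Sum>k<m. if Y 0 \<omega> \<le> \<alpha> ^ k then 1 / \<alpha> ^ k else 0)"
              unfolding sum_distrib_left by (intro sum.cong) (auto simp: X_def)
            also have "\<dots> \<le> 2 * (Y 0 \<omega>)\<^sup>2 * (\<alpha> / (\<alpha> - 1) * (1 / Y 0 \<omega>))"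
              by (intro mult_left_mono sum_inverse_powers_above \<alpha> y) auto
            also have "\<dots> = c * Y 0 \<omega>" using y by (simp add: c_def power2_eq_square)
            finally show ?thesis .
          qed
        qed (use \<alpha> in simp)
        then show "(\<Sum>k. ennreal (2 * (X k 0 \<omega>)\<^sup>2 / \<alpha> ^ k)) \<le> ennreal c * ennreal (Y 0 \<omega>)"
          using c nonneg by (simp add: ennreal_mult)
      qed
      also have "\<dots> < \<infinity>" using fin by (simp add: nn_integral_cmult ennreal_mult_less_top less_top)
      finally show "(\<Sum>k. \<integral>\<^sup>+\<omega>. ennreal (((\<Sum>i<n k. X k i \<omega> - e k) / \<alpha> ^ k)\<^sup>2) \<partial>M) \<noteq> \<infinity>" by simp
    qed auto
    then show ?thesis
    proof eventually_elim
      case (elim \<omega>)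
      from tendsto_real_sqrt[OF this] have "(\<lambda>k. \<bar>(\<Sum>i<n k. X k i \<omega> - e k) / \<alpha> ^ k\<bar>) \<longlonglongrightarrow> 0"
        by (simp del: abs_divide)
      then show ?case unfolding e_def by (rule tendsto_rabs_zero_cancel)
    qed
  qed
  have mean: "(\<lambda>k. expectation (X k 0)) \<longlonglongrightarrow> expectation (Y 0)"
  proof (rule integral_dominated_convergence[where w="Y 0"])
    have "(\<lambda>k. X k 0 \<omega>) \<longlonglongrightarrow> Y 0 \<omega>" for \<omega>
    proof (rule tendsto_eventually)
      have "\<forall>\<^sub>F k in sequentially. Y 0 \<omega> \<le> \<alpha> ^ k"
        using filterlim_at_top[THEN iffD1, OF power_at_top[OF \<alpha>]] by blast
      then show "\<forall>\<^sub>F k in sequentially. X k 0 \<omega> = Y 0 \<omega>" by eventually_elim (simp add: X_def)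
    qed
    then show "AE \<omega> in M. (\<lambda>k. X k 0 \<omega>) \<longlonglongrightarrow> Y 0 \<omega>" by simp
  qed (use int nonneg in \<open>auto simp: X_def\<close>)
  have ratio: "(\<lambda>k. real (n k) / \<alpha> ^ k) \<longlonglongrightarrow> 1"
  proof (rule tendsto_sandwich[where f="\<lambda>_. 1"])
    show "(\<lambda>k. 1 + (1 / \<alpha>) ^ k) \<longlonglongrightarrow> 1"
      using tendsto_add[OF tendsto_const LIMSEQ_realpow_zero[of "1 / \<alpha>"], of 1] \<alpha> by simp
    show "\<forall>\<^sub>F k in sequentially. real (n k) / \<alpha> ^ k \<le> 1 + (1 / \<alpha>) ^ k"
    proof (intro always_eventually allI)
      fix k show "real (n k) / \<alpha> ^ k \<le> 1 + (1 / \<alpha>) ^ k"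
        using divide_right_mono[OF n(3)[of k], of "\<alpha> ^ k"] \<alpha>k[of k] \<alpha> by (simp add: add_divide_distrib power_divide less_imp_le)
    qed
    show "\<forall>\<^sub>F k in sequentially. 1 \<le> real (n k) / \<alpha> ^ k"
      using n(2) \<alpha>k by (intro always_eventually allI) (simp add: le_divide_eq)
  qed auto
  from few fluct show ?thesis
  proof eventually_elim
    case (elim \<omega>)
    note lims = elim mean ratio
    have ev: "\<forall>\<^sub>F k in sequentially. (\<Sum>i<n k. X k i \<omega>) = (\<Sum>i<n k. Y i \<omega>)"
      using order_tendstoD(2)[OF elim(1), of 1, simplified]
    proof eventually_elim
      case (elim k)
      have "Y i \<omega> \<le> \<alpha> ^ k" if i: "i < n k" for i
      proof (rule ccontr)
        assume "\<not> Y i \<omega> \<le> \<alpha> ^ k"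
        then have "1 = I k i \<omega>" by (simp add: I_def)
        also have "\<dots> \<le> (\<Sum>i<n k. I k i \<omega>)"
          using i by (intro member_le_sum I_nonneg) auto
        finally show False using elim by simp
      qed
      then show ?case by (intro sum.cong) (auto simp: X_def)
    qed
    have "(\<lambda>k. (\<Sum>i<n k. X k i \<omega> - expectation (X k 0)) / \<alpha> ^ k + real (n k) / \<alpha> ^ k * expectation (X k 0))
       \<longlonglongrightarrow> 0 + 1 * expectation (Y 0)"
      by (intro tendsto_intros lims)
    moreover have "(\<Sum>i<n k. X k i \<omega> - expectation (X k 0)) / \<alpha> ^ k + real (n k) / \<alpha> ^ k * expectation (X k 0)
      = (\<Sum>i<n k. X k i \<omega>) / \<alpha> ^ k" for k by (simp add: sum_subtractf diff_divide_distrib)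
    ultimately have "(\<lambda>k. (\<Sum>i<n k. X k i \<omega>) / \<alpha> ^ k) \<longlonglongrightarrow> expectation (Y 0)" by simp
    then have "(\<lambda>k. (\<Sum>i<n k. Y i \<omega>) / \<alpha> ^ k) \<longlonglongrightarrow> expectation (Y 0)"
      by (rule Lim_transform_eventually) (use ev in eventually_elim, simp)
    then show ?case by (simp add: n_def)
  qed
qed

lemma (in prob_space) strong_law_nonneg:
  fixes Y :: "nat \<Rightarrow> 'a \<Rightarrow> real"
  assumes indep: "indep_vars (\<lambda>_. borel) Y UNIV"
    and ident: "\<And>k. distr M borel (Y k) = distr M borel (Y 0)"
    and int: "integrable M (Y 0)" and nonneg: "\<And>k \<omega>. 0 \<le> Y k \<omega>"
  shows "AE \<omega> in M. (\<lambda>K. (\<Sum>i<K. Y i \<omega>) / real K) \<longlonglongrightarrow> expectation (Y 0)"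
proof -
  \<comment> \<open>Countably many ratios that tend to 1, so that the union of their exceptional
    sets is still null.\<close>
  let ?\<alpha> = "\<lambda>j. 1 + 1 / real (Suc j)"
  have "AE \<omega> in M. \<forall>j. (\<lambda>k. (\<Sum>i<nat \<lceil>?\<alpha> j ^ k\<rceil>. Y i \<omega>) / ?\<alpha> j ^ k) \<longlonglongrightarrow> expectation (Y 0)"
    unfolding AE_all_countable by (intro allI strong_law_geometric assms) auto
  then show ?thesis
  proof eventually_elim
    case (elim \<omega>)
    define f where "f x = (\<Sum>i<nat \<lceil>x\<rceil>. Y i \<omega>)" for x :: real
    have "((\<lambda>x::real. f x / x) \<longlongrightarrow> expectation (Y 0)) at_top"
    proof (rule monotone_ratio_tendsto)
      show "mono f" unfolding f_def
      proof (intro monoI sum_mono2)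
        show "{..<nat \<lceil>x\<rceil>} \<subseteq> {..<nat \<lceil>z\<rceil>}" if "x \<le> z" for x z :: real
          using nat_mono[OF ceiling_mono[OF that]] by (simp only: lessThan_subset_iff)
      qed (simp_all add: nonneg)
      show "0 \<le> f x" for x unfolding f_def by (intro sum_nonneg nonneg)
      fix \<beta> :: real assume "1 < \<beta>"
      then obtain j where "inverse (real (Suc j)) < \<beta> - 1" using reals_Archimedean[of "\<beta> - 1"] by auto
      then have j: "?\<alpha> j \<le> \<beta>" by (simp add: inverse_eq_divide)
      have "filterlim (\<lambda>k. ?\<alpha> j ^ k) at_top sequentially"
        by (rule power_at_top) simp
      moreover have "?\<alpha> j ^ Suc k \<le> \<beta> * ?\<alpha> j ^ k" for k
        unfolding power_Suc using j by (intro mult_right_mono) auto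
      moreover have "(\<lambda>k. f (?\<alpha> j ^ k) / ?\<alpha> j ^ k) \<longlonglongrightarrow> expectation (Y 0)"
        unfolding f_def using elim by blast
      ultimately show "\<exists>t. filterlim t at_top sequentially \<and> (\<forall>\<^sub>F k in sequentially. t (Suc k) \<le> \<beta> * t k) \<and>
        (\<lambda>k. f (t k) / t k) \<longlonglongrightarrow> expectation (Y 0)"
        by (intro exI[of _ "\<lambda>k. ?\<alpha> j ^ k"] conjI always_eventually allI)
    qed
    from filterlim_compose[OF this filterlim_real_sequentially] show ?case by (simp add: f_def)
  qed
qed

lemma (in prob_space) indep_vars_reindex:
  assumes f: "inj_on f J" and indep: "indep_vars (\<lambda>_. L) X (f ` J)"
  shows "indep_vars (\<lambda>_. L) (\<lambda>j. X (f j)) J"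
  unfolding indep_vars_def2 indep_sets_def
proof (intro conjI ballI allI impI)
  note ind = indep[unfolded indep_vars_def2 indep_sets_def]
  let ?G = "\<lambda>i. {X i -` A \<inter> space M |A. A \<in> sets L}"
  show "random_variable L (X (f j))" if "j \<in> J" for j using ind that by auto
  show "?G (f j) \<subseteq> events" if "j \<in> J" for j using ind that by blast
  fix K A assume K: "K \<subseteq> J" "K \<noteq> {}" "finite K" and A: "A \<in> (\<Pi> j\<in>K. ?G (f j))"
  have inj: "inj_on f K" using f K(1) by (rule inj_on_subset)
  let ?A = "\<lambda>i. A (inv_into K f i)"
  have fK: "f ` K \<subseteq> f ` J" "f ` K \<noteq> {}" "finite (f ` K)" using K by auto
  have mem: "?A \<in> (\<Pi> i\<in>f ` K. ?G i)"
  proof (rule Pi_I)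
    fix i assume "i \<in> f ` K"
    then obtain j where j: "j \<in> K" "i = f j" by auto
    then show "?A i \<in> ?G i" using Pi_mem[OF A j(1)] by (simp only: inv_into_f_f[OF inj])
  qed
  have "\<forall>K\<subseteq>f ` J. K \<noteq> {} \<longrightarrow> finite K \<longrightarrow>
      (\<forall>A\<in>(\<Pi> i\<in>K. ?G i). prob (\<Inter>i\<in>K. A i) = (\<Prod>i\<in>K. prob (A i)))"
    by (rule conjunct2[OF conjunct2[OF ind]])
  from this[rule_format, OF fK mem] have "prob (\<Inter>i\<in>f ` K. ?A i) = (\<Prod>i\<in>f ` K. prob (?A i))" .
  then show "prob (\<Inter>j\<in>K. A j) = (\<Prod>j\<in>K. prob (A j))"
    by (simp add: prod.reindex[OF inj] inj)
qed

text \<open>Once \<open>e i < \<epsilon> * (1 - \<rho>)\<close>, the quantity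
  \<open>d i - \<epsilon>\<close> contracts by the factor \<open>\<rho>\<close> without any further
  error. Serves the lower bound on the area below the workload.\<close>

lemma contraction_tendsto_zero:
  fixes d e :: "nat \<Rightarrow> real"
  assumes rec: "\<forall>\<^sub>F i in sequentially. d (Suc i) \<le> \<rho> * d i + e i" and e: "e \<longlonglongrightarrow> 0"
    and d: "\<And>i. 0 \<le> d i" and \<rho>: "0 \<le> \<rho>" "\<rho> < 1"
  shows "d \<longlonglongrightarrow> 0"
proof (rule LIMSEQ_I)
  fix r :: real assume r: "0 < r"
  define \<epsilon> where "\<epsilon> = r / 3"
  have "\<forall>\<^sub>F i in sequentially. e i < \<epsilon> * (1 - \<rho>)"
    using r \<rho> by (intro order_tendstoD(2)[OF e]) (simp add: \<epsilon>_def)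
  with rec have "\<forall>\<^sub>F i in sequentially. d (Suc i) - \<epsilon> \<le> \<rho> * (d i - \<epsilon>)"
    by eventually_elim (simp add: algebra_simps)
  then obtain i0 where i0: "\<And>i. i0 \<le> i \<Longrightarrow> d (Suc i) - \<epsilon> \<le> \<rho> * (d i - \<epsilon>)"
    by (auto simp: eventually_sequentially)
  have le: "d (i0 + k) - \<epsilon> \<le> \<rho> ^ k * d i0" for k
  proof (induction k)
    case (Suc k)
    have "d (i0 + Suc k) - \<epsilon> \<le> \<rho> * (d (i0 + k) - \<epsilon>)" using i0[of "i0 + k"] by simp
    also have "\<dots> \<le> \<rho> * (\<rho> ^ k * d i0)" using Suc \<rho> by (intro mult_left_mono) auto
    finally show ?case by simp
  qed (use r in \<open>simp add: \<epsilon>_def\<close>)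
  have "(\<lambda>k. \<rho> ^ k * d i0) \<longlonglongrightarrow> 0 * d i0" using \<rho> by (intro tendsto_intros LIMSEQ_realpow_zero) auto
  then have "\<forall>\<^sub>F k in sequentially. \<rho> ^ k * d i0 < \<epsilon>"
    using r by (intro order_tendstoD(2)) (auto simp: \<epsilon>_def)
  then obtain k0 where k0: "\<And>k. k0 \<le> k \<Longrightarrow> \<rho> ^ k * d i0 < \<epsilon>" by (auto simp: eventually_sequentially)
  have "norm (d i - 0) < r" if "i0 + k0 \<le> i" for i
  proof -
    have "k0 \<le> i - i0" using that by linarith
    from k0[OF this] le[of "i - i0"] show ?thesis using that d[of i] r by (simp add: \<epsilon>_def)
  qed
  then show "\<exists>no. \<forall>n\<ge>no. norm (d n - 0) < r" by blast
qed

section \<open>Resampling a coordinate of a product measure\<close>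

lemma measurable_PiM_fun_upd [measurable]:
  assumes "i \<in> I"
  shows "(\<lambda>(z, r). z(i := r)) \<in> PiM I D \<Otimes>\<^sub>M D i \<rightarrow>\<^sub>M PiM I D"
  unfolding split_beta' by (rule measurable_fun_upd[where J=I]) (use assms in auto)

text \<open>By Fubini, with coordinate \<open>i\<close> split off: the new value overwrites the old
  one, whose integral then contributes the factor 1. This replaces conditioning on all other
  coordinates, while the integrand remains a function of a full path.\<close>

lemma nn_integral_PiM_resample:
  fixes D :: "'i \<Rightarrow> 'b measure"
  assumes D: "\<And>i. i \<in> I \<Longrightarrow> prob_space (D i)" and i: "i \<in> I"
    and F [measurable]: "F \<in> borel_measurable (PiM I D)"
  shows "(\<integral>\<^sup>+z. F z \<partial>PiM I D) = (\<integral>\<^sup>+z. \<integral>\<^sup>+r. F (z(i := r)) \<partial>D i \<partial>PiM I D)"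
proof -
  let ?J = "I - {i}"
  interpret Di: prob_space "D i" using D i by simp
  interpret R: prob_space "PiM ?J D" by (rule prob_space_PiM) (use D in auto)
  interpret pair_sigma_finite "D i" "PiM ?J D" ..
  have ins: "insert i ?J = I" using i by auto
  have [measurable]: "(\<lambda>(x, Z). Z(i := x)) \<in> D i \<Otimes>\<^sub>M PiM ?J D \<rightarrow>\<^sub>M PiM I D"
    unfolding split_beta' by (rule measurable_fun_upd[where J="?J"]) (use i in auto)
  have eq: "PiM I D = distr (D i \<Otimes>\<^sub>M PiM ?J D) (PiM I D) (\<lambda>(x, Z). Z(i := x))"
    using distr_pair_PiM_eq_PiM[of ?J D i] D i unfolding ins by auto
  have split: "(\<integral>\<^sup>+z. G z \<partial>PiM I D) = (\<integral>\<^sup>+Z. \<integral>\<^sup>+x. G (Z(i := x)) \<partial>D i \<partial>PiM ?J D)"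
    if [measurable]: "G \<in> borel_measurable (PiM I D)" for G :: "_ \<Rightarrow> ennreal"
    by (subst eq, subst nn_integral_distr) (auto simp: split_beta' nn_integral_snd[symmetric])
  have "(\<integral>\<^sup>+z. \<integral>\<^sup>+r. F (z(i := r)) \<partial>D i \<partial>PiM I D) =
      (\<integral>\<^sup>+Z. \<integral>\<^sup>+x. \<integral>\<^sup>+r. F ((Z(i := x))(i := r)) \<partial>D i \<partial>D i \<partial>PiM ?J D)"
    by (rule split) (use i in measurable)
  also have "\<dots> = (\<integral>\<^sup>+Z. \<integral>\<^sup>+r. F (Z(i := r)) \<partial>D i \<partial>PiM ?J D)"
    by (simp add: Di.emeasure_space_1)
  also have "\<dots> = (\<integral>\<^sup>+z. F z \<partial>PiM I D)" by (rule split[symmetric]) measurable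
  finally show ?thesis ..
qed

text \<open>Resampling as a measure preserving map. In this form integrability of a function passes
  to the product with \<open>D i\<close>, as is required before a Bochner integral can be
  iterated.\<close>

lemma distr_PiM_resample:
  fixes D :: "'i \<Rightarrow> 'b measure"
  assumes D: "\<And>i. i \<in> I \<Longrightarrow> prob_space (D i)" and i: "i \<in> I"
  shows "distr (PiM I D \<Otimes>\<^sub>M D i) (PiM I D) (\<lambda>(z, r). z(i := r)) = PiM I D"
proof (rule measure_eqI)
  fix A assume "A \<in> sets (distr (PiM I D \<Otimes>\<^sub>M D i) (PiM I D) (\<lambda>(z, r). z(i := r)))"
  then have A [measurable]: "A \<in> sets (PiM I D)" by simp
  interpret Di: prob_space "D i" using D i by simp
  have [measurable]: "(\<lambda>(z, r). z(i := r)) \<in> PiM I D \<Otimes>\<^sub>M D i \<rightarrow>\<^sub>M PiM I D"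
    by (rule measurable_PiM_fun_upd[OF i])
  have "emeasure (distr (PiM I D \<Otimes>\<^sub>M D i) (PiM I D) (\<lambda>(z, r). z(i := r))) A =
    (\<integral>\<^sup>+p. indicator A p \<partial>distr (PiM I D \<Otimes>\<^sub>M D i) (PiM I D) (\<lambda>(z, r). z(i := r)))" by simp
  also have "\<dots> = (\<integral>\<^sup>+p. indicator A ((fst p)(i := snd p)) \<partial>(PiM I D \<Otimes>\<^sub>M D i))"
    by (subst nn_integral_distr) (auto simp: split_beta')
  also have "\<dots> = (\<integral>\<^sup>+z. \<integral>\<^sup>+r. indicator A (z(i := r)) \<partial>D i \<partial>PiM I D)"
    by (subst Di.nn_integral_fst[symmetric]) (auto simp: split_beta')
  also have "\<dots> = (\<integral>\<^sup>+z. indicator A z \<partial>PiM I D)"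
    by (rule nn_integral_PiM_resample[symmetric, OF D i]) measurable
  finally show "emeasure (distr (PiM I D \<Otimes>\<^sub>M D i) (PiM I D) (\<lambda>(z, r). z(i := r))) A = emeasure (PiM I D) A"
    by simp
qed simp

lemma integral_PiM_resample:
  fixes F :: "('i \<Rightarrow> 'b) \<Rightarrow> real"
  assumes D: "\<And>i. i \<in> I \<Longrightarrow> prob_space (D i)" and i: "i \<in> I"
    and F: "integrable (PiM I D) F"
  shows "(\<integral>z. F z \<partial>PiM I D) = (\<integral>z. \<integral>r. F (z(i := r)) \<partial>D i \<partial>PiM I D)"
proof -
  interpret Di: prob_space "D i" using D i by simp
  interpret P: prob_space "PiM I D" by (rule prob_space_PiM[OF D])
  interpret pair_sigma_finite "PiM I D" "D i" ..
  have [measurable]: "(\<lambda>(z, r). z(i := r)) \<in> PiM I D \<Otimes>\<^sub>M D i \<rightarrow>\<^sub>M PiM I D"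
    by (rule measurable_PiM_fun_upd[OF i])
  have eq: "distr (PiM I D \<Otimes>\<^sub>M D i) (PiM I D) (\<lambda>(z, r). z(i := r)) = PiM I D"
    by (rule distr_PiM_resample[OF D i])
  have [measurable]: "F \<in> borel_measurable (PiM I D)" using F by simp
  have int: "integrable (PiM I D \<Otimes>\<^sub>M D i) (\<lambda>(z, r). F (z(i := r)))"
    using F eq integrable_distr[of "\<lambda>(z, r). z(i := r)" "PiM I D \<Otimes>\<^sub>M D i" "PiM I D" F]
    by (simp add: split_beta')
  have "(\<integral>z. F z \<partial>PiM I D) = (\<integral>z. F z \<partial>distr (PiM I D \<Otimes>\<^sub>M D i) (PiM I D) (\<lambda>(z, r). z(i := r)))"
    by (simp only: eq)
  also have "\<dots> = (\<integral>p. F ((fst p)(i := snd p)) \<partial>(PiM I D \<Otimes>\<^sub>M D i))"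
    by (subst integral_distr) (auto simp: split_beta')
  also have "\<dots> = (\<integral>z. \<integral>r. F (z(i := r)) \<partial>D i \<partial>PiM I D)"
    using integral_fst[OF int] by (simp add: split_beta')
  finally show ?thesis .
qed

section \<open>Exponential interarrival times: constant hazard rate and compensators\<close>

definition exponential_distr :: "real \<Rightarrow> real measure" where
  "exponential_distr l = density lborel (\<lambda>x. ennreal (exponential_density l x))"

lemma sets_exponential_distr [simp, measurable_cong]: "sets (exponential_distr l) = sets borel"
  by (simp add: exponential_distr_def)

lemma space_exponential_distr [simp]: "space (exponential_distr l) = UNIV"
  by (simp add: exponential_distr_def)

lemma prob_space_exponential_distr: "0 < l \<Longrightarrow> prob_space (exponential_distr l)"
  unfolding exponential_distr_def by (rule prob_space_exponential_density)

lemma AE_exponential_distr_pos: "AE r in exponential_distr l. 0 < r"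
proof -
  have "AE r in lborel. r \<noteq> (0::real)" by (rule AE_lborel_singleton)
  then show ?thesis unfolding exponential_distr_def
    by (subst AE_density) (auto simp: exponential_density_def elim!: eventually_mono)
qed

lemma AE_exponential_distr_neq: "AE r in exponential_distr l. r \<noteq> c"
proof -
  have "AE r in lborel. r \<noteq> (c::real)" by (rule AE_lborel_singleton)
  then show ?thesis unfolding exponential_distr_def
    by (subst AE_density) (auto elim!: eventually_mono)
qed

lemma borel_measurable_nn_integral_greaterThanAtMost [measurable (raw)]:
  fixes a b :: "'a \<Rightarrow> real" and f :: "'a \<Rightarrow> real \<Rightarrow> ennreal"
  assumes [measurable]: "a \<in> borel_measurable M" "b \<in> borel_measurable M"
    "(\<lambda>(x, u). f x u) \<in> borel_measurable (M \<Otimes>\<^sub>M borel)"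
  shows "(\<lambda>x. \<integral>\<^sup>+u. f x u * indicator {a x<..b x} u \<partial>lborel) \<in> borel_measurable M"
  unfolding indicator_def greaterThanAtMost_iff by measurable

text \<open>The hazard rate of the exponential distribution is constant, which is why Poisson arrivals see
  time averages.\<close>

lemma nn_integral_exponential_hazard:
  fixes f :: "real \<Rightarrow> ennreal"
  assumes l: "0 < l" and [measurable]: "f \<in> borel_measurable borel"
  shows "(\<integral>\<^sup>+r. f r \<partial>exponential_distr l) =
    ennreal l * (\<integral>\<^sup>+r. (\<integral>\<^sup>+u. f u * indicator {0<..r} u \<partial>lborel) \<partial>exponential_distr l)"
proof -
  let ?e = "\<lambda>r. ennreal (exponential_density l r)"
  \<comment> \<open>The survival function. Multiplied by \<open>l\<close> it is the density again,
    which closes the computation after Fubini.\<close>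
  have tail: "(\<integral>\<^sup>+r. ?e r * indicator {u..} r \<partial>lborel) = ennreal (exp (- l * u))" if "0 \<le> u" for u
  proof -
    have "(\<integral>\<^sup>+r. ?e r * indicator {u..} r \<partial>lborel) =
       (\<integral>\<^sup>+r. ennreal (l * exp (- r * l)) * indicator {u..} r \<partial>lborel)"
      using that by (intro nn_integral_cong) (auto simp: exponential_density_def indicator_def)
    also have "\<dots> = ennreal (0 - (- exp (- u * l)))"
    proof (rule nn_integral_FTC_atLeast)
      show "((\<lambda>a. - exp (- a * l)) has_real_derivative l * exp (- x * l)) (at x)" for x
        by (auto intro!: derivative_eq_intros)
      show "((\<lambda>a. - exp (- a * l)) \<longlongrightarrow> 0) at_top" using l by real_asymp
    qed (use l in auto)
    finally show ?thesis by (simp add: mult.commute)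
  qed
  have "ennreal l * (\<integral>\<^sup>+r. (\<integral>\<^sup>+u. f u * indicator {0<..r} u \<partial>lborel) \<partial>exponential_distr l) =
    ennreal l * (\<integral>\<^sup>+r. \<integral>\<^sup>+u. ?e r * (f u * indicator {0<..r} u) \<partial>lborel \<partial>lborel)"
    unfolding exponential_distr_def
    by (subst nn_integral_density) (measurable, simp add: nn_integral_cmult)
  also have "\<dots> = ennreal l * (\<integral>\<^sup>+u. \<integral>\<^sup>+r. ?e r * (f u * indicator {0<..r} u) \<partial>lborel \<partial>lborel)"
    unfolding indicator_def greaterThanAtMost_iff by (subst lborel_pair.Fubini') auto
  also have "\<dots> = ennreal l * (\<integral>\<^sup>+u. f u * indicator {0<..} u * ennreal (exp (- l * u)) \<partial>lborel)"
  proof (intro arg_cong2[where f="(*)"] refl nn_integral_cong)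
    fix u
    have "(\<integral>\<^sup>+r. ?e r * (f u * indicator {0<..r} u) \<partial>lborel) =
      (\<integral>\<^sup>+r. (f u * indicator {0<..} u) * (?e r * indicator {u..} r) \<partial>lborel)"
      by (intro nn_integral_cong) (auto simp: indicator_def mult_ac)
    also have "\<dots> = f u * indicator {0<..} u * (\<integral>\<^sup>+r. ?e r * indicator {u..} r \<partial>lborel)"
      by (subst nn_integral_cmult) auto
    also have "\<dots> = f u * indicator {0<..} u * ennreal (exp (- l * u))"
      using tail[of u] by (cases "0 < u") auto
    finally show "(\<integral>\<^sup>+r. ?e r * (f u * indicator {0<..r} u) \<partial>lborel) = f u * indicator {0<..} u * ennreal (exp (- l * u))" .
  qed
  also have "\<dots> = (\<integral>\<^sup>+u. ennreal l * (f u * indicator {0<..} u * ennreal (exp (- l * u))) \<partial>lborel)"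
    by (subst nn_integral_cmult) auto
  also have "\<dots> = (\<integral>\<^sup>+u. ?e u * f u \<partial>lborel)"
  proof (rule nn_integral_cong_AE)
    show "AE u in lborel. ennreal l * (f u * indicator {0<..} u * ennreal (exp (- l * u))) = ?e u * f u"
      using AE_lborel_singleton[of "0::real"]
      by eventually_elim (use l in \<open>auto simp: exponential_density_def indicator_def ennreal_mult mult_ac\<close>)
  qed
  also have "\<dots> = (\<integral>\<^sup>+r. f r \<partial>exponential_distr l)"
    unfolding exponential_distr_def by (subst nn_integral_density) auto
  finally show ?thesis ..
qed

lemma integrable_greaterThanAtMost_bounded:
  fixes f :: "real \<Rightarrow> real"
  assumes "f \<in> borel_measurable borel" "\<And>u. 0 \<le> f u" "\<And>u. f u \<le> m"
  shows "integrable lborel (\<lambda>u. f u * indicator {a<..b} u)"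
proof -
  have "emeasure lborel {a<..b} < \<infinity>" by (cases "a \<le> b") auto
  then show ?thesis
    using integrableI_bounded_set_indicator[where B=m, of "{a<..b}" lborel f] assms
    by (simp add: mult.commute)
qed

text \<open>\<open>H\<close> has slope at most \<open>l * m\<close>. Going back from
  \<open>r\<close> it therefore stays above the line of this slope through \<open>H r\<close>, and
  the area below \<open>H\<close> is at least that of a triangle of height \<open>H r\<close> and
  base \<open>H r / (l * m)\<close>, which is \<open>(H r)\<^sup>2 / (2 * (l * m))\<close>.\<close>

lemma compensator_square_le:
  fixes f :: "real \<Rightarrow> real"
  assumes [measurable]: "f \<in> borel_measurable borel" and f: "\<And>u. 0 \<le> f u" "\<And>u. f u \<le> m"
    and l: "0 \<le> l"
  defines "H \<equiv> \<lambda>r. l * (\<integral>u. f u * indicator {0<..r} u \<partial>lborel)"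
  shows "ennreal ((H r)\<^sup>2) \<le> ennreal (2 * (l * m)) * (\<integral>\<^sup>+u. ennreal (H u) * indicator {0<..r} u \<partial>lborel)"
proof -
  have int: "integrable lborel (\<lambda>u. f u * indicator {a<..b} u)" for a b
    by (rule integrable_greaterThanAtMost_bounded) (use f in auto)
  have m: "0 \<le> m" using f[of 0] by linarith
  have int_m: "integrable lborel (\<lambda>u. m * indicator {a<..b} u)" for a b :: real
    by (rule integrable_greaterThanAtMost_bounded[where f="\<lambda>_. m" and m=m]) (use m in auto)
  have H_diff: "H r - H u \<le> l * m * (r - u)" if "0 \<le> u" "u \<le> r" for u
  proof -
    have "H r - H u = l * (\<integral>v. f v * indicator {u<..r} v \<partial>lborel)"
      unfolding H_def right_diff_distrib[symmetric]
      by (subst Bochner_Integration.integral_diff[symmetric, OF int int])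
         (use that in \<open>auto intro!: arg_cong2[where f="(*)"] Bochner_Integration.integral_cong simp: indicator_def\<close>)
    also have "\<dots> \<le> l * (\<integral>v. m * indicator {u<..r} v \<partial>lborel)"
      by (intro mult_left_mono integral_mono int int_m l) (use f that in \<open>auto simp: indicator_def\<close>)
    also have "\<dots> = l * m * (r - u)" using that by simp
    finally show ?thesis .
  qed
  have H_nonneg: "0 \<le> H r" unfolding H_def using l f by (intro mult_nonneg_nonneg integral_nonneg) auto
  show ?thesis
  proof (cases "H r = 0")
    case False
    have r: "0 \<le> r"
    proof (rule ccontr)
      assume "\<not> 0 \<le> r"
      then have "H r = 0" by (simp add: H_def)
      then show False using False by simp
    qed
    have Hr: "0 < H r" using False H_nonneg by simp
    have "H 0 = 0" by (simp add: H_def)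
    then have Hr': "H r \<le> l * m * r" using H_diff[of 0] r by simp
    have pos: "0 < l * m * r" using Hr Hr' by linarith
    then have lm: "0 < l * m" using pos r by (auto simp: zero_less_mult_iff)
    define c where "c = H r / (l * m)"
    have c: "0 \<le> c" "c \<le> r" "l * m * c = H r" using Hr Hr' lm by (auto simp: c_def divide_le_eq mult.commute)
    have "(H r)\<^sup>2 = 2 * (l * m) * (l * m * c\<^sup>2 / 2)" unfolding c(3)[symmetric] by (simp add: power2_eq_square)
    then have "ennreal ((H r)\<^sup>2) = ennreal (2 * (l * m)) * ennreal (l * m * c\<^sup>2 / 2)"
      using lm by (simp only: ennreal_mult' [symmetric] mult_nonneg_nonneg zero_le_numeral less_imp_le)
    also have "ennreal (l * m * c\<^sup>2 / 2) = ennreal (l * m * (r - (r - c))\<^sup>2 / 2 - l * m * ((r - c) - (r - c))\<^sup>2 / 2)"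
      by simp
    also have "\<dots> = (\<integral>\<^sup>+u. ennreal (l * m * (u - (r - c))) * indicator {r - c..r} u \<partial>lborel)"
    proof (rule nn_integral_FTC_Icc[symmetric])
      show "((\<lambda>u. l * m * (u - (r - c))\<^sup>2 / 2) has_real_derivative l * m * (u - (r - c))) (at u)" for u
        by (auto intro!: derivative_eq_intros)
      show "0 \<le> l * m * (u - (r - c))" if "u \<in> {r - c..r}" for u
        using that l m by auto
    qed (use c in auto)
    also have "\<dots> \<le> (\<integral>\<^sup>+u. ennreal (H u) * indicator {0<..r} u \<partial>lborel)"
    proof (rule nn_integral_mono_AE)
      show "AE u in lborel. ennreal (l * m * (u - (r - c))) * indicator {r - c..r} u \<le> ennreal (H u) * indicator {0<..r} u"
        using AE_lborel_singleton[of 0]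
      proof eventually_elim
        case (elim u)
        have "l * m * (u - (r - c)) \<le> H u" if "r - c \<le> u" "u \<le> r"
          using H_diff[of u] that c by (simp add: algebra_simps)
        then show ?case using elim c by (auto simp: indicator_def intro!: ennreal_leI)
      qed
    qed
    finally show ?thesis by (simp add: mult_left_mono)
  qed simp
qed

text \<open>The hazard identity for \<open>f\<close> makes the mean of \<open>g\<close> vanish.
  Applied once more, to the compensator \<open>H\<close>, it turns
  \<open>compensator_square_le\<close> into a second moment of at most \<open>2 * m\<close> times
  the mean of \<open>f\<close>. With
  \<open>(f - H)\<^sup>2 \<le> 2 * f\<^sup>2 + 2 * H\<^sup>2\<close> the constant is
  \<open>6 = 2 + 2 * 2\<close>. The bound is proportional to the mean of \<open>f\<close> and not to
  \<open>m\<^sup>2\<close>; this keeps the sum over all packets linear in \<open>m\<close>.\<close>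

lemma exponential_compensated:
  fixes f :: "real \<Rightarrow> real"
  assumes l: "0 < l" and [measurable]: "f \<in> borel_measurable borel" and f: "\<And>u. 0 \<le> f u" "\<And>u. f u \<le> m"
  defines "g \<equiv> \<lambda>r. f r - l * (\<integral>u. f u * indicator {0<..r} u \<partial>lborel)"
  shows "integrable (exponential_distr l) g" "(\<integral>r. g r \<partial>exponential_distr l) = 0"
    "(\<integral>\<^sup>+r. ennreal ((g r)\<^sup>2) \<partial>exponential_distr l) \<le> ennreal (6 * m) * (\<integral>\<^sup>+r. ennreal (f r) \<partial>exponential_distr l)"
proof -
  let ?E = "exponential_distr l"
  interpret E: prob_space ?E by (rule prob_space_exponential_distr[OF l])
  define H where "H r = l * (\<integral>u. f u * indicator {0<..r} u \<partial>lborel)" for r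
  have g: "g r = f r - H r" for r by (simp add: g_def H_def)
  have int: "integrable lborel (\<lambda>u. f u * indicator {a<..b} u)" for a b
    by (rule integrable_greaterThanAtMost_bounded) (use f in auto)
  have m: "0 \<le> m" using f[of 0] by linarith
  have H_nonneg: "0 \<le> H r" for r unfolding H_def using l f by (intro mult_nonneg_nonneg integral_nonneg) auto
  have H_eq: "ennreal (H r) = ennreal l * (\<integral>\<^sup>+u. ennreal (f u) * indicator {0<..r} u \<partial>lborel)" for r
  proof -
    have "(\<integral>\<^sup>+u. ennreal (f u) * indicator {0<..r} u \<partial>lborel) = (\<integral>\<^sup>+u. ennreal (f u * indicator {0<..r} u) \<partial>lborel)"
      by (intro nn_integral_cong) (auto simp: indicator_def)
    also have "\<dots> = ennreal (\<integral>u. f u * indicator {0<..r} u \<partial>lborel)"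
      by (rule nn_integral_eq_integral[OF int]) (use f in auto)
    finally show ?thesis using l by (simp add: H_def ennreal_mult')
  qed
  have [measurable]: "H \<in> borel_measurable borel"
  proof -
    have "(\<lambda>r. enn2real (ennreal l * (\<integral>\<^sup>+u. ennreal (f u) * indicator {0<..r} u \<partial>lborel))) \<in> borel_measurable borel"
      by measurable
    moreover have "H = (\<lambda>r. enn2real (ennreal l * (\<integral>\<^sup>+u. ennreal (f u) * indicator {0<..r} u \<partial>lborel)))"
      unfolding H_eq[symmetric] using H_nonneg by (simp add: fun_eq_iff)
    ultimately show ?thesis by simp
  qed
  have fH: "(\<integral>\<^sup>+r. ennreal (f r) \<partial>?E) = (\<integral>\<^sup>+r. ennreal (H r) \<partial>?E)"
    unfolding H_eq by (subst nn_integral_exponential_hazard[OF l]) (auto simp: nn_integral_cmult)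
  have f_int: "integrable ?E f" by (rule E.integrable_const_bound[where B=m]) (use f in auto)
  then have fin: "(\<integral>\<^sup>+r. ennreal (f r) \<partial>?E) < \<infinity>" using f by (simp add: nn_integral_eq_integral)
  have H_int: "integrable ?E H"
    by (rule integrableI_nonneg) (use fin fH H_nonneg in auto)
  show "integrable ?E g" unfolding g[abs_def] using f_int H_int by simp
  have "ennreal (\<integral>r. f r \<partial>?E) = ennreal (\<integral>r. H r \<partial>?E)"
    using fH f H_nonneg f_int H_int by (simp add: nn_integral_eq_integral)
  then have "(\<integral>r. f r \<partial>?E) = (\<integral>r. H r \<partial>?E)"
    using f H_nonneg by (simp add: ennreal_inj integral_nonneg)
  then show "(\<integral>r. g r \<partial>?E) = 0" unfolding g[abs_def] using f_int H_int by simp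
  have H2: "(\<integral>\<^sup>+r. ennreal ((H r)\<^sup>2) \<partial>?E) \<le> ennreal (2 * m) * (\<integral>\<^sup>+r. ennreal (f r) \<partial>?E)"
  proof -
    have "(\<integral>\<^sup>+r. ennreal ((H r)\<^sup>2) \<partial>?E) \<le>
      (\<integral>\<^sup>+r. ennreal (2 * (l * m)) * (\<integral>\<^sup>+u. ennreal (H u) * indicator {0<..r} u \<partial>lborel) \<partial>?E)"
      unfolding H_def by (intro nn_integral_mono compensator_square_le) (use f l in auto)
    also have "\<dots> = ennreal (2 * m) * (ennreal l * (\<integral>\<^sup>+r. (\<integral>\<^sup>+u. ennreal (H u) * indicator {0<..r} u \<partial>lborel) \<partial>?E))"
      using l m by (simp add: nn_integral_cmult ennreal_mult mult_ac)
    also have "\<dots> = ennreal (2 * m) * (\<integral>\<^sup>+r. ennreal (H r) \<partial>?E)"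
      by (subst nn_integral_exponential_hazard[OF l, symmetric]) auto
    finally show ?thesis using fH by simp
  qed
  have sq: "(g r)\<^sup>2 \<le> 2 * m * f r + 2 * (H r)\<^sup>2" for r
  proof -
    have "0 \<le> (f r + H r)\<^sup>2" by simp
    then have "(g r)\<^sup>2 \<le> 2 * (f r)\<^sup>2 + 2 * (H r)\<^sup>2" by (simp add: g power2_eq_square algebra_simps)
    also have "(f r)\<^sup>2 \<le> m * f r" using f by (simp add: power2_eq_square mult_right_mono)
    finally show ?thesis by simp
  qed
  have "(\<integral>\<^sup>+r. ennreal ((g r)\<^sup>2) \<partial>?E) \<le> (\<integral>\<^sup>+r. ennreal (2 * m) * ennreal (f r) + ennreal 2 * ennreal ((H r)\<^sup>2) \<partial>?E)"
    by (intro nn_integral_mono)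
       (use sq f m in \<open>simp add: ennreal_mult[symmetric] ennreal_plus[symmetric] ennreal_leI del: ennreal_plus ennreal_numeral\<close>)
  also have "\<dots> = ennreal (2 * m) * (\<integral>\<^sup>+r. ennreal (f r) \<partial>?E) + ennreal 2 * (\<integral>\<^sup>+r. ennreal ((H r)\<^sup>2) \<partial>?E)"
    by (simp add: nn_integral_add nn_integral_cmult)
  also have "\<dots> \<le> ennreal (2 * m) * (\<integral>\<^sup>+r. ennreal (f r) \<partial>?E) + ennreal 2 * (ennreal (2 * m) * (\<integral>\<^sup>+r. ennreal (f r) \<partial>?E))"
    by (intro add_left_mono mult_left_mono H2) auto
  also have "\<dots> = ennreal (6 * m) * (\<integral>\<^sup>+r. ennreal (f r) \<partial>?E)"
  proof -
    have "ennreal (6 * m) = ennreal (2 * m) + ennreal 2 * ennreal (2 * m)"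
      using m by (simp add: ennreal_mult[symmetric] ennreal_plus[symmetric] del: ennreal_plus ennreal_numeral)
    then show ?thesis by (simp add: distrib_right mult.assoc)
  qed
  finally show "(\<integral>\<^sup>+r. ennreal ((g r)\<^sup>2) \<partial>?E) \<le> ennreal (6 * m) * (\<integral>\<^sup>+r. ennreal (f r) \<partial>?E)" .
qed

lemma exponential_moments:
  assumes "prob_space M" and D: "distributed M lborel X (exponential_density l)" and l: "0 < l"
  shows "integrable M X" "(\<integral>\<omega>. X \<omega> \<partial>M) = 1 / l"
    "integrable M (\<lambda>\<omega>. (X \<omega> - 1 / l)\<^sup>2)" "(\<integral>\<omega>. (X \<omega> - 1 / l)\<^sup>2 \<partial>M) = 1 / l\<^sup>2"
proof -
  interpret prob_space M by fact
  have X [measurable]: "X \<in> borel_measurable M" using D by (auto dest: distributed_measurable)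
  show "integrable M X" using erlang_ith_moment_integrable[OF l D, of 1] by simp
  then have int: "integrable M X" .
  have int2: "integrable M (\<lambda>\<omega>. (X \<omega>)\<^sup>2)" using erlang_ith_moment_integrable[OF l D, of 2] by simp
  show E: "(\<integral>\<omega>. X \<omega> \<partial>M) = 1 / l" by (rule exponential_distributed_expectation[OF l D])
  have eq: "(\<lambda>\<omega>. (X \<omega> - 1 / l)\<^sup>2) = (\<lambda>\<omega>. (X \<omega>)\<^sup>2 + (1 / l)\<^sup>2 - 2 * (1 / l) * X \<omega>)"
    by (simp add: power2_eq_square algebra_simps fun_eq_iff)
  show "integrable M (\<lambda>\<omega>. (X \<omega> - 1 / l)\<^sup>2)" unfolding eq using int int2 by simp
  show "(\<integral>\<omega>. (X \<omega> - 1 / l)\<^sup>2 \<partial>M) = 1 / l\<^sup>2"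
    using exponential_distributed_variance[OF l D] by (simp add: E)
qed

section \<open>The queue on the space of interarrival and service times\<close>

text \<open>A path lists the interarrival times as \<open>Inl (n, k)\<close> and the service times as \<open>Inr (n, k)\<close>.\<close>

type_synonym mg1_path = "(nat \<times> nat) + (nat \<times> nat) \<Rightarrow> real"

definition arrival :: "mg1_path \<Rightarrow> nat \<times> nat \<Rightarrow> real" where
  "arrival z = (\<lambda>(n, k). \<Sum>i\<le>k. z (Inl (n, i)))"

definition prev_arrival :: "mg1_path \<Rightarrow> nat \<times> nat \<Rightarrow> real" where
  "prev_arrival z = (\<lambda>(n, k). \<Sum>i<k. z (Inl (n, i)))"

definition load :: "nat \<Rightarrow> mg1_path \<Rightarrow> real \<Rightarrow> real" where
  "load N z = workload N (arrival z) (z \<circ> Inr)"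

lemma load_nonneg [simp]: "0 \<le> load N z u"
  by (simp add: load_def)

lemma arrival_eq: "arrival z p = prev_arrival z p + z (Inl p)"
  by (cases p) (simp add: arrival_def prev_arrival_def lessThan_Suc_atMost[symmetric])

lemma prev_arrival_upd [simp]:
  "prev_arrival (z(Inl p := r)) p = prev_arrival z p" "prev_arrival (z(Inr q := r)) p = prev_arrival z p"
  by (cases p; auto simp: prev_arrival_def intro!: sum.cong)+

lemma arrival_upd [simp]:
  "arrival (z(Inl p := r)) p = prev_arrival z p + r" "arrival (z(Inr q := r)) p = arrival z p"
  by (auto simp: arrival_eq)

lemma arrival_upd_other:
  assumes "fst q = fst p \<Longrightarrow> snd q < snd p"
  shows "arrival (z(Inl p := r)) q = arrival z q"
  using assms by (auto simp: arrival_def split_beta intro!: sum.cong)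

lemma prev_arrival_le:
  assumes "\<And>i. 0 \<le> z (Inl (n, i))" "l \<le> k"
  shows "prev_arrival z (n, l) \<le> prev_arrival z (n, k)"
  unfolding prev_arrival_def using assms by (auto intro!: sum_mono2)

lemma load_upd_service:
  assumes "u \<le> arrival z p"
  shows "load N (z(Inr p := r)) u = load N z u"
  unfolding load_def using assms by (intro workload_cong) auto

text \<open>A change of the interarrival time of \<open>p\<close> shifts \<open>p\<close> and all
  later packets of its class. Nonnegative interarrival times keep those behind \<open>p\<close>, so
  with either value they arrive at \<open>u\<close> or later and do not influence the workload at
  \<open>u\<close>.\<close>

lemma load_upd_arrival:
  assumes z: "\<And>i. 0 \<le> z (Inl (fst p, i))" and r: "0 \<le> r"
    and u: "u \<le> prev_arrival z p + z (Inl p)" "u \<le> prev_arrival z p + r"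
  shows "load N (z(Inl p := r)) u = load N z u"
proof -
  let ?z = "z(Inl p := r)"
  have late: "\<not> arrival w q < u"
    if w: "\<And>i. 0 \<le> w (Inl (fst p, i))" "prev_arrival w p = prev_arrival z p" "u \<le> prev_arrival z p + w (Inl p)"
      and q: "fst q = fst p" "\<not> snd q < snd p" for w q
  proof -
    have "arrival w p \<le> arrival w q"
      using prev_arrival_le[of w "fst p" "Suc (snd p)" "Suc (snd q)"] q w(1)
      by (simp add: arrival_def prev_arrival_def split_beta lessThan_Suc_atMost)
    then show ?thesis using w by (simp add: arrival_eq[of w p])
  qed
  have late2: "\<not> arrival ?z q < u \<and> \<not> arrival z q < u" if q: "fst q = fst p" "\<not> snd q < snd p" for q
    using late[OF _ _ _ q, of ?z] late[OF _ _ _ q, of z] z r u by auto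
  show ?thesis
    unfolding load_def
  proof (rule workload_cong)
    fix q
    show "arrival ?z q < u \<longleftrightarrow> arrival z q < u"
      using late2[of q] arrival_upd_other[of q p z r] by (cases "fst q = fst p \<and> \<not> snd q < snd p") auto
    show "arrival ?z q < u \<Longrightarrow> arrival ?z q = arrival z q \<and> (?z \<circ> Inr) q = (z \<circ> Inr) q"
      using late2[of q] arrival_upd_other[of q p z r] by (cases "fst q = fst p \<and> \<not> snd q < snd p") auto
  qed
qed

text \<open>Workload seen by packet \<open>p\<close> if it arrives \<open>r\<close> after the previous packet of its class.\<close>

definition probe_load :: "nat \<Rightarrow> nat \<times> nat \<Rightarrow> mg1_path \<Rightarrow> real \<Rightarrow> real" where
  "probe_load N p z r = load N (z(Inl p := r)) (prev_arrival z p + r)"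

lemma probe_load_nonneg [simp]: "0 \<le> probe_load N p z r"
  by (simp add: probe_load_def)

lemma probe_load_upd [simp]: "probe_load N p (z(Inl p := r')) r = probe_load N p z r"
  by (simp add: probe_load_def)

lemma load_arrival: "load N z (arrival z p) = probe_load N p z (z (Inl p))"
  by (simp add: probe_load_def arrival_eq)

text \<open>Before \<open>p\<close> arrives it has no influence, so a hypothetical earlier arrival
  would see the actual workload. This turns the compensator of packet \<open>p\<close> into the area
  below the workload between two arrivals of its class.\<close>

lemma load_eq_probe_load:
  assumes "\<And>i. 0 \<le> z (Inl (fst p, i))" "0 \<le> r" "r \<le> z (Inl p)"
  shows "load N z (prev_arrival z p + r) = probe_load N p z r"
  unfolding probe_load_def by (rule load_upd_arrival[symmetric]) (use assms in auto)

text \<open>The queue on its canonical product space, where single coordinates can be resampled.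
  Almost sure statements are carried over to the given probability space in
  \<open>AE_mg1_sample\<close>.\<close>

locale mg1_model =
  fixes N :: nat and lam x y :: "nat \<Rightarrow> real" and F :: "nat \<Rightarrow> real measure"
  assumes classes: "1 \<le> N"
    and rate_pos: "\<And>n. n \<in> {1..N} \<Longrightarrow> 0 < lam n"
    and service_prob: "\<And>n. n \<in> {1..N} \<Longrightarrow> prob_space (F n)"
    and service_sets: "\<And>n. n \<in> {1..N} \<Longrightarrow> sets (F n) = sets borel"
    and service_pos: "\<And>n. n \<in> {1..N} \<Longrightarrow> AE r in F n. 0 < r"
    and service_mean: "\<And>n. n \<in> {1..N} \<Longrightarrow> has_bochner_integral (F n) (\<lambda>r. r) (x n)"
    and service_second_moment: "\<And>n. n \<in> {1..N} \<Longrightarrow> has_bochner_integral (F n) (\<lambda>r. r\<^sup>2) (y n)"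
    and stable: "(\<Sum>j=1..N. lam j * x j) < 1"
begin

definition D :: "(nat \<times> nat) + (nat \<times> nat) \<Rightarrow> real measure" where
  "D = case_sum (\<lambda>p. exponential_distr (lam (fst p))) (\<lambda>p. F (fst p))"

abbreviation "I \<equiv> packets N <+> packets N"

definition P :: "mg1_path measure" where "P = PiM I D"

lemma D_simps [simp]: "D (Inl p) = exponential_distr (lam (fst p))" "D (Inr p) = F (fst p)"
  by (simp_all add: D_def)

lemma packets_class: "p \<in> packets N \<Longrightarrow> fst p \<in> {1..N}"
  by (auto simp: packets_def)

lemma same_class: "p \<in> packets N \<Longrightarrow> (fst p, i) \<in> packets N"
  by (auto simp: packets_def)

lemma sets_D: "i \<in> I \<Longrightarrow> sets (D i) = sets borel"
  using service_sets packets_class by auto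

lemma prob_space_D: "i \<in> I \<Longrightarrow> prob_space (D i)"
  using service_prob[OF packets_class] prob_space_exponential_distr[OF rate_pos[OF packets_class]]
  by (cases i) (auto simp del: atLeastAtMost_iff)

sublocale P: prob_space P
  unfolding P_def by (rule prob_space_PiM[OF prob_space_D])

lemma sets_P [measurable_cong]: "sets P = sets (PiM I (\<lambda>_. borel))"
  unfolding P_def by (intro sets_PiM_cong sets_D refl)

lemma coordinate_measurable [measurable]: "i \<in> I \<Longrightarrow> (\<lambda>z. z i) \<in> borel_measurable P"
  unfolding measurable_cong_sets[OF sets_P refl] by (rule measurable_component_singleton)

lemma upd_measurable [measurable (raw)]:
  assumes "i \<in> I" "f \<in> M \<rightarrow>\<^sub>M P" "g \<in> borel_measurable M"
  shows "(\<lambda>w. (f w)(i := g w)) \<in> M \<rightarrow>\<^sub>M P"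
proof -
  have "(\<lambda>w. (f w)(i := g w)) \<in> M \<rightarrow>\<^sub>M PiM I (\<lambda>_. borel)"
    by (rule measurable_fun_upd[where J=I]) (use assms measurable_cong_sets[OF refl sets_P, of M] in auto)
  then show ?thesis using measurable_cong_sets[OF refl sets_P, of M] by simp
qed

lemma measurable_coordinate_comp:
  assumes "i \<in> I" "f \<in> M \<rightarrow>\<^sub>M P"
  shows "(\<lambda>w. f w i) \<in> borel_measurable M"
  using measurable_compose[OF assms(2) coordinate_measurable[OF assms(1)]] .

lemma prev_arrival_measurable [measurable (raw)]:
  assumes "p \<in> packets N" "f \<in> M \<rightarrow>\<^sub>M P"
  shows "(\<lambda>w. prev_arrival (f w) p) \<in> borel_measurable M"
  unfolding prev_arrival_def split_beta
  by (intro borel_measurable_sum measurable_coordinate_comp) (use assms in \<open>auto intro: same_class\<close>)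

lemma arrival_measurable [measurable (raw)]:
  assumes "p \<in> packets N" "f \<in> M \<rightarrow>\<^sub>M P"
  shows "(\<lambda>w. arrival (f w) p) \<in> borel_measurable M"
  unfolding arrival_def split_beta
  by (intro borel_measurable_sum measurable_coordinate_comp) (use assms in \<open>auto intro: same_class\<close>)

lemma load_measurable [measurable (raw)]:
  assumes f: "f \<in> M \<rightarrow>\<^sub>M P" and [measurable]: "g \<in> borel_measurable M"
  shows "(\<lambda>w. load N (f w) (g w)) \<in> borel_measurable M"
proof -
  have jk: "(j, k) \<in> packets N" if "j \<in> {1..N}" for j k using that by (auto simp: packets_def)
  have summand: "(\<lambda>w. if arrival (f w) p < g w then
     (\<Sum>j=1..N. \<Sum>k. if arrival (f w) p \<le> arrival (f w) (j, k) \<and> arrival (f w) (j, k) < g w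
        then ennreal ((f w \<circ> Inr) (j, k)) else 0) - ennreal (g w - arrival (f w) p) else 0) \<in> borel_measurable M"
    if p: "p \<in> packets N" for p
  proof -
    note [measurable] = arrival_measurable[OF p f]
    have "(\<lambda>w. \<Sum>j=1..N. \<Sum>k. if arrival (f w) p \<le> arrival (f w) (j, k) \<and> arrival (f w) (j, k) < g w
        then ennreal ((f w \<circ> Inr) (j, k)) else 0) \<in> borel_measurable M"
    proof (intro borel_measurable_sum borel_measurable_suminf_order)
      fix j k assume "j \<in> {1..N}"
      note [measurable] = arrival_measurable[OF jk[OF this, of k] f]
      have [measurable]: "(\<lambda>w. f w (Inr (j, k))) \<in> borel_measurable M"
        by (rule measurable_coordinate_comp[OF _ f]) (use jk[OF \<open>j \<in> {1..N}\<close>] in auto)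
      show "(\<lambda>w. if arrival (f w) p \<le> arrival (f w) (j, k) \<and> arrival (f w) (j, k) < g w
        then ennreal ((f w \<circ> Inr) (j, k)) else 0) \<in> borel_measurable M"
        unfolding comp_def by measurable
    qed
    then show ?thesis by measurable
  qed
  show ?thesis
    unfolding load_def workload_def
    by (rule borel_measurable_enn2real[OF borel_measurable_SUP[OF _ summand]]) auto
qed

lemma probe_load_measurable [measurable (raw)]:
  assumes "p \<in> packets N" "f \<in> M \<rightarrow>\<^sub>M P" "g \<in> borel_measurable M"
  shows "(\<lambda>w. probe_load N p (f w) (g w)) \<in> borel_measurable M"
  unfolding probe_load_def
  by (intro load_measurable upd_measurable prev_arrival_measurable borel_measurable_add assms)
     (use assms in auto)

lemma nn_integral_resample:
  assumes "i \<in> I" "f \<in> borel_measurable P"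
  shows "(\<integral>\<^sup>+z. f z \<partial>P) = (\<integral>\<^sup>+z. \<integral>\<^sup>+r. f (z(i := r)) \<partial>D i \<partial>P)"
  using assms unfolding P_def by (intro nn_integral_PiM_resample prob_space_D)

lemma integral_resample:
  fixes f :: "mg1_path \<Rightarrow> real"
  assumes "i \<in> I" "integrable P f"
  shows "(\<integral>z. f z \<partial>P) = (\<integral>z. \<integral>r. f (z(i := r)) \<partial>D i \<partial>P)"
  using assms unfolding P_def by (intro integral_PiM_resample prob_space_D)

lemma AE_D_pos:
  assumes "i \<in> I" shows "AE r in D i. 0 < r"
proof (cases i)
  case (Inl p)
  then show ?thesis unfolding Inl D_simps by (intro AE_exponential_distr_pos)
next
  case (Inr p)
  then have "p \<in> packets N" using assms by auto
  then show ?thesis unfolding Inr D_simps by (intro service_pos packets_class)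
qed

lemma AE_pos: "AE z in P. \<forall>i\<in>I. 0 < z i"
proof -
  have "AE z in P. 0 < z i" if "i \<in> I" for i
    unfolding P_def using that by (intro AE_PiM_component prob_space_D AE_D_pos)
  then show ?thesis by (simp add: AE_ball_countable)
qed

end

section \<open>Poisson arrivals see time averages\<close>

lemma has_real_derivative_half_square_pos_part:
  "((\<lambda>x::real. (max 0 x)\<^sup>2 / 2) has_real_derivative max 0 x) (at x)"
proof -
  consider "x < 0" | "x = 0" | "0 < x" by linarith
  then show ?thesis
  proof cases
    case 1
    have "((\<lambda>_::real. 0) has_real_derivative 0) (at x)" by simp
    then have "((\<lambda>x::real. (max 0 x)\<^sup>2 / 2) has_real_derivative 0) (at x)"
      by (rule has_field_derivative_transform_within_open[of _ _ _ "{..<0}"]) (use 1 in auto)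
    then show ?thesis using 1 by simp
  next
    case 2
    have "((\<lambda>h::real. (max 0 h)\<^sup>2 / 2 / h) \<longlongrightarrow> 0) (at 0)"
    proof (rule Lim_null_comparison)
      show "((\<lambda>h::real. \<bar>h\<bar>) \<longlongrightarrow> 0) (at 0)" by (intro tendsto_rabs_zero tendsto_ident_at)
      show "\<forall>\<^sub>F h in at 0. norm ((max 0 h)\<^sup>2 / 2 / h) \<le> \<bar>h :: real\<bar>"
        by (intro always_eventually allI) (auto simp: max_def power2_eq_square)
    qed
    then show ?thesis using 2 by (simp add: has_field_derivative_iff)
  next
    case 3
    have "((\<lambda>x::real. x\<^sup>2 / 2) has_real_derivative x) (at x)"
      by (auto intro!: derivative_eq_intros)
    then have "((\<lambda>x::real. (max 0 x)\<^sup>2 / 2) has_real_derivative x) (at x)"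
      by (rule has_field_derivative_transform_within_open[of _ _ _ "{0<..}"]) (use 3 in auto)
    then show ?thesis using 3 by simp
  qed
qed

context fcfs_path begin

lemma workload_area:
  assumes "0 \<le> t"
  shows "(W has_integral
    (\<Sum>q | q \<in> packets N \<and> a q < t. W (a q) * s q + (s q)\<^sup>2 / 2) - (W t)\<^sup>2 / 2) {0..t}"
proof -
  have E: "((\<lambda>u. max 0 (W u)) has_integral
    (\<Sum>q | q \<in> packets N \<and> a q < t. (max 0 (W (a q) + s q))\<^sup>2 / 2 - (max 0 (W (a q)))\<^sup>2 / 2)
      - (max 0 (W t))\<^sup>2 / 2) {0..t}"
    by (rule energy_identity[OF has_real_derivative_half_square_pos_part]) (use assms in auto)
  have max_W: "max 0 (W u) = W u" for u by simp
  have eq: "(\<Sum>q | q \<in> packets N \<and> a q < t. (max 0 (W (a q) + s q))\<^sup>2 / 2 - (max 0 (W (a q)))\<^sup>2 / 2) =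
    (\<Sum>q | q \<in> packets N \<and> a q < t. W (a q) * s q + (s q)\<^sup>2 / 2)"
    by (intro sum.cong refl) (use service_pos in \<open>auto simp: less_imp_le power2_eq_square field_simps\<close>)
  show ?thesis using E unfolding eq unfolding max_W .
qed

text \<open>\<open>energy_identity\<close> for \<open>g = min w m\<close> on nonnegative
  \<open>w\<close>; its primitive \<open>G\<close> is quadratic up to \<open>m\<close> and linear
  beyond. Since \<open>g\<close> grows with slope at most 1, a jump of \<open>G\<close> from
  \<open>w\<close> to \<open>w + v\<close> is at most \<open>v * g w + v\<^sup>2 / 2\<close>. The
  boundary term is dropped because \<open>G\<close> is nonnegative.\<close>

lemma capped_workload_area_le:
  assumes t: "0 \<le> t" and m: "0 \<le> m"
  shows "(\<integral>\<^sup>+u. ennreal (min (W u) m) * indicator {0..t} u \<partial>lborel) \<le>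
    (\<Sum>q | q \<in> packets N \<and> a q < t. ennreal (s q * min (W (a q)) m + (s q)\<^sup>2 / 2))"
proof -
  define g where "g x = max 0 x - max 0 (x - m)" for x :: real
  define G where "G x = (max 0 x)\<^sup>2 / 2 - (max 0 (x - m))\<^sup>2 / 2" for x :: real
  have dG: "(G has_real_derivative g x) (at x)" for x
  proof -
    have "((\<lambda>x. x - m) has_real_derivative 1) (at x)" by (auto intro!: derivative_eq_intros)
    from DERIV_chain2[OF has_real_derivative_half_square_pos_part this] show ?thesis
      unfolding G_def[abs_def] g_def
      by (intro DERIV_diff has_real_derivative_half_square_pos_part) simp
  qed
  have g: "g w = min w m" if "0 \<le> w" for w using that by (auto simp: g_def)
  have G_le: "G (w + v) - G w \<le> v * min w m + v\<^sup>2 / 2" if "0 \<le> w" "0 < v" for w v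
  proof -
    consider "m \<le> w" | "w + v \<le> m" | "w < m" "m < w + v" by linarith
    then show ?thesis
    proof cases
      case 1
      then show ?thesis using that m by (simp add: G_def power2_eq_square field_simps)
    next
      case 2
      then show ?thesis using that m by (simp add: G_def power2_eq_square field_simps)
    next
      case 3
      then have "G (w + v) - G w = v * w + v\<^sup>2 / 2 - (w + v - m)\<^sup>2 / 2"
        using that m by (simp add: G_def power2_eq_square field_simps)
      then show ?thesis using 3 by simp
    qed
  qed
  have G_nonneg: "0 \<le> G w" for w
    unfolding G_def using m by (auto simp: max_def intro!: power_mono)
  have "((\<lambda>u. g (W u)) has_integral
    (\<Sum>q | q \<in> packets N \<and> a q < t. G (W (a q) + s q) - G (W (a q))) - G (W t)) {0..t}"
    by (rule energy_identity[OF dG _ _ t]) (use m in \<open>auto simp: g_def G_def\<close>)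
  then have "((\<lambda>u. min (W u) m) has_integral
    (\<Sum>q | q \<in> packets N \<and> a q < t. G (W (a q) + s q) - G (W (a q))) - G (W t)) {0..t}"
    by (simp add: g)
  then have "(\<integral>\<^sup>+u. ennreal (min (W u) m) * indicator {0..t} u \<partial>lborel) =
    ennreal ((\<Sum>q | q \<in> packets N \<and> a q < t. G (W (a q) + s q) - G (W (a q))) - G (W t))"
    by (intro nn_integral_has_integral_lebesgue') (use m in auto)
  also have "\<dots> \<le> ennreal (\<Sum>q | q \<in> packets N \<and> a q < t. s q * min (W (a q)) m + (s q)\<^sup>2 / 2)"
  proof (rule ennreal_leI)
    have "(\<Sum>q | q \<in> packets N \<and> a q < t. G (W (a q) + s q) - G (W (a q))) \<le>
      (\<Sum>q | q \<in> packets N \<and> a q < t. s q * min (W (a q)) m + (s q)\<^sup>2 / 2)"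
      by (intro sum_mono G_le) (use service_pos in auto)
    then show "(\<Sum>q | q \<in> packets N \<and> a q < t. G (W (a q) + s q) - G (W (a q))) - G (W t) \<le>
      (\<Sum>q | q \<in> packets N \<and> a q < t. s q * min (W (a q)) m + (s q)\<^sup>2 / 2)"
      using G_nonneg[of "W t"] by linarith
  qed
  also have "\<dots> = (\<Sum>q | q \<in> packets N \<and> a q < t. ennreal (s q * min (W (a q)) m + (s q)\<^sup>2 / 2))"
    by (rule sum_ennreal[symmetric]) (use service_pos m in \<open>auto intro!: add_nonneg_nonneg mult_nonneg_nonneg simp: less_imp_le\<close>)
  finally show ?thesis .
qed

end

lemma sum_indicator_interarrival:
  assumes "\<And>i. 0 \<le> z (Inl (n, i))"
  shows "(\<Sum>k<K. indicator {prev_arrival z (n, k)<..arrival z (n, k)} u) =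
    (indicator {0<..prev_arrival z (n, K)} u :: 'b :: semiring_1)"
proof (induction K)
  case 0
  then show ?case by (simp add: prev_arrival_def)
next
  case (Suc K)
  have "0 \<le> prev_arrival z (n, K)" "prev_arrival z (n, K) \<le> arrival z (n, K)"
    "prev_arrival z (n, Suc K) = arrival z (n, K)"
    using assms by (auto simp: prev_arrival_def arrival_def lessThan_Suc_atMost intro!: sum_nonneg sum_mono2)
  then show ?case unfolding sum.lessThan_Suc Suc by (auto simp: indicator_def)
qed

context mg1_model begin

text \<open>Given all other coordinates, the workload that packet \<open>p\<close> would see if it arrived at time \<open>u\<close>
  is a fixed function of \<open>u\<close>, to which the hazard identity applies.\<close>

lemma pasta:
  fixes \<phi> :: "real \<Rightarrow> ennreal"
  assumes p: "p \<in> packets N" and [measurable]: "\<phi> \<in> borel_measurable borel"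
  shows "(\<integral>\<^sup>+z. \<phi> (load N z (arrival z p)) * indicator {..<t} (arrival z p) \<partial>P) =
    ennreal (lam (fst p)) * (\<integral>\<^sup>+z. \<integral>\<^sup>+u. \<phi> (load N z u) * indicator {..<t} u *
      indicator {prev_arrival z p<..arrival z p} u \<partial>lborel \<partial>P)"
proof -
  let ?i = "Inl p :: (nat \<times> nat) + (nat \<times> nat)"
  let ?l = "lam (fst p)"
  have i [measurable]: "?i \<in> I" using p by auto
  have l: "0 < ?l" using rate_pos[OF packets_class[OF p]] .
  note [measurable] = p
  define f where "f z r = \<phi> (probe_load N p z r) * indicator {..<t} (prev_arrival z p + r)" for z r
  have f_meas [measurable (raw)]: "(\<lambda>w. f (h w) (g w)) \<in> borel_measurable M"
    if [measurable]: "h \<in> M \<rightarrow>\<^sub>M P" "g \<in> borel_measurable M" for M :: "'c measure" and h g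
    unfolding f_def indicator_def lessThan_iff by measurable
  have f_upd: "f (z(?i := r')) r = f z r" for z r r' by (simp add: f_def)
  have f_meas1: "f z \<in> borel_measurable borel" if "z \<in> space P" for z
    using f_meas[of "\<lambda>_. z" borel "\<lambda>r. r"] that by simp
  have "(\<integral>\<^sup>+z. \<phi> (load N z (arrival z p)) * indicator {..<t} (arrival z p) \<partial>P) =
     (\<integral>\<^sup>+z. f z (z ?i) \<partial>P)" unfolding load_arrival by (simp add: f_def arrival_eq)
  also have "\<dots> = (\<integral>\<^sup>+z. \<integral>\<^sup>+r. f z r \<partial>exponential_distr ?l \<partial>P)"
    by (subst nn_integral_resample[OF i]) (measurable, simp add: f_upd)
  also have "\<dots> = (\<integral>\<^sup>+z. ennreal ?l * (\<integral>\<^sup>+r. (\<integral>\<^sup>+u. f z u * indicator {0<..r} u \<partial>lborel) \<partial>exponential_distr ?l) \<partial>P)"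
    by (intro nn_integral_cong nn_integral_exponential_hazard l f_meas1)
  also have "\<dots> = ennreal ?l * (\<integral>\<^sup>+z. \<integral>\<^sup>+r. (\<integral>\<^sup>+u. f z u * indicator {0<..r} u \<partial>lborel) \<partial>exponential_distr ?l \<partial>P)"
    by (rule nn_integral_cmult)
       (rule sigma_finite_measure.borel_measurable_nn_integral[OF prob_space_imp_sigma_finite[OF prob_space_exponential_distr[OF l]]],
        unfold split_beta', measurable)
  \<comment> \<open>Resampling read backwards: the independent copy \<open>r\<close> becomes the
    interarrival time of the path itself.\<close>
  also have "(\<integral>\<^sup>+z. \<integral>\<^sup>+r. (\<integral>\<^sup>+u. f z u * indicator {0<..r} u \<partial>lborel) \<partial>exponential_distr ?l \<partial>P) =
    (\<integral>\<^sup>+z. (\<integral>\<^sup>+u. f z u * indicator {0<..z ?i} u \<partial>lborel) \<partial>P)"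
    by (subst nn_integral_resample[OF i, where f="\<lambda>z. \<integral>\<^sup>+u. f z u * indicator {0<..z ?i} u \<partial>lborel"])
       (measurable, simp add: f_upd)
  also have "\<dots> = (\<integral>\<^sup>+z. \<integral>\<^sup>+u. \<phi> (load N z u) * indicator {..<t} u *
      indicator {prev_arrival z p<..arrival z p} u \<partial>lborel \<partial>P)"
  proof (rule nn_integral_cong_AE)
    from AE_pos AE_space show "AE z in P. (\<integral>\<^sup>+u. f z u * indicator {0<..z ?i} u \<partial>lborel) =
       (\<integral>\<^sup>+u. \<phi> (load N z u) * indicator {..<t} u * indicator {prev_arrival z p<..arrival z p} u \<partial>lborel)"
    proof eventually_elim
      case (elim z)
      have z: "0 \<le> z (Inl (fst p, j))" for j using elim same_class[OF p] by (auto intro: less_imp_le)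
      have [measurable]: "(\<lambda>u. load N z u) \<in> borel_measurable borel"
        using load_measurable[of "\<lambda>_. z" borel "\<lambda>u. u"] elim by simp
      have "(\<integral>\<^sup>+u. \<phi> (load N z u) * indicator {..<t} u * indicator {prev_arrival z p<..arrival z p} u \<partial>lborel) =
        ennreal 1 * (\<integral>\<^sup>+v. \<phi> (load N z (prev_arrival z p + 1 * v)) * indicator {..<t} (prev_arrival z p + 1 * v) *
           indicator {prev_arrival z p<..arrival z p} (prev_arrival z p + 1 * v) \<partial>lborel)"
        by (subst nn_integral_real_affine[where t="prev_arrival z p" and c=1]) auto
      also have "\<dots> = (\<integral>\<^sup>+u. f z u * indicator {0<..z ?i} u \<partial>lborel)"
        unfolding ennreal_1 mult_1
      proof (intro nn_integral_cong)
        fix v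
        have "load N z (prev_arrival z p + v) = probe_load N p z v" if "0 < v" "v \<le> z ?i"
          using load_eq_probe_load[of z p v N] z that by simp
        then show "\<phi> (load N z (prev_arrival z p + v)) * indicator {..<t} (prev_arrival z p + v) *
           indicator {prev_arrival z p<..arrival z p} (prev_arrival z p + v) = f z v * indicator {0<..z ?i} v"
          by (auto simp: f_def arrival_eq indicator_def)
      qed
      finally show ?case by simp
    qed
  qed
  finally show ?thesis .
qed

text \<open>The intervals between successive arrivals of a class are disjoint, so the right sides of
  \<open>pasta\<close> add up to at most the integral over the whole time until \<open>t\<close>.
  With \<open>\<phi> = 1\<close> this bounds the expected number of arrivals.\<close>

lemma pasta_sum_le:
  fixes \<phi> :: "real \<Rightarrow> ennreal"
  assumes n: "n \<in> {1..N}" and [measurable]: "\<phi> \<in> borel_measurable borel"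
  shows "(\<Sum>k. \<integral>\<^sup>+z. \<phi> (load N z (arrival z (n, k))) * indicator {..<t} (arrival z (n, k)) \<partial>P) \<le>
    ennreal (lam n) * (\<integral>\<^sup>+z. \<integral>\<^sup>+u. \<phi> (load N z u) * indicator {0<..t} u \<partial>lborel \<partial>P)"
proof (rule suminf_le_const)
  fix K
  have p [measurable]: "(n, k) \<in> packets N" for k using n by (auto simp: packets_def)
  have "(\<Sum>k<K. \<integral>\<^sup>+z. \<phi> (load N z (arrival z (n, k))) * indicator {..<t} (arrival z (n, k)) \<partial>P) =
    (\<Sum>k<K. ennreal (lam n) * (\<integral>\<^sup>+z. \<integral>\<^sup>+u. \<phi> (load N z u) * indicator {..<t} u *
      indicator {prev_arrival z (n, k)<..arrival z (n, k)} u \<partial>lborel \<partial>P))"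
    by (subst pasta[OF p]) auto
  also have "\<dots> = ennreal (lam n) * (\<integral>\<^sup>+z. (\<Sum>k<K. \<integral>\<^sup>+u. \<phi> (load N z u) * indicator {..<t} u *
      indicator {prev_arrival z (n, k)<..arrival z (n, k)} u \<partial>lborel) \<partial>P)"
    unfolding indicator_def[of "{..<t}"] lessThan_iff
    by (subst nn_integral_sum) (auto simp: sum_distrib_left)
  also have "\<dots> \<le> ennreal (lam n) * (\<integral>\<^sup>+z. \<integral>\<^sup>+u. \<phi> (load N z u) * indicator {0<..t} u \<partial>lborel \<partial>P)"
  proof (intro mult_left_mono nn_integral_mono_AE)
    from AE_pos AE_space show "AE z in P. (\<Sum>k<K. \<integral>\<^sup>+u. \<phi> (load N z u) * indicator {..<t} u *
        indicator {prev_arrival z (n, k)<..arrival z (n, k)} u \<partial>lborel) \<le>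
      (\<integral>\<^sup>+u. \<phi> (load N z u) * indicator {0<..t} u \<partial>lborel)"
    proof eventually_elim
      case (elim z)
      have z: "0 \<le> z (Inl (n, j))" for j using elim p by (auto intro: less_imp_le)
      have [measurable]: "(\<lambda>u. load N z u) \<in> borel_measurable borel"
        using load_measurable[of "\<lambda>_. z" borel "\<lambda>u. u"] elim by simp
      have "(\<Sum>k<K. \<integral>\<^sup>+u. \<phi> (load N z u) * indicator {..<t} u *
          indicator {prev_arrival z (n, k)<..arrival z (n, k)} u \<partial>lborel) =
        (\<integral>\<^sup>+u. \<phi> (load N z u) * indicator {..<t} u * (\<Sum>k<K. indicator {prev_arrival z (n, k)<..arrival z (n, k)} u) \<partial>lborel)"
        by (subst nn_integral_sum[symmetric]) (auto simp: sum_distrib_left)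
      also have "\<dots> \<le> (\<integral>\<^sup>+u. \<phi> (load N z u) * indicator {0<..t} u \<partial>lborel)"
        unfolding sum_indicator_interarrival[of z n, OF z] by (intro nn_integral_mono) (auto simp: indicator_def)
      finally show ?case .
    qed
  qed simp
  finally show "(\<Sum>k<K. \<integral>\<^sup>+z. \<phi> (load N z (arrival z (n, k))) * indicator {..<t} (arrival z (n, k)) \<partial>P) \<le>
    ennreal (lam n) * (\<integral>\<^sup>+z. \<integral>\<^sup>+u. \<phi> (load N z u) * indicator {0<..t} u \<partial>lborel \<partial>P)" .
qed (rule summableI)

end

section \<open>The mean of the capped workload\<close>

context mg1_model begin

lemma packets_pair: "(n, k) \<in> packets N \<longleftrightarrow> n \<in> {1..N}"
  by (auto simp: packets_def)

lemma service_integrals: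
  assumes n: "n \<in> {1..N}"
  shows "(\<integral>\<^sup>+r. ennreal r \<partial>F n) = ennreal (x n)" "(\<integral>\<^sup>+r. ennreal (r\<^sup>2) \<partial>F n) = ennreal (y n)"
    "0 \<le> x n" "0 \<le> y n"
proof -
  have "AE r in F n. 0 \<le> r" using service_pos[OF n] by eventually_elim simp
  then show "(\<integral>\<^sup>+r. ennreal r \<partial>F n) = ennreal (x n)" "0 \<le> x n"
    using service_mean[OF n] integral_nonneg_AE[where M="F n" and f="\<lambda>r. r"]
    by (auto simp: has_bochner_integral_iff nn_integral_eq_integral)
  show "(\<integral>\<^sup>+r. ennreal (r\<^sup>2) \<partial>F n) = ennreal (y n)" "0 \<le> y n"
    using service_second_moment[OF n] Bochner_Integration.integral_nonneg[where M="F n" and f="\<lambda>r. r\<^sup>2"]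
    by (auto simp: has_bochner_integral_iff nn_integral_eq_integral)
qed

lemma nn_integral_service:
  assumes p: "p \<in> packets N" and [measurable]: "g \<in> borel_measurable P" "h \<in> borel_measurable borel"
    and g: "\<And>z r. g (z(Inr p := r)) = g z"
  shows "(\<integral>\<^sup>+z. g z * h (z (Inr p)) \<partial>P) = (\<integral>\<^sup>+z. g z \<partial>P) * (\<integral>\<^sup>+r. h r \<partial>F (fst p))"
proof -
  have i [measurable]: "Inr p \<in> I" using p by auto
  note [measurable_cong] = service_sets[OF packets_class[OF p]]
  have h: "h \<in> borel_measurable (F (fst p))"
    unfolding measurable_cong_sets[OF service_sets[OF packets_class[OF p]] refl] by (rule assms)
  have "(\<integral>\<^sup>+z. g z * h (z (Inr p)) \<partial>P) = (\<integral>\<^sup>+z. \<integral>\<^sup>+r. g z * h r \<partial>F (fst p) \<partial>P)"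
    by (subst nn_integral_resample[OF i]) (measurable, simp add: g)
  also have "\<dots> = (\<integral>\<^sup>+z. g z * (\<integral>\<^sup>+r. h r \<partial>F (fst p)) \<partial>P)"
    by (intro nn_integral_cong nn_integral_cmult h)
  also have "\<dots> = (\<integral>\<^sup>+z. g z \<partial>P) * (\<integral>\<^sup>+r. h r \<partial>F (fst p))" by (rule nn_integral_multc) measurable
  finally show ?thesis .
qed

lemma arrival_count_le:
  assumes n: "n \<in> {1..N}" and t: "0 \<le> t"
  shows "(\<Sum>k. \<integral>\<^sup>+z. indicator {..<t} (arrival z (n, k)) \<partial>P) \<le> ennreal (lam n * t)"
proof -
  have "(\<Sum>k. \<integral>\<^sup>+z. indicator {..<t} (arrival z (n, k)) \<partial>P) \<le>
    ennreal (lam n) * (\<integral>\<^sup>+z. \<integral>\<^sup>+u. indicator {0<..t} u \<partial>lborel \<partial>P)"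
    using pasta_sum_le[OF n, of "\<lambda>_. 1" t] by simp
  also have "\<dots> = ennreal (lam n * t)"
    using t rate_pos[OF n] by (simp add: P.emeasure_space_1 ennreal_mult')
  finally show ?thesis .
qed

text \<open>A tie between two classes would force one interarrival time, given all other
  coordinates, to hit a fixed value; within a class arrivals strictly increase. Local finiteness
  follows from the finite expected number of arrivals before each integer time.\<close>

lemma AE_fcfs_path: "AE z in P. fcfs_path N (arrival z) (z \<circ> Inr)"
proof -
  have distinct: "AE z in P. arrival z p \<noteq> arrival z q"
    if p [measurable]: "p \<in> packets N" and q [measurable]: "q \<in> packets N" and pq: "fst p \<noteq> fst q" for p q
  proof -
    have i [measurable]: "Inl p \<in> I" using p by auto
    have "(\<integral>\<^sup>+z. indicator {0} (arrival z p - arrival z q) \<partial>P) =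
       (\<integral>\<^sup>+z. \<integral>\<^sup>+r. indicator {0} (prev_arrival z p + r - arrival z q) \<partial>exponential_distr (lam (fst p)) \<partial>P)"
      by (subst nn_integral_resample[OF i]) (measurable, use pq in \<open>simp add: arrival_upd_other\<close>)
    also have "\<dots> = (\<integral>\<^sup>+z. 0 \<partial>P)"
    proof (intro nn_integral_cong)
      fix z
      have "AE r in exponential_distr (lam (fst p)). (indicator {0} (prev_arrival z p + r - arrival z q) :: ennreal) = 0"
        using AE_exponential_distr_neq[where c="arrival z q - prev_arrival z p"]
        by eventually_elim (auto simp: indicator_def)
      then show "(\<integral>\<^sup>+r. indicator {0} (prev_arrival z p + r - arrival z q) \<partial>exponential_distr (lam (fst p))) = 0"
        by (subst nn_integral_cong_AE[where v="\<lambda>_. 0"]) auto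
    qed
    finally have "AE z in P. (indicator {0} (arrival z p - arrival z q) :: ennreal) = 0"
      by (subst (asm) nn_integral_cong[of _ _ "\<lambda>z. indicator {0} (arrival z p - arrival z q)"]) (simp_all add: nn_integral_0_iff_AE)
    then show ?thesis by eventually_elim (auto simp: indicator_def split: if_splits)
  qed
  have few: "AE z in P. finite {k. arrival z (n, k) < real j}" if n: "n \<in> {1..N}" for n and j :: nat
  proof -
    have [measurable]: "(n, k) \<in> packets N" for k using n by (simp add: packets_pair)
    have "(\<integral>\<^sup>+z. (\<Sum>k. indicator {..<real j} (arrival z (n, k))) \<partial>P) \<le> ennreal (lam n * real j)"
      by (subst nn_integral_suminf) (auto intro!: arrival_count_le n)
    then have "(\<integral>\<^sup>+z. (\<Sum>k. indicator {..<real j} (arrival z (n, k))) \<partial>P) \<noteq> \<infinity>"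
      by (auto simp: top_unique)
    then have "AE z in P. (\<Sum>k. indicator {..<real j} (arrival z (n, k)) :: ennreal) \<noteq> \<infinity>"
      by (intro nn_integral_PInf_AE) measurable
    then show ?thesis
    proof eventually_elim
      case (elim z)
      have "(\<Sum>k. ennreal (indicator {..<real j} (arrival z (n, k)))) \<noteq> \<infinity>"
        using elim by (simp add: ennreal_indicator)
      then have "summable (\<lambda>k. indicator {..<real j} (arrival z (n, k)) :: real)"
        by (intro summable_suminf_not_top) auto
      from summable_LIMSEQ_zero[OF this]
      have "\<forall>\<^sub>F k in sequentially. (indicator {..<real j} (arrival z (n, k)) :: real) < 1"
        by (rule order_tendstoD) simp
      then obtain K where "\<And>k. K \<le> k \<Longrightarrow> (indicator {..<real j} (arrival z (n, k)) :: real) < 1"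
        by (auto simp: eventually_sequentially)
      then have "{k. arrival z (n, k) < real j} \<subseteq> {..<K}"
        by (force simp: indicator_def not_less[symmetric])
      then show ?case by (rule finite_subset) simp
    qed
  qed
  have "AE z in P. \<forall>p\<in>packets N. \<forall>q\<in>packets N. fst p \<noteq> fst q \<longrightarrow> arrival z p \<noteq> arrival z q"
    using distinct by (simp add: AE_ball_countable)
  moreover have "AE z in P. \<forall>n\<in>{1..N}. \<forall>j. finite {k. arrival z (n, k) < real j}"
    using few by (simp add: AE_ball_countable AE_all_countable del: atLeastAtMost_iff)
  ultimately show ?thesis using AE_pos
  proof eventually_elim
    case (elim z)
    have pos: "0 < z (Inl p)" "0 < z (Inr p)" if "p \<in> packets N" for p using elim that by auto
    have mono: "arrival z p < arrival z q" if "p \<in> packets N" "fst p = fst q" "snd p < snd q" for p q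
    proof -
      have "arrival z p < (\<Sum>i<Suc (Suc (snd p)). z (Inl (fst p, i)))"
        using pos(1)[OF same_class[OF that(1)]] by (simp add: arrival_def split_beta lessThan_Suc_atMost[symmetric])
      also have "\<dots> \<le> arrival z q"
        unfolding arrival_def split_beta that(2)[symmetric] lessThan_Suc_atMost[symmetric]
        by (rule sum_mono2) (use that pos(1)[OF same_class[OF that(1)]] in \<open>auto intro: less_imp_le\<close>)
      finally show ?thesis .
    qed
    show ?case
    proof
      show "1 \<le> N" by (rule classes)
      show "0 < arrival z p" if "p \<in> packets N" for p
        unfolding arrival_def split_beta using pos(1)[OF same_class[OF that]] by (intro sum_pos) auto
      show "0 < (z \<circ> Inr) p" if "p \<in> packets N" for p using pos that by simp
      show "inj_on (arrival z) (packets N)"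
      proof (rule inj_onI)
        fix p q assume pq: "p \<in> packets N" "q \<in> packets N" "arrival z p = arrival z q"
        then have "fst p = fst q" using elim by blast
        moreover have "snd p = snd q"
          using mono[of p q] mono[of q p] pq \<open>fst p = fst q\<close> by (metis less_irrefl linorder_less_linear)
        ultimately show "p = q" by (rule prod_eqI)
      qed
      show "finite {q \<in> packets N. arrival z q \<le> u}" for u
      proof -
        obtain j where j: "u < real j" using reals_Archimedean2 by blast
        have "{q \<in> packets N. arrival z q \<le> u} \<subseteq> (SIGMA n:{1..N}. {k. arrival z (n, k) < real j})"
          using j by (auto simp: packets_def)
        moreover have "finite (SIGMA n:{1..N}. {k. arrival z (n, k) < real j})"
          using elim by (intro finite_SigmaI) auto
        ultimately show ?thesis by (rule finite_subset)
      qed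
    qed
  qed
qed

text \<open>The Pollaczek-Khinchine value, that is the solution \<open>v\<close> of
  \<open>v = \<rho> * v + (\<Sum>j=1..N. lam j * y j) / 2\<close> with
  \<open>\<rho> = (\<Sum>j=1..N. lam j * x j)\<close>.\<close>

definition mean_load :: real where
  "mean_load = (\<Sum>j=1..N. lam j * y j) / (2 * (1 - (\<Sum>j=1..N. lam j * x j)))"

lemma mean_load_nonneg: "0 \<le> mean_load"
  unfolding mean_load_def using stable rate_pos service_integrals
  by (intro divide_nonneg_nonneg sum_nonneg mult_nonneg_nonneg) (auto intro: less_imp_le)

text \<open>The expectation of \<open>capped_workload_area_le\<close>: the service time of a packet
  factors out of the workload it sees, and \<open>pasta_sum_le\<close> leads back to the expected
  area \<open>?e\<close>. The result is the inequality version of the equation for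
  \<open>mean_load\<close>, and the cap disappears from the bound.\<close>

lemma expected_capped_area_le:
  assumes m: "0 \<le> m" and t: "0 \<le> t"
  shows "(\<integral>\<^sup>+z. \<integral>\<^sup>+u. ennreal (min (load N z u) m) * indicator {0<..t} u \<partial>lborel \<partial>P) \<le> ennreal (mean_load * t)"
    (is "?e \<le> _")
proof -
  let ?S = "\<lambda>z j k. indicator {..<t} (arrival z (j, k)) *
     ennreal (z (Inr (j, k)) * min (load N z (arrival z (j, k))) m + (z (Inr (j, k)))\<^sup>2 / 2)"
  have pk [measurable]: "(j, k) \<in> packets N" if "j \<in> {1..N}" for j k using that by (simp add: packets_pair)
  have term_eq: "(\<integral>\<^sup>+z. ?S z j k \<partial>P) =
      ennreal (x j) * (\<integral>\<^sup>+z. ennreal (min (load N z (arrival z (j, k))) m) * indicator {..<t} (arrival z (j, k)) \<partial>P)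
      + ennreal (y j / 2) * (\<integral>\<^sup>+z. indicator {..<t} (arrival z (j, k)) \<partial>P)" if j: "j \<in> {1..N}" for j k
  proof -
    note [measurable] = pk[OF j, of k]
    have i [measurable]: "Inr (j, k) \<in> I" using j by (auto simp: packets_pair)
    let ?a = "\<lambda>z. arrival z (j, k)"
    have "(\<integral>\<^sup>+z. ?S z j k \<partial>P) = (\<integral>\<^sup>+z. (indicator {..<t} (?a z) * ennreal (min (load N z (?a z)) m)) * ennreal (z (Inr (j, k)))
       + indicator {..<t} (?a z) * ennreal (((z (Inr (j, k)))\<^sup>2) / 2) \<partial>P)"
    proof (rule nn_integral_cong_AE)
      show "AE z in P. ?S z j k = (indicator {..<t} (?a z) * ennreal (min (load N z (?a z)) m)) * ennreal (z (Inr (j, k)))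
       + indicator {..<t} (?a z) * ennreal (((z (Inr (j, k)))\<^sup>2) / 2)"
        using AE_pos
      proof eventually_elim
        case (elim z)
        then have "0 \<le> z (Inr (j, k))" using i by (auto intro: less_imp_le)
        then show ?case using m by (simp add: ennreal_mult distrib_left mult_ac)
      qed
    qed
    also have "\<dots> = (\<integral>\<^sup>+z. (indicator {..<t} (?a z) * ennreal (min (load N z (?a z)) m)) * ennreal (z (Inr (j, k))) \<partial>P)
       + (\<integral>\<^sup>+z. indicator {..<t} (?a z) * ennreal (((z (Inr (j, k)))\<^sup>2) / 2) \<partial>P)"
      by (rule nn_integral_add) measurable
    also have "(\<integral>\<^sup>+z. (indicator {..<t} (?a z) * ennreal (min (load N z (?a z)) m)) * ennreal (z (Inr (j, k))) \<partial>P) =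
       (\<integral>\<^sup>+z. indicator {..<t} (?a z) * ennreal (min (load N z (?a z)) m) \<partial>P) * ennreal (x j)"
      by (subst nn_integral_service[of "(j, k)"])
         (measurable, auto simp: load_upd_service service_integrals[OF j])
    also have "(\<integral>\<^sup>+z. indicator {..<t} (?a z) * ennreal (((z (Inr (j, k)))\<^sup>2) / 2) \<partial>P) =
       (\<integral>\<^sup>+z. indicator {..<t} (?a z) \<partial>P) * ennreal (y j / 2)"
    proof -
      note [measurable_cong] = service_sets[OF j]
      have "(\<lambda>r. ennreal (r\<^sup>2)) \<in> borel_measurable (F j)"
        unfolding measurable_cong_sets[OF service_sets[OF j] refl] by measurable
      from nn_integral_divide[OF this, of 2]
      have "(\<integral>\<^sup>+r. ennreal (r\<^sup>2 / 2) \<partial>F j) = ennreal (y j / 2)"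
        using service_integrals(2)[OF j]
        by (simp add: divide_ennreal[symmetric] service_integrals(4)[OF j])
      then show ?thesis
        by (subst nn_integral_service[of "(j, k)" _ "\<lambda>r. ennreal (r\<^sup>2 / 2)"]) (measurable, use j in auto)
    qed
    finally show ?thesis by (simp add: mult.commute)
  qed
  have "?e \<le> (\<integral>\<^sup>+z. (\<Sum>j=1..N. \<Sum>k. ?S z j k) \<partial>P)"
  proof (rule nn_integral_mono_AE)
    show "AE z in P. (\<integral>\<^sup>+u. ennreal (min (load N z u) m) * indicator {0<..t} u \<partial>lborel) \<le> (\<Sum>j=1..N. \<Sum>k. ?S z j k)"
      using AE_fcfs_path
    proof eventually_elim
      case (elim z)
      interpret fcfs_path N "arrival z" "z \<circ> Inr" by (rule elim)
      have "(\<integral>\<^sup>+u. ennreal (min (load N z u) m) * indicator {0<..t} u \<partial>lborel) \<le>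
         (\<integral>\<^sup>+u. ennreal (min (load N z u) m) * indicator {0..t} u \<partial>lborel)"
        by (intro nn_integral_mono) (auto simp: indicator_def)
      also have "\<dots> \<le> (\<Sum>q | q \<in> packets N \<and> arrival z q < t.
        ennreal (z (Inr q) * min (load N z (arrival z q)) m + (z (Inr q))\<^sup>2 / 2))"
        using capped_workload_area_le[OF t m] by (simp add: load_def)
      also have "\<dots> = (\<Sum>j=1..N. \<Sum>k. if arrival z (j, k) < t then
        ennreal (z (Inr (j, k)) * min (load N z (arrival z (j, k))) m + (z (Inr (j, k)))\<^sup>2 / 2) else 0)"
        by (subst sum_packets_suminf[where P="\<lambda>q. arrival z q < t"]) (auto intro: locally_finite')
      also have "\<dots> \<le> (\<Sum>j=1..N. \<Sum>k. ?S z j k)"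
        by (intro sum_mono suminf_le summableI) (auto simp: indicator_def)
      finally show ?case .
    qed
  qed
  also have "\<dots> = (\<Sum>j=1..N. \<Sum>k. \<integral>\<^sup>+z. ?S z j k \<partial>P)"
  proof (subst nn_integral_sum)
    have meas: "(\<lambda>z. ?S z j k) \<in> borel_measurable P" if j: "j \<in> {1..N}" for j k
    proof -
      note [measurable] = pk[OF j, of k]
      have [measurable]: "Inr (j, k) \<in> I" using j by (auto simp: packets_pair)
      show ?thesis by measurable
    qed
    then show "\<And>j. j \<in> {1..N} \<Longrightarrow> (\<lambda>z. \<Sum>k. ?S z j k) \<in> borel_measurable P"
      by (intro borel_measurable_suminf_order) auto
    show "(\<Sum>j=1..N. \<integral>\<^sup>+z. (\<Sum>k. ?S z j k) \<partial>P) = (\<Sum>j=1..N. \<Sum>k. \<integral>\<^sup>+z. ?S z j k \<partial>P)"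
      by (intro sum.cong refl nn_integral_suminf meas)
  qed
  also have "\<dots> \<le> (\<Sum>j=1..N. ennreal (x j) * (ennreal (lam j) * ?e) + ennreal (y j / 2) * ennreal (lam j * t))"
  proof (rule sum_mono)
    fix j assume j: "j \<in> {1..N}"
    have "(\<Sum>k. \<integral>\<^sup>+z. ?S z j k \<partial>P) =
      ennreal (x j) * (\<Sum>k. \<integral>\<^sup>+z. ennreal (min (load N z (arrival z (j, k))) m) * indicator {..<t} (arrival z (j, k)) \<partial>P)
      + ennreal (y j / 2) * (\<Sum>k. \<integral>\<^sup>+z. indicator {..<t} (arrival z (j, k)) \<partial>P)"
      unfolding term_eq[OF j] by (simp add: suminf_add[symmetric, OF summableI summableI])
    also have "\<dots> \<le> ennreal (x j) * (ennreal (lam j) * ?e) + ennreal (y j / 2) * ennreal (lam j * t)"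
      by (intro add_mono mult_left_mono arrival_count_le pasta_sum_le[OF j, of "\<lambda>w. ennreal (min w m)"] j t) auto
    finally show "(\<Sum>k. \<integral>\<^sup>+z. ?S z j k \<partial>P) \<le> ennreal (x j) * (ennreal (lam j) * ?e) + ennreal (y j / 2) * ennreal (lam j * t)" .
  qed
  finally have le: "?e \<le> (\<Sum>j=1..N. ennreal (x j) * (ennreal (lam j) * ?e) + ennreal (y j / 2) * ennreal (lam j * t))" .
  \<comment> \<open>The cap makes \<open>?e\<close> finite, which is what allows the inequality
    \<open>le\<close> to be solved for it.\<close>
  have "?e \<le> (\<integral>\<^sup>+z. \<integral>\<^sup>+u. ennreal m * indicator {0<..t} u \<partial>lborel \<partial>P)"
    by (intro nn_integral_mono mult_right_mono ennreal_leI) auto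
  also have "\<dots> < \<infinity>" using t by (simp add: nn_integral_cmult P.emeasure_space_1 ennreal_mult_less_top)
  finally obtain e where e: "?e = ennreal e" "0 \<le> e" by (cases ?e) auto
  have "ennreal e \<le> ennreal (\<Sum>j=1..N. x j * (lam j * e) + y j / 2 * (lam j * t))"
  proof -
    have "(\<Sum>j=1..N. ennreal (x j) * (ennreal (lam j) * ennreal e) + ennreal (y j / 2) * ennreal (lam j * t)) =
      (\<Sum>j=1..N. ennreal (x j * (lam j * e) + y j / 2 * (lam j * t)))"
    proof (rule sum.cong[OF refl])
      fix j assume j: "j \<in> {1..N}"
      have "0 \<le> x j" "0 \<le> y j" "0 \<le> lam j" using service_integrals[OF j] rate_pos[OF j] by auto
      then show "ennreal (x j) * (ennreal (lam j) * ennreal e) + ennreal (y j / 2) * ennreal (lam j * t) =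
        ennreal (x j * (lam j * e) + y j / 2 * (lam j * t))"
        using e t by (simp add: ennreal_mult[symmetric] ennreal_plus[symmetric] del: ennreal_plus)
    qed
    also have "\<dots> = ennreal (\<Sum>j=1..N. x j * (lam j * e) + y j / 2 * (lam j * t))"
      by (rule sum_ennreal)
         (use service_integrals rate_pos e t in \<open>auto intro!: add_nonneg_nonneg mult_nonneg_nonneg simp: less_imp_le\<close>)
    finally show ?thesis using le unfolding e by simp
  qed
  then have "e \<le> (\<Sum>j=1..N. x j * (lam j * e) + y j / 2 * (lam j * t))"
    by (subst (asm) ennreal_le_iff)
       (use service_integrals rate_pos e t in \<open>auto intro!: sum_nonneg add_nonneg_nonneg mult_nonneg_nonneg simp: less_imp_le\<close>)
  also have "\<dots> = (\<Sum>j=1..N. lam j * x j) * e + (\<Sum>j=1..N. lam j * y j) / 2 * t"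
    by (simp add: sum.distrib sum_distrib_right sum_distrib_left sum_divide_distrib mult_ac)
  finally have "e \<le> mean_load * t"
    using stable by (simp add: mean_load_def field_simps)
  then show ?thesis unfolding e by (rule ennreal_leI)
qed

end

section \<open>Orthogonal noise\<close>

context mg1_model begin

text \<open>The two noises are the errors that a single packet contributes when its service time is replaced
  by the mean and its waiting time by the area below the workload, with the workload capped
  at \<open>m\<close> and only up to time \<open>t\<close>.\<close>

definition seen :: "nat \<Rightarrow> real \<Rightarrow> real \<Rightarrow> nat \<Rightarrow> mg1_path \<Rightarrow> real" where
  "seen n t m k z = indicator {..<t} (arrival z (n, k)) * min (load N z (arrival z (n, k))) m"

definition service_noise :: "nat \<Rightarrow> real \<Rightarrow> real \<Rightarrow> nat \<Rightarrow> mg1_path \<Rightarrow> real" where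
  "service_noise n t m k z = seen n t m k z * (z (Inr (n, k)) - x n)"

definition probe :: "nat \<Rightarrow> real \<Rightarrow> real \<Rightarrow> nat \<Rightarrow> mg1_path \<Rightarrow> real \<Rightarrow> real" where
  "probe n t m k z r = indicator {..<t} (prev_arrival z (n, k) + r) * min (probe_load N (n, k) z r) m"

definition arrival_noise :: "nat \<Rightarrow> real \<Rightarrow> real \<Rightarrow> nat \<Rightarrow> mg1_path \<Rightarrow> real" where
  "arrival_noise n t m k z = seen n t m k z -
     lam n * (\<integral>u. probe n t m k z u * indicator {0<..z (Inl (n, k))} u \<partial>lborel)"

lemma seen_eq_probe: "seen n t m k z = probe n t m k z (z (Inl (n, k)))"
  unfolding seen_def probe_def load_arrival by (simp add: arrival_eq)

lemma seen_bounds: "0 \<le> m \<Longrightarrow> 0 \<le> seen n t m k z" "0 \<le> m \<Longrightarrow> seen n t m k z \<le> m"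
  by (auto simp: seen_def indicator_def)

lemma probe_bounds: "0 \<le> m \<Longrightarrow> 0 \<le> probe n t m k z r" "0 \<le> m \<Longrightarrow> probe n t m k z r \<le> m"
  by (auto simp: probe_def indicator_def)

lemma probe_measurable [measurable (raw)]:
  assumes "n \<in> {1..N}" and [measurable]: "f \<in> M \<rightarrow>\<^sub>M P" "g \<in> borel_measurable M"
  shows "(\<lambda>w. probe n t m k (f w) (g w)) \<in> borel_measurable M"
proof -
  have [measurable]: "(n, k) \<in> packets N" using assms by (simp add: packets_pair)
  show ?thesis unfolding probe_def indicator_def lessThan_iff by measurable
qed

lemma seen_measurable [measurable (raw)]:
  assumes n: "n \<in> {1..N}" and f: "f \<in> M \<rightarrow>\<^sub>M P"
  shows "(\<lambda>w. seen n t m k (f w)) \<in> borel_measurable M"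
  unfolding seen_eq_probe
  by (rule probe_measurable[OF n f measurable_coordinate_comp[OF _ f]]) (use n in \<open>simp add: packets_pair Plus_def\<close>)

lemma service_noise_measurable [measurable]:
  assumes n: "n \<in> {1..N}"
  shows "service_noise n t m k \<in> borel_measurable P"
proof -
  have [measurable]: "Inr (n, k) \<in> I" "n \<in> {1..N}" using n by (auto simp: packets_pair)
  show ?thesis unfolding service_noise_def[abs_def] by measurable
qed

lemma arrival_noise_measurable [measurable]:
  assumes n: "n \<in> {1..N}"
  shows "arrival_noise n t m k \<in> borel_measurable P"
proof -
  have [measurable]: "Inl (n, k) \<in> I" "n \<in> {1..N}" using n by (auto simp: packets_pair)
  have [measurable]: "(\<lambda>z. \<integral>u. probe n t m k z u * indicator {0<..z (Inl (n, k))} u \<partial>lborel) \<in> borel_measurable P"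
    unfolding indicator_def greaterThanAtMost_iff
    by (rule lborel.borel_measurable_lebesgue_integral) measurable
  show ?thesis unfolding arrival_noise_def[abs_def] by measurable
qed

text \<open>Linear in \<open>t\<close> uniformly in the cap, so that the second moments below grow
  only like \<open>m * t\<close>.\<close>

lemma expected_seen_sum_le:
  assumes n: "n \<in> {1..N}" and t: "0 \<le> t" and m: "0 \<le> m"
  shows "(\<Sum>k. \<integral>\<^sup>+z. ennreal (seen n t m k z) \<partial>P) \<le> ennreal (lam n * mean_load * t)"
proof -
  have "(\<Sum>k. \<integral>\<^sup>+z. ennreal (seen n t m k z) \<partial>P) =
    (\<Sum>k. \<integral>\<^sup>+z. ennreal (min (load N z (arrival z (n, k))) m) * indicator {..<t} (arrival z (n, k)) \<partial>P)"
    by (intro suminf_cong nn_integral_cong) (auto simp: seen_def indicator_def)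
  also have "\<dots> \<le> ennreal (lam n) * (\<integral>\<^sup>+z. \<integral>\<^sup>+u. ennreal (min (load N z u) m) * indicator {0<..t} u \<partial>lborel \<partial>P)"
    by (rule pasta_sum_le[OF n, of "\<lambda>w. ennreal (min w m)"]) measurable
  also have "\<dots> \<le> ennreal (lam n) * ennreal (mean_load * t)"
    by (intro mult_left_mono expected_capped_area_le m t) auto
  also have "\<dots> = ennreal (lam n * mean_load * t)"
    using rate_pos[OF n] by (simp add: ennreal_mult' mult.assoc)
  finally show ?thesis .
qed

text \<open>Takes the role of the martingale difference property: on positive paths \<open>A\<close>
  does not react to coordinate \<open>i\<close>, in which \<open>B\<close> has mean 0, so
  integrating over this coordinate first annihilates the product. Positivity, which holds almost
  surely, is what keeps later packets later.\<close>

lemma orthogonal_by_resampling: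
  fixes A B :: "mg1_path \<Rightarrow> real"
  assumes i: "i \<in> I" and A_meas: "A \<in> borel_measurable P" and B_meas: "B \<in> borel_measurable P"
    and int: "integrable P (\<lambda>z. A z * B z)"
    and A: "\<And>z r. (\<And>j. j \<in> I \<Longrightarrow> 0 < z j) \<Longrightarrow> 0 < r \<Longrightarrow> A (z(i := r)) = A z"
    and B: "\<And>z. z \<in> space P \<Longrightarrow> (\<integral>r. B (z(i := r)) \<partial>D i) = 0"
  shows "(\<integral>z. A z * B z \<partial>P) = 0"
proof -
  have "(\<integral>z. A z * B z \<partial>P) = (\<integral>z. \<integral>r. A (z(i := r)) * B (z(i := r)) \<partial>D i \<partial>P)"
    by (rule integral_resample[OF i int])
  also have "\<dots> = 0"
  proof (rule integral_eq_zero_AE)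
    from AE_pos AE_space show "AE z in P. (\<integral>r. A (z(i := r)) * B (z(i := r)) \<partial>D i) = 0"
    proof eventually_elim
      case (elim z)
      have "(\<lambda>r. r) \<in> borel_measurable (D i)"
        unfolding measurable_cong_sets[OF sets_D[OF i] refl] by measurable
      then have upd: "(\<lambda>r. z(i := r)) \<in> D i \<rightarrow>\<^sub>M P"
        by (intro upd_measurable i) (use elim in auto)
      note meas = measurable_compose[OF upd A_meas] measurable_compose[OF upd B_meas]
      have A_eq: "AE r in D i. A (z(i := r)) * B (z(i := r)) = A z * B (z(i := r))"
        using AE_D_pos[OF i] by eventually_elim (use A elim in simp)
      have "(\<integral>r. A (z(i := r)) * B (z(i := r)) \<partial>D i) = (\<integral>r. A z * B (z(i := r)) \<partial>D i)"
        by (intro integral_cong_AE borel_measurable_times borel_measurable_const meas A_eq)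
      also have "\<dots> = 0" using B elim by simp
      finally show ?case .
    qed
  qed
  finally show ?thesis .
qed

text \<open>Orthogonality adds up the second moments, each of which is controlled by the mean of
  \<open>seen\<close>, and these means have a sum linear in \<open>t\<close>. The integrability that
  \<open>orth\<close> asks for is at hand because \<open>seen\<close> is bounded by the cap, which
  makes every \<open>d k\<close> square integrable.\<close>

lemma orthogonal_noise_second_moment:
  fixes d :: "nat \<Rightarrow> mg1_path \<Rightarrow> real"
  assumes n: "n \<in> {1..N}" and t: "0 \<le> t" and m: "0 \<le> m" and c: "0 \<le> c"
    and [measurable]: "\<And>k. d k \<in> borel_measurable P"
    and sq: "\<And>k. (\<integral>\<^sup>+z. ennreal ((d k z)\<^sup>2) \<partial>P) \<le> ennreal c * (\<integral>\<^sup>+z. ennreal (seen n t m k z) \<partial>P)"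
    and orth: "\<And>k l. l < k \<Longrightarrow> integrable P (\<lambda>z. d l z * d k z) \<Longrightarrow> (\<integral>z. d l z * d k z \<partial>P) = 0"
  shows "(\<integral>\<^sup>+z. ennreal ((\<Sum>k<K. d k z)\<^sup>2) \<partial>P) \<le> ennreal (c * (lam n * mean_load * t))"
proof -
  note [measurable] = seen_measurable[OF n, of "\<lambda>z. z", simplified]
  have "(\<integral>\<^sup>+z. ennreal (seen n t m k z) \<partial>P) \<le> ennreal m" for k
    using seen_bounds[OF m] by (intro P.nn_integral_le_const) (auto simp: ennreal_leI)
  then have "(\<integral>\<^sup>+z. ennreal ((d k z)\<^sup>2) \<partial>P) \<le> ennreal c * ennreal m" for k
    by (rule order_trans[OF sq mult_left_mono]) simp
  then have "(\<integral>\<^sup>+z. ennreal ((d k z)\<^sup>2) \<partial>P) < \<infinity>" for k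
    by (rule le_less_trans) (simp add: ennreal_mult_less_top)
  then have sq_int: "integrable P (\<lambda>z. (d k z)\<^sup>2)" for k
    by (intro integrableI_nonneg) auto
  have int: "integrable P (\<lambda>z. d l z * d k z)" for k l by (intro integrable_mult_square sq_int) auto
  note s = second_moment_orthogonal_sum[of d P K, OF _ sq_int orth[OF _ int], simplified]
  have "(\<integral>\<^sup>+z. ennreal ((\<Sum>k<K. d k z)\<^sup>2) \<partial>P) = ennreal (\<Sum>k<K. \<integral>z. (d k z)\<^sup>2 \<partial>P)"
    using s by (subst nn_integral_eq_integral) auto
  also have "\<dots> = (\<Sum>k<K. ennreal (\<integral>z. (d k z)\<^sup>2 \<partial>P))" by (rule sum_ennreal[symmetric]) simp
  also have "\<dots> = (\<Sum>k<K. \<integral>\<^sup>+z. ennreal ((d k z)\<^sup>2) \<partial>P)"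
    using sq_int by (intro sum.cong refl nn_integral_eq_integral[symmetric]) auto
  also have "\<dots> \<le> (\<Sum>k<K. ennreal c * (\<integral>\<^sup>+z. ennreal (seen n t m k z) \<partial>P))" by (intro sum_mono sq)
  also have "\<dots> = ennreal c * (\<Sum>k<K. \<integral>\<^sup>+z. ennreal (seen n t m k z) \<partial>P)" by (rule sum_distrib_left[symmetric])
  also have "\<dots> \<le> ennreal c * (\<Sum>k. \<integral>\<^sup>+z. ennreal (seen n t m k z) \<partial>P)"
    by (intro mult_left_mono sum_le_suminf summableI) auto
  also have "\<dots> \<le> ennreal c * ennreal (lam n * mean_load * t)"
    by (intro mult_left_mono expected_seen_sum_le n t m) simp
  finally show ?thesis using c by (simp add: ennreal_mult')
qed

text \<open>The factor \<open>m\<close> comes from \<open>(seen)\<^sup>2 \<le> m * seen\<close> and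
  the factor \<open>y n\<close> bounds the variance of a service time. For orthogonality the service
  time of the later packet \<open>k\<close> is resampled: packet \<open>l < k\<close> arrives no
  later and cannot see it.\<close>

lemma service_noise_second_moment:
  assumes n: "n \<in> {1..N}" and t: "0 \<le> t" and m: "0 \<le> m"
  shows "(\<integral>\<^sup>+z. ennreal ((\<Sum>k<K. service_noise n t m k z)\<^sup>2) \<partial>P) \<le> ennreal (m * y n * (lam n * mean_load * t))"
proof (rule orthogonal_noise_second_moment[OF n t m])
  interpret Fn: prob_space "F n" by (rule service_prob[OF n])
  note si = service_integrals[OF n]
  show "0 \<le> m * y n" using m si by simp
  show "\<And>k. service_noise n t m k \<in> borel_measurable P" by (rule service_noise_measurable[OF n])
  note [measurable] = n
  have pk: "(n, k) \<in> packets N" for k using n by (simp add: packets_pair)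
  have seen_upd: "seen n t m k (z(Inr (n, k) := r)) = seen n t m k z" for k z r
    by (simp add: seen_def load_upd_service)
  have int1: "integrable (F n) (\<lambda>r. r)" "(\<integral>r. r \<partial>F n) = x n"
    and int2: "integrable (F n) (\<lambda>r. r\<^sup>2)" "(\<integral>r. r\<^sup>2 \<partial>F n) = y n"
    using service_mean[OF n] service_second_moment[OF n] by (auto simp: has_bochner_integral_iff)
  have var: "(\<integral>\<^sup>+r. ennreal ((r - x n)\<^sup>2) \<partial>F n) \<le> ennreal (y n)"
  proof -
    have eq: "(\<lambda>r. (r - x n)\<^sup>2) = (\<lambda>r. r\<^sup>2 + (x n)\<^sup>2 - 2 * x n * r)"
      by (auto simp: power2_eq_square algebra_simps)
    have "integrable (F n) (\<lambda>r. (r - x n)\<^sup>2)" unfolding eq using int1 int2 by simp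
    then have "(\<integral>\<^sup>+r. ennreal ((r - x n)\<^sup>2) \<partial>F n) = ennreal (\<integral>r. (r - x n)\<^sup>2 \<partial>F n)"
      by (intro nn_integral_eq_integral) auto
    also have "(\<integral>r. (r - x n)\<^sup>2 \<partial>F n) = y n + (x n)\<^sup>2 - 2 * x n * x n"
      unfolding eq using int1 int2 by (simp add: Fn.prob_space)
    also have "\<dots> \<le> y n" by (simp add: power2_eq_square)
    finally show ?thesis by (simp add: ennreal_leI)
  qed
  fix k
  show "(\<integral>\<^sup>+z. ennreal ((service_noise n t m k z)\<^sup>2) \<partial>P) \<le> ennreal (m * y n) * (\<integral>\<^sup>+z. ennreal (seen n t m k z) \<partial>P)"
  proof -
    have "(\<integral>\<^sup>+z. ennreal ((service_noise n t m k z)\<^sup>2) \<partial>P) =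
      (\<integral>\<^sup>+z. ennreal ((seen n t m k z)\<^sup>2) * ennreal ((z (Inr (n, k)) - x n)\<^sup>2) \<partial>P)"
      by (simp add: service_noise_def power_mult_distrib ennreal_mult)
    also have "\<dots> = (\<integral>\<^sup>+z. ennreal ((seen n t m k z)\<^sup>2) \<partial>P) * (\<integral>\<^sup>+r. ennreal ((r - x n)\<^sup>2) \<partial>F n)"
      using nn_integral_service[OF pk[of k], of "\<lambda>z. ennreal ((seen n t m k z)\<^sup>2)" "\<lambda>r. ennreal ((r - x n)\<^sup>2)"] n
      by (simp add: seen_upd)
    also have "\<dots> \<le> (\<integral>\<^sup>+z. ennreal m * ennreal (seen n t m k z) \<partial>P) * ennreal (y n)"
    proof (intro mult_mono nn_integral_mono var)
      fix z
      have "(seen n t m k z)\<^sup>2 \<le> m * seen n t m k z"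
        using seen_bounds[OF m] by (simp add: power2_eq_square mult_right_mono)
      then show "ennreal ((seen n t m k z)\<^sup>2) \<le> ennreal m * ennreal (seen n t m k z)"
        using m by (simp add: ennreal_mult'[symmetric] ennreal_leI)
    qed auto
    also have "\<dots> = ennreal (m * y n) * (\<integral>\<^sup>+z. ennreal (seen n t m k z) \<partial>P)"
      using m si n by (subst nn_integral_cmult) (auto simp: ennreal_mult mult_ac)
    finally show ?thesis .
  qed
  fix l assume lk: "l < k" and int: "integrable P (\<lambda>z. service_noise n t m l z * service_noise n t m k z)"
  have i: "Inr (n, k) \<in> I" using pk by auto
  show "(\<integral>z. service_noise n t m l z * service_noise n t m k z \<partial>P) = 0"
  proof (rule orthogonal_by_resampling[OF i service_noise_measurable[OF n] service_noise_measurable[OF n] int])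
    fix z :: mg1_path and r :: real assume z: "\<And>j. j \<in> I \<Longrightarrow> 0 < z j"
    have z': "0 \<le> z (Inl (n, j))" for j
      by (rule less_imp_le[OF z[of "Inl (n, j)"]]) (use pk in auto)
    have "arrival z (n, l) \<le> arrival z (n, k)"
      using prev_arrival_le[of z n "Suc l" "Suc k"] z' lk by (simp add: prev_arrival_def arrival_def lessThan_Suc_atMost)
    then show "service_noise n t m l (z(Inr (n, k) := r)) = service_noise n t m l z"
      using lk by (simp add: service_noise_def seen_def load_upd_service)
  next
    fix z
    show "(\<integral>r. service_noise n t m k (z(Inr (n, k) := r)) \<partial>D (Inr (n, k))) = 0"
      using int1 by (simp add: service_noise_def seen_upd Fn.prob_space)
  qed
qed

text \<open>As a function of its own interarrival time alone, the noise is a compensated function of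
  an exponential variable, so \<open>exponential_compensated\<close> gives mean 0 and the factor
  \<open>6 * m\<close>. For orthogonality the interarrival time of the later packet \<open>k\<close>
  is resampled: the noise of packet \<open>l < k\<close> involves the workload only up to the
  arrival of \<open>l\<close>.\<close>

lemma arrival_noise_second_moment:
  assumes n: "n \<in> {1..N}" and t: "0 \<le> t" and m: "0 \<le> m"
  shows "(\<integral>\<^sup>+z. ennreal ((\<Sum>k<K. arrival_noise n t m k z)\<^sup>2) \<partial>P) \<le> ennreal (6 * m * (lam n * mean_load * t))"
proof (rule orthogonal_noise_second_moment[OF n t m])
  show "0 \<le> 6 * m" using m by simp
  show "\<And>k. arrival_noise n t m k \<in> borel_measurable P" by (rule arrival_noise_measurable[OF n])
  note [measurable] = n
  have pk: "(n, k) \<in> packets N" for k using n by (simp add: packets_pair)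
  then have i: "Inl (n, k) \<in> I" for k by auto
  have probe_upd: "probe n t m k (z(Inl (n, k) := r)) u = probe n t m k z u" for k z r u
    by (simp add: probe_def)
  have probe_meas: "probe n t m k z \<in> borel_measurable borel" if "z \<in> space P" for k z
    using probe_measurable[OF n, of "\<lambda>_. z" borel "\<lambda>r. r"] that by simp
  have noise_upd: "arrival_noise n t m k (z(Inl (n, k) := r)) =
     probe n t m k z r - lam n * (\<integral>u. probe n t m k z u * indicator {0<..r} u \<partial>lborel)" for k z r
    by (simp add: arrival_noise_def seen_eq_probe probe_upd)
  fix k
  note comp = exponential_compensated[OF rate_pos[OF n] probe_meas probe_bounds[OF m]]
  show "(\<integral>\<^sup>+z. ennreal ((arrival_noise n t m k z)\<^sup>2) \<partial>P) \<le> ennreal (6 * m) * (\<integral>\<^sup>+z. ennreal (seen n t m k z) \<partial>P)"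
  proof -
    have "(\<integral>\<^sup>+z. ennreal ((arrival_noise n t m k z)\<^sup>2) \<partial>P) =
      (\<integral>\<^sup>+z. \<integral>\<^sup>+r. ennreal ((arrival_noise n t m k (z(Inl (n, k) := r)))\<^sup>2) \<partial>exponential_distr (lam n) \<partial>P)"
      using nn_integral_resample[OF i[of k], of "\<lambda>z. ennreal ((arrival_noise n t m k z)\<^sup>2)"] arrival_noise_measurable[OF n]
      by simp
    also have "\<dots> \<le> (\<integral>\<^sup>+z. ennreal (6 * m) * (\<integral>\<^sup>+r. ennreal (probe n t m k z r) \<partial>exponential_distr (lam n)) \<partial>P)"
      unfolding noise_upd by (intro nn_integral_mono comp(3))
    also have "\<dots> = (\<integral>\<^sup>+z. \<integral>\<^sup>+r. ennreal (6 * m) * ennreal (seen n t m k (z(Inl (n, k) := r))) \<partial>exponential_distr (lam n) \<partial>P)"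
    proof (intro nn_integral_cong)
      fix z assume "z \<in> space P"
      then have "(\<lambda>r. ennreal (probe n t m k z r)) \<in> borel_measurable (exponential_distr (lam n))"
        unfolding measurable_cong_sets[OF sets_exponential_distr refl]
        by (intro measurable_compose[OF probe_meas measurable_ennreal])
      then show "ennreal (6 * m) * (\<integral>\<^sup>+r. ennreal (probe n t m k z r) \<partial>exponential_distr (lam n)) =
        (\<integral>\<^sup>+r. ennreal (6 * m) * ennreal (seen n t m k (z(Inl (n, k) := r))) \<partial>exponential_distr (lam n))"
        unfolding seen_eq_probe probe_upd by (subst nn_integral_cmult) auto
    qed
    also have "\<dots> = (\<integral>\<^sup>+z. ennreal (6 * m) * ennreal (seen n t m k z) \<partial>P)"
      using nn_integral_resample[OF i[of k], of "\<lambda>z. ennreal (6 * m) * ennreal (seen n t m k z)"] n by simp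
    also have "\<dots> = ennreal (6 * m) * (\<integral>\<^sup>+z. ennreal (seen n t m k z) \<partial>P)"
      using n by (intro nn_integral_cmult) auto
    finally show ?thesis .
  qed
  fix l assume lk: "l < k" and int: "integrable P (\<lambda>z. arrival_noise n t m l z * arrival_noise n t m k z)"
  show "(\<integral>z. arrival_noise n t m l z * arrival_noise n t m k z \<partial>P) = 0"
  proof (rule orthogonal_by_resampling[OF i arrival_noise_measurable[OF n] arrival_noise_measurable[OF n] int])
    fix z :: mg1_path and r :: real assume z: "\<And>j. j \<in> I \<Longrightarrow> 0 < z j" and r: "0 < r"
    have z': "0 \<le> z (Inl (n, j))" for j using z[OF i] by (rule less_imp_le)
    let ?z = "z(Inl (n, k) := r)"
    have prev: "prev_arrival ?z (n, l) = prev_arrival z (n, l)"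
      using lk by (auto simp: prev_arrival_def intro!: sum.cong)
    have probe_eq: "probe n t m l ?z u = probe n t m l z u" if u: "0 \<le> u" for u
    proof -
      let ?w = "z(Inl (n, l) := u)"
      have w: "0 \<le> ?w (Inl (n, j))" for j using z' u by auto
      have "prev_arrival z (n, l) + u = prev_arrival ?w (n, Suc l)"
        by (simp add: arrival_eq[symmetric] prev_arrival_def)
      also have "\<dots> \<le> prev_arrival ?w (n, k)" using lk by (intro prev_arrival_le w) auto
      finally have le: "prev_arrival z (n, l) + u \<le> prev_arrival ?w (n, k)" .
      \<comment> \<open>With the two updates exchanged, \<open>load_upd_arrival\<close> removes that
        of packet \<open>k\<close> from the path \<open>?w\<close>, on which packet \<open>l\<close>
        arrives hypothetically after \<open>u\<close>.\<close>
      have "?z(Inl (n, l) := u) = ?w(Inl (n, k) := r)" using lk by (simp add: fun_upd_twist)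
      then have "probe_load N (n, l) ?z u = load N (?w(Inl (n, k) := r)) (prev_arrival z (n, l) + u)"
        by (simp add: probe_load_def prev)
      also have "\<dots> = load N ?w (prev_arrival z (n, l) + u)"
        by (rule load_upd_arrival) (use w r le z'[of k] lk in \<open>auto intro: add_increasing2\<close>)
      finally show ?thesis by (simp add: probe_def prev probe_load_def)
    qed
    have "(\<integral>u. probe n t m l ?z u * indicator {0<..z (Inl (n, l))} u \<partial>lborel) =
        (\<integral>u. probe n t m l z u * indicator {0<..z (Inl (n, l))} u \<partial>lborel)"
      by (intro Bochner_Integration.integral_cong refl) (use probe_eq in \<open>auto simp: indicator_def\<close>)
    then show "arrival_noise n t m l ?z = arrival_noise n t m l z"
      using probe_eq[OF z'[of l]] lk by (simp add: arrival_noise_def seen_eq_probe)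
  next
    fix z assume "z \<in> space P"
    then show "(\<integral>r. arrival_noise n t m k (z(Inl (n, k) := r)) \<partial>D (Inl (n, k))) = 0"
      unfolding noise_upd using comp(2)[of z] by simp
  qed
qed

text \<open>Along \<open>t = i ^ 16\<close> with cap \<open>m = i ^ 14\<close> the bound \<open>m / t\<close> on the variance of the averages
  is summable.\<close>

lemma AE_noise_tendsto:
  assumes c: "0 \<le> c" and meas: "\<And>t m k. d t m k \<in> borel_measurable P"
    and bound: "\<And>t m K. 0 \<le> t \<Longrightarrow> 0 \<le> m \<Longrightarrow> (\<integral>\<^sup>+z. ennreal ((\<Sum>k<K. d t m k z)\<^sup>2) \<partial>P) \<le> ennreal (c * m * t)"
  shows "AE z in P. (\<lambda>i. (\<Sum>k<K i. d (real i ^ 16) (real i ^ 14) k z) / real i ^ 16) \<longlonglongrightarrow> 0"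
proof (rule AE_tendsto_zero_second_moment)
  note [measurable] = meas
  show "(\<lambda>z. (\<Sum>k<K i. d (real i ^ 16) (real i ^ 14) k z) / real i ^ 16) \<in> borel_measurable P" for i
    by measurable
  show "summable (\<lambda>i. c * (1 / real i ^ 2))"
    by (intro summable_mult) (use inverse_power_summable[of 2, where 'a=real] in \<open>simp add: field_simps\<close>)
  show "0 \<le> c * (1 / real i ^ 2)" for i using c by simp
  fix i :: nat
  let ?T = "real i ^ 16" and ?m = "real i ^ 14"
  have "(\<integral>\<^sup>+z. ennreal (((\<Sum>k<K i. d ?T ?m k z) / ?T)\<^sup>2) \<partial>P) =
    (\<integral>\<^sup>+z. ennreal (1 / ?T\<^sup>2) * ennreal ((\<Sum>k<K i. d ?T ?m k z)\<^sup>2) \<partial>P)"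
    by (intro nn_integral_cong) (simp add: ennreal_mult'[symmetric] power_divide)
  also have "\<dots> = ennreal (1 / ?T\<^sup>2) * (\<integral>\<^sup>+z. ennreal ((\<Sum>k<K i. d ?T ?m k z)\<^sup>2) \<partial>P)"
    by (rule nn_integral_cmult) measurable
  also have "\<dots> \<le> ennreal (1 / ?T\<^sup>2) * ennreal (c * ?m * ?T)"
    by (intro mult_left_mono bound) auto
  also have "\<dots> = ennreal (1 / ?T\<^sup>2 * (c * ?m * ?T))" by (rule ennreal_mult'[symmetric]) simp
  also have "1 / ?T\<^sup>2 * (c * ?m * ?T) = c * (1 / real i ^ 2)"
  proof (cases "i = 0")
    case False
    have "1 / (a * b * q) * (c * a * b) = c * (1 / q)" if "a \<noteq> 0" "b \<noteq> 0" for a b q :: real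
      using that by simp
    from this[of ?m ?T "real i ^ 2"] False have "1 / (?m * ?T * real i ^ 2) * (c * ?m * ?T) = c * (1 / real i ^ 2)"
      by (simp only: power_eq_0_iff of_nat_eq_0_iff simp_thms not_False_eq_True)
    moreover have "?T\<^sup>2 = ?m * ?T * real i ^ 2" by (simp add: power_mult[symmetric] power_add[symmetric])
    ultimately show ?thesis by (simp only:)
  qed simp
  finally show "(\<integral>\<^sup>+z. ennreal (((\<Sum>k<K i. d ?T ?m k z) / ?T)\<^sup>2) \<partial>P) \<le> ennreal (c * (1 / real i ^ 2))" .
qed

lemma AE_service_noise_tendsto:
  assumes n: "n \<in> {1..N}"
  shows "AE z in P. (\<lambda>i. (\<Sum>k<K i. service_noise n (real i ^ 16) (real i ^ 14) k z) / real i ^ 16) \<longlonglongrightarrow> 0"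
proof (rule AE_noise_tendsto[where c="y n * lam n * mean_load"])
  show "0 \<le> y n * lam n * mean_load"
    using service_integrals[OF n] rate_pos[OF n] mean_load_nonneg by simp
  show "(\<integral>\<^sup>+z. ennreal ((\<Sum>k<K. service_noise n t m k z)\<^sup>2) \<partial>P) \<le> ennreal (y n * lam n * mean_load * m * t)"
    if "0 \<le> t" "0 \<le> m" for t m K
    using service_noise_second_moment[OF n that, of K] by (simp only: mult.assoc mult.commute mult.left_commute)
qed (rule service_noise_measurable[OF n])

lemma AE_arrival_noise_tendsto:
  assumes n: "n \<in> {1..N}"
  shows "AE z in P. (\<lambda>i. (\<Sum>k<K i. arrival_noise n (real i ^ 16) (real i ^ 14) k z) / real i ^ 16) \<longlonglongrightarrow> 0"
proof (rule AE_noise_tendsto[where c="6 * lam n * mean_load"])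
  show "0 \<le> 6 * lam n * mean_load"
    using rate_pos[OF n] mean_load_nonneg by simp
  show "(\<integral>\<^sup>+z. ennreal ((\<Sum>k<K. arrival_noise n t m k z)\<^sup>2) \<partial>P) \<le> ennreal (6 * lam n * mean_load * m * t)"
    if "0 \<le> t" "0 \<le> m" for t m K
    using arrival_noise_second_moment[OF n that, of K] by (simp only: mult.assoc mult.commute mult.left_commute)
qed (rule arrival_noise_measurable[OF n])

end

section \<open>Long-run averages along a typical path\<close>

text \<open>For large \<open>i\<close>, less than \<open>\<lceil>2 * lam j\<rceil> * i ^ 16\<close> packets of class \<open>j\<close> arrive before time
  \<open>i ^ 16\<close>, so that the sums of noises cover all of them.\<close>

locale mg1_sample = mg1_model +
  fixes z :: mg1_path
  assumes path: "fcfs_path N (arrival z) (z \<circ> Inr)"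
    and positive: "\<And>i. i \<in> I \<Longrightarrow> 0 < z i"
    and in_space: "z \<in> space P"
    and arrival_lln: "\<And>j. j \<in> {1..N} \<Longrightarrow> \<exists>C\<ge>0. \<forall>k K. K \<le> k ^ 4 \<longrightarrow>
      \<bar>(\<Sum>i<K. z (Inl (j, i))) - 1 / lam j * real K\<bar> \<le> C * real k ^ 3"
    and service_lln: "\<And>j. j \<in> {1..N} \<Longrightarrow> \<exists>C\<ge>0. \<forall>k K. K \<le> k ^ 4 \<longrightarrow>
      \<bar>(\<Sum>i<K. z (Inr (j, i))) - x j * real K\<bar> \<le> C * real k ^ 3"
    and service_square_lln: "\<And>j. j \<in> {1..N} \<Longrightarrow> (\<lambda>K. (\<Sum>i<K. (z (Inr (j, i)))\<^sup>2) / real K) \<longlonglongrightarrow> y j"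
    and service_noise_lim: "\<And>j. j \<in> {1..N} \<Longrightarrow>
      (\<lambda>i. (\<Sum>k<nat \<lceil>2 * lam j\<rceil> * i ^ 16. service_noise j (real i ^ 16) (real i ^ 14) k z) / real i ^ 16) \<longlonglongrightarrow> 0"
    and arrival_noise_lim: "\<And>j. j \<in> {1..N} \<Longrightarrow>
      (\<lambda>i. (\<Sum>k<nat \<lceil>2 * lam j\<rceil> * i ^ 16. arrival_noise j (real i ^ 16) (real i ^ 14) k z) / real i ^ 16) \<longlonglongrightarrow> 0"
begin

interpretation path: fcfs_path N "arrival z" "z \<circ> Inr" by (rule path)

abbreviation "W \<equiv> load N z"
abbreviation "a \<equiv> \<lambda>j k. arrival z (j, k)"
abbreviation "g \<equiv> \<lambda>j K. prev_arrival z (j, K)"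
abbreviation "srv \<equiv> \<lambda>j k. z (Inr (j, k))"

definition cnt :: "nat \<Rightarrow> real \<Rightarrow> nat" where "cnt j u = card {k. a j k < u}"

lemma g_eq: "g j K = (\<Sum>i<K. z (Inl (j, i)))" by (simp add: prev_arrival_def)

lemma a_eq: "a j k = g j (Suc k)"
  by (simp add: arrival_def prev_arrival_def lessThan_Suc_atMost)

lemma z_pos: "j \<in> {1..N} \<Longrightarrow> 0 < z (Inl (j, k))" "j \<in> {1..N} \<Longrightarrow> 0 < srv j k"
  by (rule positive; simp add: packets_pair Plus_def)+

lemma g_strict_mono: "j \<in> {1..N} \<Longrightarrow> strict_mono (g j)"
  unfolding strict_mono_Suc_iff g_eq using z_pos(1) by simp

lemma g_nonneg: "j \<in> {1..N} \<Longrightarrow> 0 \<le> g j K"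
  unfolding g_eq using z_pos(1) by (intro sum_nonneg) (auto intro: less_imp_le)

lemma less_cnt_iff:
  assumes j: "j \<in> {1..N}"
  shows "k < cnt j u \<longleftrightarrow> a j k < u"
proof -
  have fin: "finite {k. a j k < u}"
  proof -
    have "(\<lambda>k. (j, k)) ` {k. a j k < u} \<subseteq> {q \<in> packets N. arrival z q < u}"
      using j by (auto simp: packets_pair)
    then have "finite ((\<lambda>k. (j, k)) ` {k. a j k < u})"
      using path.locally_finite' finite_subset by blast
    then show ?thesis by (rule finite_imageD) (auto simp: inj_on_def)
  qed
  have "\<exists>m. \<not> a j m < u"
  proof (rule ccontr)
    assume "\<nexists>m. \<not> a j m < u"
    then have "{k. a j k < u} = UNIV" by auto
    then show False using fin by simp
  qed
  then obtain m where m: "\<not> a j m < u" "\<And>i. i < m \<Longrightarrow> a j i < u"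
    using exists_least_iff[of "\<lambda>m. \<not> a j m < u"] by blast
  have "{k. a j k < u} = {..<m}"
  proof (intro equalityI subsetI)
    fix k assume k: "k \<in> {k. a j k < u}"
    have "\<not> m \<le> k"
    proof
      assume "m \<le> k"
      then have "a j m \<le> a j k" unfolding a_eq using strict_mono_less_eq[OF g_strict_mono[OF j], of "Suc m" "Suc k"] by simp
      then show False using k m by simp
    qed
    then show "k \<in> {..<m}" by simp
  qed (use m in auto)
  moreover from this have "cnt j u = m" by (simp add: cnt_def)
  ultimately show ?thesis by auto
qed

lemma cnt_bracket:
  assumes j: "j \<in> {1..N}" and u: "0 \<le> u"
  shows "g j (cnt j u) \<le> u" "u \<le> g j (Suc (cnt j u))"
proof -
  show "g j (cnt j u) \<le> u"
  proof (cases "cnt j u")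
    case (Suc k)
    then show ?thesis using less_cnt_iff[OF j, of k u] by (simp add: a_eq)
  qed (use u in \<open>simp add: g_eq\<close>)
  show "u \<le> g j (Suc (cnt j u))" using less_cnt_iff[OF j, of "cnt j u" u] by (simp add: a_eq)
qed

lemma cnt_mono: "j \<in> {1..N} \<Longrightarrow> u \<le> v \<Longrightarrow> cnt j u \<le> cnt j v"
proof (rule ccontr)
  assume j: "j \<in> {1..N}" and uv: "u \<le> v" and "\<not> cnt j u \<le> cnt j v"
  then have "cnt j v < cnt j u" by simp
  then have "a j (cnt j v) < v" using less_cnt_iff[OF j, of "cnt j v" u] uv by simp
  then show False using less_cnt_iff[OF j, of "cnt j v" v] by simp
qed

lemma sum_arrived_classes:
  "(\<Sum>q | q \<in> packets N \<and> arrival z q < u. f q) = (\<Sum>j=1..N. \<Sum>k<cnt j u. f (j, k))"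
proof -
  have "{q. q \<in> packets N \<and> arrival z q < u} = (SIGMA j:{1..N}. {..<cnt j u})"
    using less_cnt_iff by (auto simp: packets_def)
  then show ?thesis by (simp add: sum.Sigma)
qed

lemma g_ratio:
  assumes j: "j \<in> {1..N}" shows "(\<lambda>K. g j K / real K) \<longlonglongrightarrow> 1 / lam j"
proof -
  obtain C where "C \<ge> 0" "\<And>k K. K \<le> k ^ 4 \<Longrightarrow> \<bar>g j K - 1 / lam j * real K\<bar> \<le> C * real k ^ 3"
    using arrival_lln[OF j] unfolding g_eq by blast
  then show ?thesis by (intro lln_rate_imp_tendsto) auto
qed

text \<open>The laws of large numbers give their error bound only for \<open>K \<le> k ^ 4\<close>;
  this a priori bound places the random index \<open>cnt j u\<close> in such a range.\<close>

lemma cnt_linear_bound: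
  assumes j: "j \<in> {1..N}"
  shows "\<exists>L. \<forall>i u. 1 \<le> i \<longrightarrow> 0 \<le> u \<longrightarrow> u \<le> real i ^ 16 \<longrightarrow> cnt j u \<le> L * i ^ 16"
proof -
  have l: "0 < lam j" using rate_pos[OF j] .
  have "\<forall>\<^sub>F K in sequentially. 1 / (2 * lam j) < g j K / real K"
    by (rule order_tendstoD(1)[OF g_ratio[OF j]]) (use l in \<open>simp add: field_simps\<close>)
  then obtain K0 where K0: "\<And>K. K0 \<le> K \<Longrightarrow> 1 / (2 * lam j) < g j K / real K"
    by (auto simp: eventually_sequentially)
  have "cnt j u \<le> (K0 + nat \<lceil>2 * lam j\<rceil>) * i ^ 16" if i: "1 \<le> i" and u: "0 \<le> u" "u \<le> real i ^ 16" for i u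
  proof (cases "K0 \<le> cnt j u \<and> 0 < cnt j u")
    case True
    have "real (cnt j u) < 2 * lam j * g j (cnt j u)"
      using K0[of "cnt j u"] True l by (simp add: field_simps)
    also have "\<dots> \<le> 2 * lam j * real i ^ 16"
      using cnt_bracket[OF j u(1)] u l by (intro mult_left_mono) auto
    also have "\<dots> \<le> real (nat \<lceil>2 * lam j\<rceil>) * real i ^ 16"
      by (intro mult_right_mono real_nat_ceiling_ge) auto
    also have "\<dots> = real (nat \<lceil>2 * lam j\<rceil> * i ^ 16)" by simp
    finally have "cnt j u \<le> nat \<lceil>2 * lam j\<rceil> * i ^ 16" by (simp only: of_nat_less_iff)
    then show ?thesis by (simp add: add_mult_distrib)
  next
    case False
    then have "cnt j u \<le> K0" by auto
    also have "\<dots> \<le> K0 * i ^ 16" using i by simp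
    finally show ?thesis by (simp add: add_mult_distrib)
  qed
  then show ?thesis by blast
qed

text \<open>\<open>cnt_bracket\<close> inverts the rate for arrival times into one for counts, and
  the rate for service times then yields one for the arrived work. With order \<open>i ^ 16\<close>
  packets the error \<open>(M * i ^ 4) ^ 3\<close> is of order \<open>i ^ 12\<close>.\<close>

lemma cnt_rate:
  assumes j: "j \<in> {1..N}"
  shows "\<exists>B\<ge>0. \<forall>i u. 1 \<le> i \<longrightarrow> 0 \<le> u \<longrightarrow> u \<le> real i ^ 16 \<longrightarrow>
    \<bar>u - real (cnt j u) / lam j\<bar> \<le> B * real i ^ 12 \<and>
    \<bar>(\<Sum>k<cnt j u. srv j k) - lam j * x j * u\<bar> \<le> B * real i ^ 12"
proof -
  have l: "0 < lam j" using rate_pos[OF j] .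
  have xj: "0 \<le> x j" using service_integrals[OF j] by simp
  obtain L where L: "\<And>i u. 1 \<le> i \<Longrightarrow> 0 \<le> u \<Longrightarrow> u \<le> real i ^ 16 \<Longrightarrow> cnt j u \<le> L * i ^ 16"
    using cnt_linear_bound[OF j] by blast
  obtain C where C: "C \<ge> 0" "\<And>k K. K \<le> k ^ 4 \<Longrightarrow> \<bar>g j K - 1 / lam j * real K\<bar> \<le> C * real k ^ 3"
    using arrival_lln[OF j] unfolding g_eq by blast
  obtain C' where C': "C' \<ge> 0" "\<And>k K. K \<le> k ^ 4 \<Longrightarrow> \<bar>(\<Sum>i<K. srv j i) - x j * real K\<bar> \<le> C' * real k ^ 3"
    using service_lln[OF j] by blast
  \<comment> \<open>\<open>Suc L\<close> leaves room for the index \<open>Suc (cnt j u)\<close> at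
    the right end of the bracket.\<close>
  define M where "M = Suc L"
  have pow: "L * i ^ 16 + 1 \<le> (M * i ^ 4) ^ 4" if "1 \<le> i" for i
  proof -
    have "L * i ^ 16 + 1 \<le> M * i ^ 16" using that by (simp add: M_def)
    also have "M \<le> M ^ 4" by (rule self_le_power) (simp_all add: M_def)
    finally show ?thesis by (simp add: power_mult_distrib power_mult[symmetric])
  qed
  \<comment> \<open>The summand \<open>1 / lam j\<close> pays for the shift by one packet between
    the two ends of the bracket.\<close>
  define B1 where "B1 = C * real M ^ 3 + 1 / lam j"
  define B2 where "B2 = C' * real M ^ 3 + lam j * x j * B1"
  have B1: "0 \<le> B1" using C l by (simp add: B1_def)
  have B2: "0 \<le> B2" using C' l xj B1 by (simp add: B2_def)
  have e: "C * real (M * i ^ 4) ^ 3 = C * real M ^ 3 * real i ^ 12" for C :: real and i :: nat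
    by (simp add: power_mult_distrib power_mult[symmetric])
  have cnt1: "\<bar>u - real (cnt j u) / lam j\<bar> \<le> B1 * real i ^ 12" if i: "1 \<le> i" and u: "0 \<le> u" "u \<le> real i ^ 16" for i u
  proof -
    let ?K = "cnt j u"
    have K: "Suc ?K \<le> (M * i ^ 4) ^ 4" using L[OF i u] pow[OF i] by simp
    define q where "q = real ?K / lam j"
    define r where "r = 1 / lam j"
    have "\<bar>g j ?K - q\<bar> \<le> C * real M ^ 3 * real i ^ 12"
      using C(2)[of ?K "M * i ^ 4"] K unfolding e by (simp add: q_def)
    moreover have "\<bar>g j (Suc ?K) - (q + r)\<bar> \<le> C * real M ^ 3 * real i ^ 12"
      using C(2)[OF K] unfolding e by (simp add: q_def r_def add_divide_distrib add.commute)
    moreover have "0 \<le> r" "r \<le> r * real i ^ 12"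
      using l i one_le_power[of "real i" 12] mult_left_mono[of 1 "real i ^ 12" r] by (simp_all add: r_def)
    ultimately have "\<bar>u - q\<bar> \<le> C * real M ^ 3 * real i ^ 12 + r * real i ^ 12"
      using cnt_bracket[OF j u(1)] by linarith
    then show ?thesis by (simp only: B1_def distrib_right q_def r_def)
  qed
  have cnt2: "\<bar>(\<Sum>k<cnt j u. srv j k) - lam j * x j * u\<bar> \<le> B2 * real i ^ 12"
    if i: "1 \<le> i" and u: "0 \<le> u" "u \<le> real i ^ 16" for i u
  proof -
    let ?K = "cnt j u"
    have K: "?K \<le> (M * i ^ 4) ^ 4" using L[OF i u] pow[OF i] by simp
    have eq: "(\<Sum>k<?K. srv j k) - lam j * x j * u =
      ((\<Sum>k<?K. srv j k) - x j * real ?K) - lam j * x j * (u - real ?K / lam j)"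
      using l by (simp add: field_simps)
    have "\<bar>(\<Sum>k<?K. srv j k) - lam j * x j * u\<bar> \<le>
       \<bar>(\<Sum>k<?K. srv j k) - x j * real ?K\<bar> + \<bar>lam j * x j * (u - real ?K / lam j)\<bar>"
      unfolding eq by (rule abs_triangle_ineq4)
    also have "\<bar>lam j * x j * (u - real ?K / lam j)\<bar> = lam j * x j * \<bar>u - real ?K / lam j\<bar>"
      using l xj by (simp add: abs_mult)
    also have "\<bar>(\<Sum>k<?K. srv j k) - x j * real ?K\<bar> + lam j * x j * \<bar>u - real ?K / lam j\<bar> \<le>
       C' * real M ^ 3 * real i ^ 12 + lam j * x j * (B1 * real i ^ 12)"
      using C'(2)[OF K] unfolding e by (intro add_mono mult_left_mono cnt1 i u) (use l xj in auto)
    finally show ?thesis by (simp add: B2_def algebra_simps)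
  qed
  show ?thesis
  proof (intro exI[of _ "max B1 B2"] conjI allI impI)
    show "0 \<le> max B1 B2" using B1 by simp
    fix i :: nat and u :: real assume *: "1 \<le> i" "0 \<le> u" "u \<le> real i ^ 16"
    have "B1 * real i ^ 12 \<le> max B1 B2 * real i ^ 12" "B2 * real i ^ 12 \<le> max B1 B2 * real i ^ 12"
      by (intro mult_right_mono; simp)+
    then show "\<bar>u - real (cnt j u) / lam j\<bar> \<le> max B1 B2 * real i ^ 12"
      "\<bar>(\<Sum>k<cnt j u. srv j k) - lam j * x j * u\<bar> \<le> max B1 B2 * real i ^ 12"
      using cnt1[OF *] cnt2[OF *] by linarith+
  qed
qed

text \<open>The input of all classes together stays within order \<open>i ^ 12\<close> of its mean,
  uniformly until \<open>i ^ 16\<close>, and \<open>workload_le_fluctuation\<close> transfers this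
  to the workload.\<close>

lemma W_bound: "\<exists>E\<ge>0. \<forall>i u. 1 \<le> i \<longrightarrow> 0 \<le> u \<longrightarrow> u \<le> real i ^ 16 \<longrightarrow> W u \<le> E * real i ^ 12"
proof -
  have "\<forall>j\<in>{1..N}. \<exists>B. 0 \<le> B \<and> (\<forall>i u. 1 \<le> i \<longrightarrow> 0 \<le> u \<longrightarrow> u \<le> real i ^ 16 \<longrightarrow>
      \<bar>(\<Sum>k<cnt j u. srv j k) - lam j * x j * u\<bar> \<le> B * real i ^ 12)"
    using cnt_rate by blast
  from bchoice[OF this]
  obtain B where B: "\<And>j. j \<in> {1..N} \<Longrightarrow> 0 \<le> B j"
      "\<And>j i u. j \<in> {1..N} \<Longrightarrow> 1 \<le> i \<Longrightarrow> 0 \<le> u \<Longrightarrow> u \<le> real i ^ 16 \<Longrightarrow>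
        \<bar>(\<Sum>k<cnt j u. srv j k) - lam j * x j * u\<bar> \<le> B j * real i ^ 12"
    by blast
  define E where "E = 2 * (\<Sum>j=1..N. B j)"
  have "0 \<le> E" unfolding E_def by (intro mult_nonneg_nonneg sum_nonneg B(1)) auto
  moreover have "W t \<le> E * real i ^ 12" if i: "1 \<le> i" and t: "0 \<le> t" "t \<le> real i ^ 16" for i t
  proof -
    have "W t \<le> 2 * ((\<Sum>j=1..N. B j) * real i ^ 12)"
      unfolding load_def
    proof (rule path.workload_le_fluctuation)
      show "(\<Sum>j=1..N. lam j * x j) \<le> 1" using stable by simp
      show "0 \<le> t" by (rule t)
      fix u assume u: "0 \<le> u" "u \<le> t"
      have "\<bar>(\<Sum>q | q \<in> packets N \<and> arrival z q < u. (z \<circ> Inr) q) - (\<Sum>j=1..N. lam j * x j) * u\<bar> =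
        \<bar>\<Sum>j=1..N. (\<Sum>k<cnt j u. srv j k) - lam j * x j * u\<bar>"
        unfolding sum_arrived_classes by (simp add: sum_subtractf sum_distrib_right)
      also have "\<dots> \<le> (\<Sum>j=1..N. \<bar>(\<Sum>k<cnt j u. srv j k) - lam j * x j * u\<bar>)" by (rule sum_abs)
      also have "\<dots> \<le> (\<Sum>j=1..N. B j * real i ^ 12)"
        by (intro sum_mono B(2)) (use i u t in auto)
      finally show "\<bar>(\<Sum>q | q \<in> packets N \<and> arrival z q < u. (z \<circ> Inr) q) - (\<Sum>j=1..N. lam j * x j) * u\<bar> \<le>
        (\<Sum>j=1..N. B j) * real i ^ 12" by (simp add: sum_distrib_right)
    qed
    then show ?thesis by (simp add: E_def)
  qed
  ultimately show ?thesis by blast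
qed

text \<open>The exponent of the cap exceeds 12, so the random factor of \<open>W_bound\<close> is
  absorbed.\<close>

lemma eventually_W_le: "\<forall>\<^sub>F i in sequentially. \<forall>u. 0 \<le> u \<longrightarrow> u \<le> real i ^ 16 \<longrightarrow> W u \<le> real i ^ 14"
proof -
  obtain E where E: "0 \<le> E" "\<And>i u. 1 \<le> i \<Longrightarrow> 0 \<le> u \<Longrightarrow> u \<le> real i ^ 16 \<Longrightarrow> W u \<le> E * real i ^ 12"
    using W_bound by blast
  have "\<forall>\<^sub>F i in sequentially. E \<le> real i" using filterlim_real_sequentially by (simp add: filterlim_at_top)
  then show ?thesis using eventually_ge_at_top[of 1]
  proof eventually_elim
    case (elim i)
    have "real i \<le> real i ^ 2" by (rule self_le_power) (use elim in auto)
    then have "E \<le> real i ^ 2" using elim by linarith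
    then have "E * real i ^ 12 \<le> real i ^ 2 * real i ^ 12" by (intro mult_right_mono) auto
    also have "\<dots> = real i ^ 14" by (simp flip: power_add)
    finally show ?case using E(2) elim by (meson order_trans)
  qed
qed

lemma cnt_ratio:
  assumes j: "j \<in> {1..N}"
  shows "(\<lambda>i. real (cnt j (real i ^ 16)) / real i ^ 16) \<longlonglongrightarrow> lam j"
proof -
  have l: "0 < lam j" using rate_pos[OF j] .
  obtain B where B: "0 \<le> B" "\<And>i u. 1 \<le> i \<Longrightarrow> 0 \<le> u \<Longrightarrow> u \<le> real i ^ 16 \<Longrightarrow> \<bar>u - real (cnt j u) / lam j\<bar> \<le> B * real i ^ 12"
    "\<And>i u. 1 \<le> i \<Longrightarrow> 0 \<le> u \<Longrightarrow> u \<le> real i ^ 16 \<Longrightarrow> \<bar>(\<Sum>k<cnt j u. srv j k) - lam j * x j * u\<bar> \<le> B * real i ^ 12"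
    using cnt_rate[OF j] by blast
  have "(\<lambda>i. lam j - real (cnt j (real i ^ 16)) / real i ^ 16) \<longlonglongrightarrow> 0"
  proof (rule Lim_null_comparison)
    show "(\<lambda>i. lam j * B * real i ^ 12 / real i ^ 16) \<longlonglongrightarrow> 0" by real_asymp
    show "\<forall>\<^sub>F i in sequentially. norm (lam j - real (cnt j (real i ^ 16)) / real i ^ 16) \<le> lam j * B * real i ^ 12 / real i ^ 16"
      using eventually_ge_at_top[of 1]
    proof eventually_elim
      case (elim i)
      let ?u = "real i ^ 16"
      have u: "0 < ?u" using elim by simp
      have "lam j - real (cnt j ?u) / ?u = lam j * (?u - real (cnt j ?u) / lam j) / ?u"
        using u l by (simp add: diff_divide_distrib right_diff_distrib)
      then have "norm (lam j - real (cnt j ?u) / ?u) = lam j * \<bar>?u - real (cnt j ?u) / lam j\<bar> / ?u"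
        using u l by (simp add: abs_mult)
      also have "\<dots> \<le> lam j * (B * real i ^ 12) / ?u"
        using B(2)[of i ?u] elim u l by (intro divide_right_mono mult_left_mono) auto
      finally show ?case by (simp add: mult.assoc)
    qed
  qed
  then have "(\<lambda>i. lam j - (lam j - real (cnt j (real i ^ 16)) / real i ^ 16)) \<longlonglongrightarrow> lam j - 0"
    by (intro tendsto_intros)
  then show ?thesis by simp
qed

lemma cnt_at_top:
  assumes j: "j \<in> {1..N}"
  shows "filterlim (\<lambda>i. cnt j (real i ^ 16)) at_top sequentially"
proof -
  have "filterlim (\<lambda>i. real (cnt j (real i ^ 16)) / real i ^ 16 * real i ^ 16) at_top sequentially"
    by (rule filterlim_tendsto_pos_mult_at_top[OF cnt_ratio[OF j] rate_pos[OF j]]) real_asymp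
  moreover have "\<forall>\<^sub>F i in sequentially. real (cnt j (real i ^ 16)) / real i ^ 16 * real i ^ 16 = real (cnt j (real i ^ 16))"
    using eventually_ge_at_top[of 1] by eventually_elim simp
  ultimately have "filterlim (\<lambda>i. real (cnt j (real i ^ 16))) at_top sequentially"
    by (subst (asm) filterlim_cong[OF refl refl])
  then show ?thesis by (simp only: filterlim_sequentially_iff_filterlim_real)
qed

lemma service_square_average:
  assumes j: "j \<in> {1..N}"
  shows "(\<lambda>i. (\<Sum>k<cnt j (real i ^ 16). (srv j k)\<^sup>2) / real i ^ 16) \<longlonglongrightarrow> lam j * y j"
proof -
  have "(\<lambda>i. real (cnt j (real i ^ 16)) / real i ^ 16 *
      ((\<Sum>k<cnt j (real i ^ 16). (srv j k)\<^sup>2) / real (cnt j (real i ^ 16)))) \<longlonglongrightarrow> lam j * y j"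
    by (intro tendsto_mult cnt_ratio j filterlim_compose[OF service_square_lln[OF j] cnt_at_top[OF j]])
  moreover have "real (cnt j t) / t * ((\<Sum>k<cnt j t. (srv j k)\<^sup>2) / real (cnt j t)) =
      (\<Sum>k<cnt j t. (srv j k)\<^sup>2) / t" for t :: real
    by (cases "cnt j t = 0") simp_all
  ultimately show ?thesis by (simp only:)
qed

section \<open>Waiting times, area and input compared along one path\<close>

definition wait_sum :: "nat \<Rightarrow> real \<Rightarrow> real" where
  "wait_sum j u = (\<Sum>k<cnt j u. W (a j k))"

definition area :: "real \<Rightarrow> real" where
  "area u = (\<integral>v. W v * indicator {0<..<u} v \<partial>lborel)"

definition load_input :: "real \<Rightarrow> real" where
  "load_input u = (\<Sum>j=1..N. \<Sum>k<cnt j u. W (a j k) * srv j k + (srv j k)\<^sup>2 / 2)"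

lemma W_measurable [measurable]: "W \<in> borel_measurable borel"
  using load_measurable[of "\<lambda>_. z" borel "\<lambda>u. u"] in_space by simp

lemma W_integrable: "integrable lborel (\<lambda>v. W v * indicator {0<..<u} v)"
proof -
  obtain E where E: "0 \<le> E" "\<And>i u. 1 \<le> i \<Longrightarrow> 0 \<le> u \<Longrightarrow> u \<le> real i ^ 16 \<Longrightarrow> W u \<le> E * real i ^ 12"
    using W_bound by blast
  define i where "i = nat \<lceil>max 1 u\<rceil>"
  have i: "1 \<le> i" "u \<le> real i" unfolding i_def by linarith+
  have i16: "real i \<le> real i ^ 16" using i by (intro self_le_power) auto
  have bound: "W v \<le> E * real i ^ 12" if "0 < v" "v < u" for v
    by (rule E(2)) (use i i16 that in linarith)+
  show ?thesis
  proof (rule integrableI_bounded_set[where A="{0<..<u}" and B="E * real i ^ 12"])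
    show "emeasure lborel {0<..<u} < \<infinity>" by (cases "0 \<le> u") auto
    show "AE v in lborel. v \<in> {0<..<u} \<longrightarrow> norm (W v * indicator {0<..<u} v) \<le> E * real i ^ 12"
      using bound by (intro AE_I2) (auto simp: indicator_def)
  qed auto
qed

lemma area_mono: "u \<le> v \<Longrightarrow> area u \<le> area v"
  unfolding area_def by (intro integral_mono W_integrable) (auto simp: indicator_def)

lemma area_nonneg: "0 \<le> area u"
  unfolding area_def by (intro Bochner_Integration.integral_nonneg) auto

lemma area_eq:
  assumes t: "0 \<le> t"
  shows "area t + (W t)\<^sup>2 / 2 = load_input t"
proof -
  have "(W has_integral
    (\<Sum>q | q \<in> packets N \<and> arrival z q < t. W (arrival z q) * z (Inr q) + (z (Inr q))\<^sup>2 / 2) - (W t)\<^sup>2 / 2) {0..t}"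
    using path.workload_area[OF t] by (simp add: load_def)
  then have "(W has_integral load_input t - (W t)\<^sup>2 / 2) {0<..<t}"
    unfolding sum_arrived_classes load_input_def has_integral_Icc_iff_Ioo .
  moreover have "set_integrable lborel {0<..<t} W"
    using W_integrable[of t] by (simp add: set_integrable_def mult.commute)
  ultimately have "(LINT v:{0<..<t}|lborel. W v) = load_input t - (W t)\<^sup>2 / 2"
    by (simp only: set_borel_integral_eq_integral(2) integral_unique)
  then show ?thesis by (simp add: area_def set_lebesgue_integral_def mult.commute)
qed

lemma load_input_mono:
  assumes "u \<le> v"
  shows "load_input u \<le> load_input v"
  unfolding load_input_def
proof (intro sum_mono sum_mono2)
  fix j assume j: "j \<in> {1..N}"
  show "{..<cnt j u} \<subseteq> {..<cnt j v}" using cnt_mono[OF j assms] by auto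
  show "\<And>k. 0 \<le> W (a j k) * srv j k + (srv j k)\<^sup>2 / 2"
    using z_pos(2)[OF j] by (auto simp: less_imp_le)
qed simp

text \<open>Otherwise the area between \<open>s\<close> and \<open>t\<close> alone would reach
  \<open>area t + 1\<close>.\<close>

lemma small_workload_time:
  assumes "0 \<le> s" "s < t"
  shows "\<exists>u\<in>{s..t}. W u \<le> (area t + 1) / (t - s)"
proof (rule ccontr)
  define c where "c = (area t + 1) / (t - s)"
  assume "\<not> ?thesis"
  then have gt: "\<And>u. u \<in> {s..t} \<Longrightarrow> c \<le> W u" unfolding c_def by force
  have "area t + 1 = (\<integral>u. c * indicator {s<..<t} u \<partial>lborel)"
    using assms by (simp add: c_def)
  also have "\<dots> \<le> area t"
    unfolding area_def
  proof (intro integral_mono W_integrable)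
    show "integrable lborel (\<lambda>u. c * indicator {s<..<t} u)"
      using assms by (intro integrable_mult_right integrable_real_indicator) auto
    show "c * indicator {s<..<t} u \<le> W u * indicator {0<..<t} u" for u
      using gt[of u] assms by (auto simp: indicator_def)
  qed
  finally show False by simp
qed

lemma seen_eq:
  assumes j: "j \<in> {1..N}" and W: "\<And>u. 0 \<le> u \<Longrightarrow> u \<le> t \<Longrightarrow> W u \<le> m"
  shows "seen j t m k z = (if k < cnt j t then W (a j k) else 0)"
  using W[of "a j k"] g_nonneg[OF j, of "Suc k"] less_cnt_iff[OF j, of k t] by (auto simp: seen_def a_eq)

lemma service_noise_sum:
  assumes j: "j \<in> {1..N}" and W: "\<And>u. 0 \<le> u \<Longrightarrow> u \<le> t \<Longrightarrow> W u \<le> m" and K: "cnt j t \<le> K"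
  shows "(\<Sum>k<K. service_noise j t m k z) = (\<Sum>k<cnt j t. W (a j k) * srv j k) - x j * wait_sum j t"
proof -
  have "(\<Sum>k<K. service_noise j t m k z) = (\<Sum>k<cnt j t. service_noise j t m k z)"
    by (rule sum.mono_neutral_right) (use K in \<open>auto simp: service_noise_def seen_eq[OF j W]\<close>)
  also have "\<dots> = (\<Sum>k<cnt j t. W (a j k) * srv j k - x j * W (a j k))"
    by (intro sum.cong refl) (simp add: service_noise_def seen_eq[OF j W] algebra_simps)
  finally show ?thesis by (simp add: sum_subtractf wait_sum_def sum_distrib_left)
qed

text \<open>With the cap inactive the compensators are integrals of \<open>W\<close> over successive
  interarrival intervals of class \<open>j\<close>. These cover the time until \<open>t\<close> only
  if the interval in progress at \<open>t\<close>, which belongs to packet \<open>cnt j t\<close>,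
  is included; hence the strict \<open>cnt j t < K\<close>.\<close>

lemma arrival_noise_sum:
  assumes j: "j \<in> {1..N}" and t: "0 \<le> t" and W: "\<And>u. 0 \<le> u \<Longrightarrow> u \<le> t \<Longrightarrow> W u \<le> m" and K: "cnt j t < K"
  shows "(\<Sum>k<K. arrival_noise j t m k z) = wait_sum j t - lam j * area t"
proof -
  let ?J = "\<lambda>k v. W v * indicator {0<..<t} v * indicator {g j k<..a j k} v"
  have int: "integrable lborel (?J k)" for k
    using integrable_mult_indicator[OF _ W_integrable[of t], of "{g j k<..a j k}"] by (simp add: mult.commute)
  have z0: "0 \<le> z (Inl (fst (j, k), i))" for i k using z_pos(1)[OF j] by (simp add: less_imp_le)
  have one: "(\<integral>u. probe j t m k z u * indicator {0<..z (Inl (j, k))} u \<partial>lborel) = (\<integral>v. ?J k v \<partial>lborel)" for k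
  proof -
    have "(\<integral>v. ?J k v \<partial>lborel) = (\<integral>u. ?J k (g j k + 1 * u) \<partial>lborel)"
      by (subst lborel_integral_real_affine[of 1 _ "g j k"]) simp_all
    also have "\<dots> = (\<integral>u. probe j t m k z u * indicator {0<..z (Inl (j, k))} u \<partial>lborel)"
    proof (intro Bochner_Integration.integral_cong refl)
      fix u
      have "probe_load N (j, k) z u = W (g j k + u)" if "0 < u" "u \<le> z (Inl (j, k))"
        using load_eq_probe_load[of z "(j, k)" u N] z0[of k] that by simp
      then show "?J k (g j k + 1 * u) = probe j t m k z u * indicator {0<..z (Inl (j, k))} u"
        using g_nonneg[OF j, of k] W[of "g j k + u"] by (auto simp: indicator_def probe_def arrival_eq)
    qed
    finally show ?thesis ..
  qed
  have "(\<Sum>k<K. \<integral>u. probe j t m k z u * indicator {0<..z (Inl (j, k))} u \<partial>lborel) =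
      (\<integral>v. (\<Sum>k<K. ?J k v) \<partial>lborel)"
    unfolding one by (rule Bochner_Integration.integral_sum[symmetric]) (rule int)
  also have "\<dots> = area t"
    unfolding area_def
  proof (intro Bochner_Integration.integral_cong refl)
    fix v
    have "t \<le> g j (Suc (cnt j t))" by (rule cnt_bracket[OF j t])
    also have "\<dots> \<le> g j K" using strict_mono_less_eq[OF g_strict_mono[OF j], of "Suc (cnt j t)" K] K by simp
    finally have tK: "t \<le> g j K" .
    have "(\<Sum>k<K. ?J k v) = W v * indicator {0<..<t} v * (\<Sum>k<K. indicator {g j k<..a j k} v)"
      by (rule sum_distrib_left[symmetric])
    also have "(\<Sum>k<K. indicator {g j k<..a j k} v) = (indicator {0<..g j K} v :: real)"
      by (rule sum_indicator_interarrival) (use z_pos(1)[OF j] in \<open>simp add: less_imp_le\<close>)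
    also have "W v * indicator {0<..<t} v * indicator {0<..g j K} v = W v * indicator {0<..<t} v"
      using tK by (auto simp: indicator_def)
    finally show "(\<Sum>k<K. ?J k v) = W v * indicator {0<..<t} v" .
  qed
  finally have probes: "(\<Sum>k<K. \<integral>u. probe j t m k z u * indicator {0<..z (Inl (j, k))} u \<partial>lborel) = area t" .
  have "(\<Sum>k<K. seen j t m k z) = (\<Sum>k<cnt j t. seen j t m k z)"
    by (rule sum.mono_neutral_right) (use K in \<open>auto simp: seen_eq[OF j W]\<close>)
  also have "\<dots> = wait_sum j t" unfolding wait_sum_def by (intro sum.cong refl) (simp add: seen_eq[OF j W])
  finally show ?thesis
    unfolding arrival_noise_def sum_subtractf sum_distrib_left[symmetric] probes by simp
qed

lemma eventually_cnt_less:
  assumes j: "j \<in> {1..N}"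
  shows "\<forall>\<^sub>F i in sequentially. cnt j (real i ^ 16) < nat \<lceil>2 * lam j\<rceil> * i ^ 16"
proof -
  have "\<forall>\<^sub>F i in sequentially. real (cnt j (real i ^ 16)) / real i ^ 16 < 2 * lam j"
    using rate_pos[OF j] by (intro order_tendstoD(2)[OF cnt_ratio[OF j]]) simp
  then show ?thesis using eventually_ge_at_top[of 1]
  proof eventually_elim
    case (elim i)
    then have "real (cnt j (real i ^ 16)) < 2 * lam j * real i ^ 16" by (simp add: divide_less_eq)
    also have "\<dots> \<le> real (nat \<lceil>2 * lam j\<rceil>) * real i ^ 16"
      by (intro mult_right_mono real_nat_ceiling_ge) auto
    also have "\<dots> = real (nat \<lceil>2 * lam j\<rceil> * i ^ 16)" by simp
    finally show ?case by (simp only: of_nat_less_iff)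
  qed
qed

lemma wait_sum_minus_area:
  assumes j: "j \<in> {1..N}"
  shows "(\<lambda>i. wait_sum j (real i ^ 16) / real i ^ 16 - lam j * (area (real i ^ 16) / real i ^ 16)) \<longlonglongrightarrow> 0"
proof (rule Lim_transform_eventually[OF arrival_noise_lim[OF j]])
  show "\<forall>\<^sub>F i in sequentially. (\<Sum>k<nat \<lceil>2 * lam j\<rceil> * i ^ 16. arrival_noise j (real i ^ 16) (real i ^ 14) k z) / real i ^ 16 =
    wait_sum j (real i ^ 16) / real i ^ 16 - lam j * (area (real i ^ 16) / real i ^ 16)"
    using eventually_W_le eventually_cnt_less[OF j]
  proof eventually_elim
    case (elim i)
    then show ?case
      by (subst arrival_noise_sum[OF j]) (auto simp: diff_divide_distrib)
  qed
qed

lemma service_wait_minus: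
  assumes j: "j \<in> {1..N}"
  shows "(\<lambda>i. (\<Sum>k<cnt j (real i ^ 16). W (a j k) * srv j k) / real i ^ 16
    - x j * (wait_sum j (real i ^ 16) / real i ^ 16)) \<longlonglongrightarrow> 0"
proof (rule Lim_transform_eventually[OF service_noise_lim[OF j]])
  show "\<forall>\<^sub>F i in sequentially. (\<Sum>k<nat \<lceil>2 * lam j\<rceil> * i ^ 16. service_noise j (real i ^ 16) (real i ^ 14) k z) / real i ^ 16 =
    (\<Sum>k<cnt j (real i ^ 16). W (a j k) * srv j k) / real i ^ 16 - x j * (wait_sum j (real i ^ 16) / real i ^ 16)"
    using eventually_W_le eventually_cnt_less[OF j]
  proof eventually_elim
    case (elim i)
    then show ?case
      by (subst service_noise_sum[OF j]) (auto simp: diff_divide_distrib)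
  qed
qed

lemma load_input_limit:
  "(\<lambda>i. load_input (real i ^ 16) / real i ^ 16 -
     ((\<Sum>j=1..N. lam j * x j) * (area (real i ^ 16) / real i ^ 16) + (\<Sum>j=1..N. lam j * y j) / 2)) \<longlonglongrightarrow> 0"
proof -
  let ?t = "\<lambda>i. real i ^ 16"
  \<comment> \<open>Three vanishing errors for each class: the service noise, \<open>x j\<close>
    times the arrival noise, and the deviation of the squared service times. The terms with
    \<open>wait_sum\<close> cancel.\<close>
  have "(\<lambda>i. \<Sum>j=1..N. ((\<Sum>k<cnt j (?t i). W (a j k) * srv j k) / ?t i - x j * (wait_sum j (?t i) / ?t i))
      + x j * (wait_sum j (?t i) / ?t i - lam j * (area (?t i) / ?t i))
      + ((\<Sum>k<cnt j (?t i). (srv j k)\<^sup>2) / ?t i - lam j * y j) / 2) \<longlonglongrightarrow> (\<Sum>j=1..N. 0 + x j * 0 + (lam j * y j - lam j * y j) / 2)"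
    by (intro tendsto_intros service_wait_minus wait_sum_minus_area service_square_average) auto
  moreover have "(\<Sum>j=1..N. ((\<Sum>k<cnt j t. W (a j k) * srv j k) / t - x j * (wait_sum j t / t))
      + x j * (wait_sum j t / t - lam j * (area t / t))
      + ((\<Sum>k<cnt j t. (srv j k)\<^sup>2) / t - lam j * y j) / 2) =
     load_input t / t - ((\<Sum>j=1..N. lam j * x j) * (area t / t) + (\<Sum>j=1..N. lam j * y j) / 2)" for t
  proof -
    have "load_input t / t = (\<Sum>j=1..N. (\<Sum>k<cnt j t. W (a j k) * srv j k) / t + (\<Sum>k<cnt j t. (srv j k)\<^sup>2) / t / 2)"
      unfolding load_input_def
      by (simp add: sum_divide_distrib sum.distrib add_divide_distrib mult.commute)
    moreover have "(\<Sum>j=1..N. lam j * x j) * (area t / t) + (\<Sum>j=1..N. lam j * y j) / 2 =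
      (\<Sum>j=1..N. lam j * x j * (area t / t) + lam j * y j / 2)"
      by (simp add: sum_distrib_right sum_divide_distrib sum.distrib)
    ultimately show ?thesis
      by (simp only: sum_subtractf[symmetric]) (intro sum.cong refl, simp add: algebra_simps diff_divide_distrib)
  qed
  ultimately show ?thesis by simp
qed

end

context mg1_sample begin

text \<open>The term \<open>(W t)\<^sup>2 / 2\<close> of \<open>area_eq\<close> can be dropped in the upper bound. For the lower bound
  the identity is used at a time between \<open>t i\<close> and \<open>t (Suc i)\<close> at which the workload is small.\<close>

lemma area_limit: "(\<lambda>i. area (real i ^ 16) / real i ^ 16) \<longlonglongrightarrow> mean_load"
proof -
  define \<rho> where "\<rho> = (\<Sum>j=1..N. lam j * x j)"
  define c where "c = (\<Sum>j=1..N. lam j * y j) / 2"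
  define t where "t i = real i ^ 16" for i
  define b where "b i = area (t i) / t i" for i
  define \<eta> where "\<eta> i = load_input (t i) / t i - (\<rho> * b i + c)" for i
  let ?v = mean_load
  have "0 \<le> lam j * x j" "0 \<le> lam j * y j" if "j \<in> {1..N}" for j
    using rate_pos[OF that] service_integrals[OF that] by simp_all
  then have \<rho>: "0 \<le> \<rho>" and c: "0 \<le> c"
    unfolding \<rho>_def c_def by (auto intro!: sum_nonneg divide_nonneg_nonneg)
  have \<rho>1: "\<rho> < 1" using stable by (simp add: \<rho>_def)
  note \<rho> = \<rho> \<rho>1
  have v: "?v = c / (1 - \<rho>)" by (simp add: mean_load_def c_def \<rho>_def)
  then have v_eq: "?v = \<rho> * ?v + c" using \<rho> by (simp add: field_simps)
  have \<eta>: "\<eta> \<longlonglongrightarrow> 0" unfolding \<eta>_def b_def t_def \<rho>_def c_def by (rule load_input_limit)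
  obtain h where h: "0 < h" "\<And>i. \<bar>\<eta> i\<bar> \<le> h"
    using convergent_imp_Bseq[OF convergentI[OF \<eta>]] by (auto simp: Bseq_def)
  have t_nonneg: "0 \<le> t i" for i by (simp add: t_def)
  have b_nonneg: "0 \<le> b i" for i unfolding b_def using area_nonneg t_nonneg by simp
  have b_upper: "b i \<le> ?v + \<eta> i / (1 - \<rho>)" for i
  proof (cases "t i = 0")
    \<comment> \<open>This is \<open>i = 0\<close>: division by 0 gives 0, and both sides of the
      claim vanish.\<close>
    case True
    then have "\<eta> i = - c" "b i = 0" by (simp_all add: \<eta>_def b_def)
    then show ?thesis using \<rho> by (simp add: v)
  next
    case False
    then have "0 < t i" using t_nonneg[of i] by simp
    have "area (t i) \<le> load_input (t i)" using area_eq[OF t_nonneg[of i]] zero_le_power2[of "W (t i)"] by linarith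
    then have "b i \<le> load_input (t i) / t i" unfolding b_def using \<open>0 < t i\<close> by (intro divide_right_mono) auto
    then have "b i * (1 - \<rho>) \<le> c + \<eta> i" by (simp add: \<eta>_def algebra_simps)
    then have "b i \<le> (c + \<eta> i) / (1 - \<rho>)" using \<rho> by (simp add: pos_le_divide_eq)
    then show ?thesis by (simp add: v add_divide_distrib)
  qed
  define \<beta> where "\<beta> = ?v + h / (1 - \<rho>)"
  have b_le: "b i \<le> \<beta>" for i
  proof -
    have "\<eta> i / (1 - \<rho>) \<le> h / (1 - \<rho>)" using h(2)[of i] \<rho> by (intro divide_right_mono) auto
    then show ?thesis using b_upper[of i] by (simp add: \<beta>_def)
  qed
  have \<beta>: "0 \<le> \<beta>" using b_le[of 0] b_nonneg[of 0] by linarith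
  define d where "d i = max 0 (?v - b i)" for i
  \<comment> \<open>The errors of the recursion for the shortfall \<open>d\<close>: the passage from
    \<open>t i\<close> to \<open>t (Suc i)\<close>, the deviation \<open>\<eta>\<close>, and the
    boundary term at a time of small workload. The last one is of order
    \<open>i ^ 2 / i ^ 16\<close>, since the gap between the two times is of order
    \<open>i ^ 15\<close>.\<close>
  define e where "e i = (1 - t i / t (Suc i)) * (\<rho> * \<beta> + c + h) + \<bar>\<eta> i\<bar>
      + (\<beta> + 1)\<^sup>2 / 2 * ((t (Suc i) / (t (Suc i) - t i))\<^sup>2 / t (Suc i))" for i
  have "d \<longlonglongrightarrow> 0"
  proof (rule contraction_tendsto_zero[OF _ _ _ \<rho>])
    show "0 \<le> d i" for i by (simp add: d_def)
    have "(\<lambda>i. (1 - t i / t (Suc i)) * (\<rho> * \<beta> + c + h) + \<bar>\<eta> i\<bar>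
      + (\<beta> + 1)\<^sup>2 / 2 * ((t (Suc i) / (t (Suc i) - t i))\<^sup>2 / t (Suc i))) \<longlonglongrightarrow>
       0 * (\<rho> * \<beta> + c + h) + 0 + (\<beta> + 1)\<^sup>2 / 2 * 0"
    proof (intro tendsto_add tendsto_mult tendsto_const tendsto_rabs_zero \<eta>)
      show "(\<lambda>i. 1 - t i / t (Suc i)) \<longlonglongrightarrow> 0" unfolding t_def by real_asymp
      show "(\<lambda>i. (t (Suc i) / (t (Suc i) - t i))\<^sup>2 / t (Suc i)) \<longlonglongrightarrow> 0" unfolding t_def by real_asymp
    qed
    then show "e \<longlonglongrightarrow> 0" unfolding e_def[abs_def] by simp
    show "\<forall>\<^sub>F i in sequentially. d (Suc i) \<le> \<rho> * d i + e i"
      using eventually_ge_at_top[of 1]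
    proof eventually_elim
      case (elim i)
      let ?s = "t i" and ?t = "t (Suc i)"
      have st: "1 \<le> ?s" "?s < ?t"
        using elim by (auto simp: t_def intro!: power_strict_mono one_le_power)
      then have t1: "1 \<le> ?t" and s0: "0 < ?s" and t0: "0 < ?t" by linarith+
      define w where "w = (area ?t + 1) / (?t - ?s)"
      obtain u where u: "u \<in> {?s..?t}" "W u \<le> w"
        using small_workload_time[of ?s ?t] st unfolding w_def by auto
      have w0: "0 \<le> w" using u(2) load_nonneg[of N z u] by linarith
      have w_le: "w \<le> (\<beta> + 1) * (?t / (?t - ?s))"
      proof -
        have "area ?t = b (Suc i) * ?t" using t0 by (simp add: b_def)
        also have "\<dots> \<le> \<beta> * ?t" using b_le t0 by (intro mult_right_mono) auto
        finally have "area ?t + 1 \<le> (\<beta> + 1) * ?t" using t1 by (simp add: algebra_simps)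
        then have "w \<le> (\<beta> + 1) * ?t / (?t - ?s)" unfolding w_def using st by (intro divide_right_mono) auto
        then show ?thesis by simp
      qed
      \<comment> \<open>Input and area are both monotone, so the identity at the intermediate time
        \<open>u\<close> bounds the input until \<open>?s\<close> by the area until
        \<open>?t\<close> plus a boundary term that is under control.\<close>
      have "?s * (\<rho> * b i + c + \<eta> i) = load_input ?s" using s0 by (simp add: \<eta>_def)
      also have "\<dots> \<le> load_input u" using u by (intro load_input_mono) auto
      also have "\<dots> = area u + (W u)\<^sup>2 / 2" using area_eq[of u] u st by simp
      also have "\<dots> \<le> area ?t + w\<^sup>2 / 2"
        using area_mono[of u ?t] u power_mono[OF u(2), of 2] by (intro add_mono divide_right_mono) auto
      finally have "(?s * (\<rho> * b i + c + \<eta> i)) / ?t \<le> (area ?t + w\<^sup>2 / 2) / ?t"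
        using t0 by (intro divide_right_mono) auto
      then have low: "?s / ?t * (\<rho> * b i + c + \<eta> i) \<le> b (Suc i) + w\<^sup>2 / 2 / ?t"
        by (simp add: b_def add_divide_distrib)
      have "w\<^sup>2 \<le> ((\<beta> + 1) * (?t / (?t - ?s)))\<^sup>2" by (rule power_mono[OF w_le w0])
      then have "w\<^sup>2 / 2 / ?t \<le> ((\<beta> + 1) * (?t / (?t - ?s)))\<^sup>2 / 2 / ?t"
        using t0 by (intro divide_right_mono) auto
      also have "\<dots> = (\<beta> + 1)\<^sup>2 / 2 * ((?t / (?t - ?s))\<^sup>2 / ?t)" unfolding power_mult_distrib by simp
      finally have w2: "w\<^sup>2 / 2 / ?t \<le> (\<beta> + 1)\<^sup>2 / 2 * ((?t / (?t - ?s))\<^sup>2 / ?t)" .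
      have "\<rho> * b i + c + \<eta> i \<le> \<rho> * \<beta> + c + h"
        using b_le[of i] \<rho> h(2)[of i] mult_left_mono[of "b i" \<beta> \<rho>] by (simp add: abs_le_iff)
      moreover have r: "0 \<le> 1 - ?s / ?t" using st t0 by simp
      ultimately have m: "(1 - ?s / ?t) * (\<rho> * b i + c + \<eta> i) \<le> (1 - ?s / ?t) * (\<rho> * \<beta> + c + h)"
        by (rule mult_left_mono)
      have "?v - b (Suc i) \<le> \<rho> * ?v + c - ?s / ?t * (\<rho> * b i + c + \<eta> i) + w\<^sup>2 / 2 / ?t"
        using low v_eq by linarith
      also have "\<dots> = \<rho> * (?v - b i) + (1 - ?s / ?t) * (\<rho> * b i + c + \<eta> i) - \<eta> i + w\<^sup>2 / 2 / ?t"
        by (simp add: algebra_simps)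
      also have "\<dots> \<le> \<rho> * (?v - b i) + e i"
        using m w2 unfolding e_def by linarith
      also have "\<dots> \<le> \<rho> * d i + e i" using \<rho> by (intro add_right_mono mult_left_mono) (auto simp: d_def)
      finally have "?v - b (Suc i) \<le> \<rho> * d i + e i" .
      moreover have "0 \<le> \<rho> * d i + e i"
        unfolding e_def d_def using \<rho> \<beta> c h r t0
        by (intro add_nonneg_nonneg mult_nonneg_nonneg) auto
      ultimately show ?case by (simp add: d_def)
    qed
  qed
  have "b \<longlonglongrightarrow> ?v"
  proof (rule tendsto_sandwich)
    show "\<forall>\<^sub>F i in sequentially. ?v - d i \<le> b i" by (intro always_eventually allI) (simp add: d_def)
    show "\<forall>\<^sub>F i in sequentially. b i \<le> ?v + \<eta> i / (1 - \<rho>)" using b_upper by simp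
    show "(\<lambda>i. ?v - d i) \<longlonglongrightarrow> ?v" using tendsto_diff[OF tendsto_const \<open>d \<longlonglongrightarrow> 0\<close>] by simp
    show "(\<lambda>i. ?v + \<eta> i / (1 - \<rho>)) \<longlonglongrightarrow> ?v"
      using tendsto_add[OF tendsto_const tendsto_divide[OF \<eta> tendsto_const, of "1 - \<rho>"], of ?v] \<rho> by simp
  qed
  then show ?thesis unfolding b_def t_def .
qed

text \<open>The sum of the waiting times is monotone in time and successive times
  \<open>i ^ 16\<close> have ratio tending to 1, so a single subsequence serves every
  \<open>\<beta>\<close>.\<close>

lemma wait_sum_limit:
  assumes j: "j \<in> {1..N}"
  shows "((\<lambda>u. wait_sum j u / u) \<longlongrightarrow> lam j * mean_load) at_top"
proof (rule monotone_ratio_tendsto)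
  show "mono (wait_sum j)"
    unfolding wait_sum_def using cnt_mono[OF j] by (intro monoI sum_mono2) auto
  show "0 \<le> wait_sum j u" for u unfolding wait_sum_def by (intro sum_nonneg) simp
  fix \<beta> :: real assume \<beta>: "1 < \<beta>"
  let ?t = "\<lambda>i. real i ^ 16"
  have "filterlim ?t at_top sequentially" by real_asymp
  moreover have "\<forall>\<^sub>F i in sequentially. ?t (Suc i) \<le> \<beta> * ?t i"
  proof -
    have "(\<lambda>i. ?t (Suc i) / ?t i) \<longlonglongrightarrow> 1" by real_asymp
    from order_tendstoD(2)[OF this \<beta>] eventually_ge_at_top[of 1] show ?thesis
      by eventually_elim (simp add: divide_less_eq)
  qed
  moreover have "(\<lambda>i. wait_sum j (?t i) / ?t i) \<longlonglongrightarrow> lam j * mean_load"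
    using tendsto_add[OF wait_sum_minus_area[OF j] tendsto_mult[OF tendsto_const area_limit, of "lam j"]] by simp
  ultimately show "\<exists>t. filterlim t at_top sequentially \<and> (\<forall>\<^sub>F k in sequentially. t (Suc k) \<le> \<beta> * t k) \<and>
    (\<lambda>k. wait_sum j (t k) / t k) \<longlonglongrightarrow> lam j * mean_load" by blast
qed

lemma arrival_ratio:
  assumes j: "j \<in> {1..N}" shows "(\<lambda>K. a j K / real K) \<longlonglongrightarrow> 1 / lam j"
proof -
  have "(\<lambda>K. g j (Suc K) / real (Suc K) * (real (Suc K) / real K)) \<longlonglongrightarrow> 1 / lam j * 1"
    by (intro tendsto_mult LIMSEQ_Suc g_ratio j) real_asymp
  then show ?thesis by (simp add: a_eq)
qed

lemma arrival_at_top: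
  assumes j: "j \<in> {1..N}" shows "filterlim (a j) at_top sequentially"
proof -
  have "filterlim (\<lambda>K. a j K / real K * real K) at_top sequentially"
    by (rule filterlim_tendsto_pos_mult_at_top[OF arrival_ratio[OF j]])
       (use rate_pos[OF j] filterlim_real_sequentially in auto)
  moreover have "\<forall>\<^sub>F K in sequentially. a j K / real K * real K = a j K"
    using eventually_gt_at_top[of 0] by eventually_elim simp
  ultimately show ?thesis by (subst (asm) filterlim_cong[OF refl refl])
qed

text \<open>The average over time is evaluated at arrival times: exactly \<open>K\<close> packets of
  the class arrive before packet \<open>K\<close>, and this takes a time of about
  \<open>K / lam j\<close>, which cancels the factor \<open>lam j\<close>.\<close>

lemma average_wait:
  assumes j: "j \<in> {1..N}"
  shows "(\<lambda>K. (\<Sum>k<K. W (a j k)) / real K) \<longlonglongrightarrow> mean_load"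
proof -
  have cnt_a: "cnt j (a j K) = K" for K
  proof -
    have "k < cnt j (a j K) \<longleftrightarrow> k < K" for k
      using less_cnt_iff[OF j, of k "a j K"] strict_mono_less[OF g_strict_mono[OF j], of "Suc k" "Suc K"]
      by (simp add: a_eq)
    then show ?thesis by (metis less_irrefl linorder_neqE_nat)
  qed
  have "(\<lambda>K. wait_sum j (a j K) / a j K * (a j K / real K)) \<longlonglongrightarrow> lam j * mean_load * (1 / lam j)"
    by (intro tendsto_mult filterlim_compose[OF wait_sum_limit[OF j] arrival_at_top[OF j]] arrival_ratio j)
  moreover have "wait_sum j (a j K) / a j K * (a j K / real K) = (\<Sum>k<K. W (a j k)) / real K" for K
  proof -
    have "0 < a j K" unfolding a_eq using strict_mono_less[OF g_strict_mono[OF j], of 0 "Suc K"] by (simp add: g_eq)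
    then show ?thesis by (simp add: wait_sum_def cnt_a)
  qed
  ultimately have "(\<lambda>K. (\<Sum>k<K. W (a j k)) / real K) \<longlonglongrightarrow> lam j * mean_load * (1 / lam j)"
    by (simp only:)
  then show ?thesis using rate_pos[OF j] by simp
qed

end

section \<open>The peak age\<close>

lemma fcfs_path_cong:
  assumes "fcfs_path N a s" and eq: "\<And>p. p \<in> packets N \<Longrightarrow> a p = a' p" "\<And>p. p \<in> packets N \<Longrightarrow> s p = s' p"
  shows "fcfs_path N a' s'"
proof -
  interpret fcfs_path N a s by fact
  show ?thesis
  proof
    show "inj_on a' (packets N)" using arrivals_distinct eq(1) by (simp cong: inj_on_cong)
    have "{q \<in> packets N. a' q \<le> u} = {q \<in> packets N. a q \<le> u}" for u using eq(1) by auto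
    then show "finite {q \<in> packets N. a' q \<le> u}" for u using locally_finite by simp
  qed (use classes arrival_pos service_pos eq in auto)
qed

context multiclass_MG1 begin

definition coordinate :: "(nat \<times> nat) + (nat \<times> nat) \<Rightarrow> 'a \<Rightarrow> real" where
  "coordinate i = (case i of Inl (n, k) \<Rightarrow> T n k | Inr (n, k) \<Rightarrow> S n k)"

definition sample_path :: "'a \<Rightarrow> mg1_path" where
  "sample_path \<omega> = (\<lambda>i\<in>packets N <+> packets N. coordinate i \<omega>)"

lemma coordinate_simps [simp]: "coordinate (Inl (n, k)) = T n k" "coordinate (Inr (n, k)) = S n k"
  by (simp_all add: coordinate_def)

lemma indep_coordinates: "indep_vars (\<lambda>_. borel) coordinate (packets N <+> packets N)"
  using independent unfolding coordinate_def[abs_def] .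

lemma coordinate_measurable: "i \<in> packets N <+> packets N \<Longrightarrow> coordinate i \<in> borel_measurable M"
  using indep_coordinates by (auto simp: indep_vars_def)

lemma interarrival_measurable: "n \<in> {1..N} \<Longrightarrow> T n k \<in> borel_measurable M"
  using coordinate_measurable[of "Inl (n, k)"] by (simp add: packets_def Plus_def)

lemma service_measurable: "n \<in> {1..N} \<Longrightarrow> S n k \<in> borel_measurable M"
  using coordinate_measurable[of "Inr (n, k)"] by (simp add: packets_def Plus_def)

lemma sample_path_simps:
  assumes "n \<in> {1..N}"
  shows "sample_path \<omega> (Inl (n, k)) = T n k \<omega>" "sample_path \<omega> (Inr (n, k)) = S n k \<omega>"
  using assms by (simp_all add: sample_path_def packets_def Plus_def)

lemma indep_class:
  assumes n: "n \<in> {1..N}"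
  shows "indep_vars (\<lambda>_. borel) (T n) UNIV" "indep_vars (\<lambda>_. borel) (S n) UNIV"
proof -
  have sub: "indep_vars (\<lambda>_. borel) (\<lambda>k. coordinate (f k)) UNIV"
    if "inj f" "range f \<subseteq> packets N <+> packets N" for f :: "nat \<Rightarrow> _"
    by (rule indep_vars_reindex[OF that(1) indep_vars_subset[OF indep_coordinates that(2)]])
  have "range (\<lambda>k. Inl (n, k)) \<subseteq> packets N <+> packets N"
    "range (\<lambda>k. Inr (n, k)) \<subseteq> packets N <+> packets N"
    using n by (auto simp: packets_def Plus_def)
  from sub[OF _ this(1)] sub[OF _ this(2)]
  show "indep_vars (\<lambda>_. borel) (T n) UNIV" "indep_vars (\<lambda>_. borel) (S n) UNIV"
    by (simp_all add: inj_on_def)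
qed

lemma mg1_model:
  assumes "1 \<le> N" and "(\<Sum>j=1..N. lam j * x j) < 1"
  shows "mg1_model N lam x y (\<lambda>n. distr M borel (S n 0))"
proof (rule mg1_model.intro)
  fix n assume n: "n \<in> {1..N}"
  note [measurable] = service_measurable[OF n]
  show "0 < lam n" by (rule rate_pos[OF n])
  show "prob_space (distr M borel (S n 0))" by (rule prob_space_distr) measurable
  show "AE r in distr M borel (S n 0). 0 < r" using service_pos[OF n, of 0] by (simp add: AE_distr_iff)
  show "has_bochner_integral (distr M borel (S n 0)) (\<lambda>r. r) (x n)"
    using service_mean[OF n, of 0] by (simp add: has_bochner_integral_iff integrable_distr_eq integral_distr)
  show "has_bochner_integral (distr M borel (S n 0)) (\<lambda>r. r\<^sup>2) (y n)"
    using service_second_moment[OF n, of 0] by (simp add: has_bochner_integral_iff integrable_distr_eq integral_distr)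
qed (use assms in auto)

text \<open>The law of \<open>sample_path\<close> is the product measure \<open>Mod.P\<close>, so
  almost sure properties of the canonical model can be pulled back. The laws of large numbers are
  taken on the original space, where the independence of the sequences is given.\<close>

lemma AE_mg1_sample:
  assumes N: "1 \<le> N" and stable: "(\<Sum>j=1..N. lam j * x j) < 1"
  shows "AE \<omega> in M. mg1_sample N lam x y (\<lambda>n. distr M borel (S n 0)) (sample_path \<omega>)"
proof -
  interpret Mod: mg1_model N lam x y "\<lambda>n. distr M borel (S n 0)" by (rule mg1_model[OF assms])
  let ?I = "packets N <+> packets N"
  have ne: "?I \<noteq> {}" using N by (auto simp: packets_def)
  have law: "distr M (PiM ?I (\<lambda>_. borel)) sample_path = Mod.P"
  proof -
    have "distr M (PiM ?I (\<lambda>_. borel)) (\<lambda>\<omega>. \<lambda>i\<in>?I. coordinate i \<omega>) = PiM ?I (\<lambda>i. distr M borel (coordinate i))"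
      using indep_vars_iff_distr_eq_PiM'[OF ne, where M'="\<lambda>_. borel" and X=coordinate] coordinate_measurable indep_coordinates by blast
    also have "\<dots> = Mod.P"
      unfolding Mod.P_def
    proof (intro PiM_cong refl)
      fix i assume i: "i \<in> ?I"
      then obtain n k where nk: "n \<in> {1..N}" "i = Inl (n, k) \<or> i = Inr (n, k)" by (auto simp: packets_def)
      show "distr M borel (coordinate i) = Mod.D i"
      proof (cases "i = Inl (n, k)")
        case True
        have "distr M borel (T n k) = distr M lborel (T n k)" by (rule distr_cong) auto
        also have "\<dots> = exponential_distr (lam n)"
          unfolding exponential_distr_def using interarrival_exponential[OF nk(1), of k]
          by (simp add: distributed_def)
        finally show ?thesis using True by simp
      next
        case False
        then show ?thesis using nk service_identical[OF nk(1), of k] by simp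
      qed
    qed
    finally show ?thesis by (simp add: sample_path_def[abs_def])
  qed
  have path_meas: "sample_path \<in> M \<rightarrow>\<^sub>M PiM ?I (\<lambda>_. borel)"
    unfolding sample_path_def[abs_def] by (rule measurable_restrict) (rule coordinate_measurable)
  have transfer: "AE \<omega> in M. Q (sample_path \<omega>)" if "AE z in Mod.P. Q z" for Q
    by (rule AE_distrD[OF path_meas]) (unfold law, rule that)
  have path: "AE \<omega> in M. fcfs_path N (arrival (sample_path \<omega>)) (sample_path \<omega> \<circ> Inr)"
    by (rule transfer[OF Mod.AE_fcfs_path])
  have pos: "AE \<omega> in M. \<forall>i\<in>?I. 0 < sample_path \<omega> i"
    by (rule transfer[OF Mod.AE_pos])
  have noise: "AE \<omega> in M. \<forall>j\<in>{1..N}.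
      (\<lambda>i. (\<Sum>k<nat \<lceil>2 * lam j\<rceil> * i ^ 16. Mod.service_noise j (real i ^ 16) (real i ^ 14) k (sample_path \<omega>)) / real i ^ 16) \<longlonglongrightarrow> 0 \<and>
      (\<lambda>i. (\<Sum>k<nat \<lceil>2 * lam j\<rceil> * i ^ 16. Mod.arrival_noise j (real i ^ 16) (real i ^ 14) k (sample_path \<omega>)) / real i ^ 16) \<longlonglongrightarrow> 0"
    unfolding AE_ball_countable[OF countable_finite[OF finite_atLeastAtMost]]
    by (intro ballI AE_conjI transfer[OF Mod.AE_service_noise_tendsto] transfer[OF Mod.AE_arrival_noise_tendsto])
  have lln: "AE \<omega> in M. \<forall>j\<in>{1..N}.
      (\<exists>C\<ge>0. \<forall>k K. K \<le> k ^ 4 \<longrightarrow> \<bar>(\<Sum>i<K. T j i \<omega>) - 1 / lam j * real K\<bar> \<le> C * real k ^ 3) \<and>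
      (\<exists>C\<ge>0. \<forall>k K. K \<le> k ^ 4 \<longrightarrow> \<bar>(\<Sum>i<K. S j i \<omega>) - x j * real K\<bar> \<le> C * real k ^ 3) \<and>
      (\<lambda>K. (\<Sum>i<K. (S j i \<omega>)\<^sup>2) / real K) \<longlonglongrightarrow> y j"
    unfolding AE_ball_countable[OF countable_finite[OF finite_atLeastAtMost]]
  proof (intro ballI AE_conjI)
    fix j assume j: "j \<in> {1..N}"
    have orth: "(\<integral>\<omega>. (Y l \<omega> - c) * (Y k \<omega> - c) \<partial>M) = 0"
      if ind: "indep_vars (\<lambda>_. borel) Y UNIV" and Y: "\<And>k. integrable M (Y k)" "\<And>k. (\<integral>\<omega>. Y k \<omega> \<partial>M) = c" and "l < k"
      for Y :: "nat \<Rightarrow> 'a \<Rightarrow> real" and c l k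
    proof -
      have "indep_vars (\<lambda>_. borel) (\<lambda>i \<omega>. Y i \<omega> - c) {l, k}"
        by (rule indep_vars_compose2[OF indep_vars_subset[OF ind subset_UNIV]]) measurable
      from indep_vars_lebesgue_integral[OF _ this] show ?thesis
        using that by (simp add: prob_space)
    qed
    note T = exponential_moments[OF prob_space_axioms interarrival_exponential[OF j] rate_pos[OF j]]
    show "AE \<omega> in M. \<exists>C\<ge>0. \<forall>k K. K \<le> k ^ 4 \<longrightarrow> \<bar>(\<Sum>i<K. T j i \<omega>) - 1 / lam j * real K\<bar> \<le> C * real k ^ 3"
    proof (rule lln_rate)
      show "\<And>k. T j k \<in> borel_measurable M" by (rule interarrival_measurable[OF j])
      show "AE \<omega> in M. 0 \<le> T j k \<omega>" for k
        using pos
      proof eventually_elim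
        case (elim \<omega>)
        have "Inl (j, k) \<in> ?I" using j by (auto simp: packets_def)
        from elim[rule_format, OF this] show ?case by (simp add: sample_path_simps[OF j])
      qed
      show "0 \<le> 1 / lam j" using rate_pos[OF j] by simp
      show "0 \<le> 1 / (lam j)\<^sup>2" by simp
      show "\<And>k l. l < k \<Longrightarrow> (\<integral>\<omega>. (T j l \<omega> - 1 / lam j) * (T j k \<omega> - 1 / lam j) \<partial>M) = 0"
        by (rule orth[OF indep_class(1)[OF j]]) (use T in auto)
    qed (use T in auto)
    have S: "integrable M (S j k)" "(\<integral>\<omega>. S j k \<omega> \<partial>M) = x j" "integrable M (\<lambda>\<omega>. (S j k \<omega>)\<^sup>2)"
      "(\<integral>\<omega>. (S j k \<omega>)\<^sup>2 \<partial>M) = y j" for k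
      using service_mean[OF j, of k] service_second_moment[OF j, of k] by (auto simp: has_bochner_integral_iff)
    have eq: "(\<lambda>\<omega>. (S j k \<omega> - x j)\<^sup>2) = (\<lambda>\<omega>. (S j k \<omega>)\<^sup>2 + (x j)\<^sup>2 - 2 * x j * S j k \<omega>)" for k
      by (simp add: power2_eq_square algebra_simps fun_eq_iff)
    show "AE \<omega> in M. \<exists>C\<ge>0. \<forall>k K. K \<le> k ^ 4 \<longrightarrow> \<bar>(\<Sum>i<K. S j i \<omega>) - x j * real K\<bar> \<le> C * real k ^ 3"
    proof (rule lln_rate)
      show "\<And>k. S j k \<in> borel_measurable M" by (rule service_measurable[OF j])
      show "AE \<omega> in M. 0 \<le> S j k \<omega>" for k using service_pos[OF j, of k] by eventually_elim simp
      show "0 \<le> x j" "0 \<le> y j" using Mod.service_integrals[OF j] by auto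
      show "integrable M (\<lambda>\<omega>. (S j k \<omega> - x j)\<^sup>2)" for k unfolding eq using S by simp
      show "(\<integral>\<omega>. (S j k \<omega> - x j)\<^sup>2 \<partial>M) \<le> y j" for k
        unfolding eq using S by (simp add: prob_space power2_eq_square)
      show "\<And>k l. l < k \<Longrightarrow> (\<integral>\<omega>. (S j l \<omega> - x j) * (S j k \<omega> - x j) \<partial>M) = 0"
        by (rule orth[OF indep_class(2)[OF j]]) (use S in auto)
    qed
    \<comment> \<open>The squares have a finite mean but possibly no variance, so
      \<open>lln_rate\<close> cannot be applied to them.\<close>
    have "AE \<omega> in M. (\<lambda>K. (\<Sum>i<K. (S j i \<omega>)\<^sup>2) / real K) \<longlonglongrightarrow> expectation (\<lambda>\<omega>. (S j 0 \<omega>)\<^sup>2)"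
    proof (rule strong_law_nonneg)
      show "indep_vars (\<lambda>_. borel) (\<lambda>k \<omega>. (S j k \<omega>)\<^sup>2) UNIV"
        by (rule indep_vars_compose2[OF indep_class(2)[OF j]]) measurable
      show "distr M borel (\<lambda>\<omega>. (S j k \<omega>)\<^sup>2) = distr M borel (\<lambda>\<omega>. (S j 0 \<omega>)\<^sup>2)" for k
        using arg_cong[OF service_identical[OF j, of k], of "\<lambda>D. distr D borel (\<lambda>r. r\<^sup>2)"]
          service_measurable[OF j] by (simp add: distr_distr comp_def)
    qed (use S in auto)
    then show "AE \<omega> in M. (\<lambda>K. (\<Sum>i<K. (S j i \<omega>)\<^sup>2) / real K) \<longlonglongrightarrow> y j" using S(4)[of 0] by simp
  qed
  from path pos noise lln AE_space show ?thesis
  proof eventually_elim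
    case (elim \<omega>)
    show ?case
    proof (intro mg1_sample.intro mg1_sample_axioms.intro Mod.mg1_model_axioms)
      show "fcfs_path N (arrival (sample_path \<omega>)) (sample_path \<omega> \<circ> Inr)" by (rule elim)
      show "0 < sample_path \<omega> i" if "i \<in> ?I" for i using elim that by blast
      show "sample_path \<omega> \<in> space Mod.P"
        using measurable_space[OF path_meas] elim sets_eq_imp_space_eq[OF Mod.sets_P] by simp
      fix j assume j: "j \<in> {1..N}"
      note lln = bspec[OF elim(4) j]
      show "\<exists>C\<ge>0. \<forall>k K. K \<le> k ^ 4 \<longrightarrow>
          \<bar>(\<Sum>i<K. sample_path \<omega> (Inl (j, i))) - 1 / lam j * real K\<bar> \<le> C * real k ^ 3"
        unfolding sample_path_simps[OF j] by (rule conjunct1[OF lln])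
      show "\<exists>C\<ge>0. \<forall>k K. K \<le> k ^ 4 \<longrightarrow>
          \<bar>(\<Sum>i<K. sample_path \<omega> (Inr (j, i))) - x j * real K\<bar> \<le> C * real k ^ 3"
        unfolding sample_path_simps[OF j] by (rule conjunct1[OF conjunct2[OF lln]])
      show "(\<lambda>K. (\<Sum>i<K. (sample_path \<omega> (Inr (j, i)))\<^sup>2) / real K) \<longlonglongrightarrow> y j"
        unfolding sample_path_simps[OF j] by (rule conjunct2[OF conjunct2[OF lln]])
    qed (rule conjunct1[OF bspec[OF elim(3)]] conjunct2[OF bspec[OF elim(3)]], assumption)+
  qed
qed

end

theorem proposition2:
  fixes M :: "'a measure" and N n :: nat
    and lam x y \<delta> :: "nat \<Rightarrow> real"
    and T S :: "nat \<Rightarrow> nat \<Rightarrow> 'a \<Rightarrow> real"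
  assumes "multiclass_MG1 M N lam x y T S"
    and "(\<Sum>j=1..N. lam j * x j) < 1"
    and "n \<in> {1..N}"
    and "\<And>j. j \<in> {1..N} \<Longrightarrow> 0 \<le> \<delta> j"
  shows "has_peak_age M N T S \<delta> n
    (1 / lam n + x n + (\<Sum>j=1..N. lam j * y j) / (2 * (1 - (\<Sum>j=1..N. lam j * x j))))"
proof -
  interpret multiclass_MG1 M N lam x y T S by fact
  note n = assms(3)
  have N: "1 \<le> N" using n by simp
  show ?thesis
    unfolding has_peak_age_def using AE_mg1_sample[OF N assms(2)]
  proof eventually_elim
    case (elim \<omega>)
    interpret mg1_sample N lam x y "\<lambda>n. distr M borel (S n 0)" "sample_path \<omega>" by (rule elim)
    let ?a = "generation_time T \<omega>" and ?s = "\<lambda>(n, k). S n k \<omega>"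
    have gen: "?a p = arrival (sample_path \<omega>) p" if "p \<in> packets N" for p
      using that by (auto simp: generation_time_def arrival_def packets_def sample_path_simps intro!: sum.cong)
    have srv: "?s p = (sample_path \<omega> \<circ> Inr) p" if "p \<in> packets N" for p
      using that by (auto simp: packets_def sample_path_simps)
    \<comment> \<open>\<open>sample_path\<close> is restricted to the coordinates of packets of the
      classes \<open>1\<close> to \<open>N\<close>, so it is on \<open>packets N\<close> that its
      queue is identified with the given one.\<close>
    interpret Q: fcfs_path N ?a ?s
      by (rule fcfs_path_cong[OF path]) (simp_all add: gen srv)
    define w where "w k = load N (sample_path \<omega>) (arrival (sample_path \<omega>) (n, k))" for k
    define \<tau> where "\<tau> K = (\<Sum>i<K. T n i \<omega>)" for K
    have nk: "(n, k) \<in> packets N" for k using n by (simp add: packets_def)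
    have a: "?a (n, k) = \<tau> (Suc k)" for k
      by (simp add: generation_time_def \<tau>_def lessThan_Suc_atMost)
    have T_pos: "0 < T n k \<omega>" for k using z_pos(1)[OF n, of k] by (simp add: sample_path_simps[OF n])
    have d: "fcfs_departure N ?a ?s (n, k) = \<tau> (Suc k) + w k + S n k \<omega>" for k
    proof -
      have "workload N ?a ?s (?a (n, k)) = w k"
        unfolding w_def load_def gen[OF nk, of k] by (rule workload_cong) (simp_all add: gen srv)
      then show ?thesis using Q.fcfs_departure_eq[OF nk[of k]] a by simp
    qed
    let ?d = "\<lambda>k. reception_time N T S \<omega> (n, k)"
    have recv: "?d k = fcfs_departure N ?a ?s (n, k)" for k by (simp add: reception_time_def)
    have lim_T: "(\<lambda>K. \<tau> K / real K) \<longlonglongrightarrow> 1 / lam n"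
      using g_ratio[OF n] by (simp add: prev_arrival_def \<tau>_def sample_path_simps[OF n])
    have peaks: "peak (entity_age N T S \<delta> n \<omega>) (Suc k) =
      ?d k + (case k of 0 \<Rightarrow> \<delta> n | Suc i \<Rightarrow> - ?a (n, i))" for k
      unfolding entity_age_def
    proof (rule status_age_peak)
      show "strict_mono ?d"
        unfolding strict_mono_Suc_iff recv
        by (intro allI Q.fcfs_departure_mono nk) (simp add: a \<tau>_def T_pos)
      show "?a (n, k) < ?a (n, Suc k)" for k by (simp add: a \<tau>_def T_pos)
      \<comment> \<open>With \<open>0 \<le> \<delta> n\<close> the first reception is a drop of the
        age as well.\<close>
      show "- \<delta> n < ?a (n, 0)" using assms(4)[OF n] T_pos[of 0] by (simp add: a \<tau>_def)
      show "filterlim ?d at_top sequentially"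
      proof (rule filterlim_at_top_mono[OF arrival_at_top[OF n]])
        have "arrival (sample_path \<omega>) (n, k) \<le> ?d k" for k
        proof -
          have "arrival (sample_path \<omega>) (n, k) = \<tau> (Suc k)" using gen[OF nk, of k] a[of k] by simp
          moreover have "0 \<le> w k" by (simp add: w_def)
          moreover have "0 < S n k \<omega>" using z_pos(2)[OF n, of k] by (simp only: sample_path_simps[OF n])
          ultimately show ?thesis unfolding recv d by linarith
        qed
        then show "\<forall>\<^sub>F k in sequentially. arrival (sample_path \<omega>) (n, k) \<le> ?d k" by simp
      qed
    qed
    \<comment> \<open>A peak is an interarrival time plus the waiting and the service time of the
      packet received, so the generation times telescope. The first peak contains
      \<open>\<delta> n\<close> in addition, which vanishes in the average.\<close>
    have total: "(\<Sum>k=1..K. peak (entity_age N T S \<delta> n \<omega>) k) =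
      (if K = 0 then 0 else \<delta> n) + \<tau> K + (\<Sum>k<K. w k) + (\<Sum>k<K. S n k \<omega>)" for K
    proof (induction K)
      case (Suc K)
      have "peak (entity_age N T S \<delta> n \<omega>) (Suc K) =
        \<tau> (Suc K) + w K + S n K \<omega> + (if K = 0 then \<delta> n else - \<tau> K)"
        unfolding peaks recv d by (cases K) (simp_all add: a)
      then show ?case using Suc by (simp add: \<tau>_def)
    qed (simp add: \<tau>_def)
    have "(\<lambda>K. (if K = 0 then 0 else \<delta> n) / real K + \<tau> K / real K + (\<Sum>k<K. w k) / real K
        + (\<Sum>k<K. S n k \<omega>) / real K) \<longlonglongrightarrow> 0 + 1 / lam n + mean_load + x n"
    proof (intro tendsto_add lim_T)
      have "(\<lambda>K. \<delta> n / real K) \<longlonglongrightarrow> 0" by (intro tendsto_divide_0[OF tendsto_const] filterlim_at_top_imp_at_infinity filterlim_real_sequentially)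
      then show "(\<lambda>K. (if K = 0 then 0 else \<delta> n) / real K) \<longlonglongrightarrow> 0"
        by (rule Lim_transform_eventually) (use eventually_gt_at_top[of 0] in eventually_elim, simp)
      show "(\<lambda>K. (\<Sum>k<K. w k) / real K) \<longlonglongrightarrow> mean_load"
        unfolding w_def by (rule average_wait[OF n])
      obtain C where "0 \<le> C" "\<And>k K. K \<le> k ^ 4 \<Longrightarrow> \<bar>(\<Sum>i<K. S n i \<omega>) - x n * real K\<bar> \<le> C * real k ^ 3"
        using service_lln[OF n] unfolding sample_path_simps[OF n] by blast
      then show "(\<lambda>K. (\<Sum>k<K. S n k \<omega>) / real K) \<longlonglongrightarrow> x n" by (intro lln_rate_imp_tendsto) auto
    qed
    then show ?case
      unfolding total by (simp add: add_divide_distrib mean_load_def add_ac)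
  qed
qed

end
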